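(* Let $f:S^n\to S^m$ be an LOMSE of Type (II). Then its associated Lawson–Osserman cone $C_{f,\theta}\subset\mathbb R^{m+n+2}$ is an unstable minimal cone.
   Context: **Lawson–Osserman maps, spheres and cones.** A smooth map $f:S^n\to S^m$ between unit spheres is a Lawson–Osserman map (LOM) if there is an acute angle $\theta\in(0,\pi/2)$ such that $M_{f,\theta}=\{(\cos\theta\, x,\ \sin\theta\, f(x)): x\in S^n\}$ is a minimal submanifold of the unit sphere $S^{m+n+1}\subset\mathbb R^{m+n+2}$. The cone $C_{f,\theta}=\{t y: y\in M_{f,\theta},\ t\ge 0\}\subset \mathbb R^{m+n+2}$ over $M_{f,\theta}$ is the associated Lawson–Osserman cone (LOC); it is minimal away from the origin. **LOMSE.** An LOM $f$ is an LOMSE if at each $x\in S^n$ all nonzero singular values of the differential $(f_* )_x:T_xS^n\to T_{f(x)}S^m$ (with respect to the standard round metrics) are equal, i.e. the set of singular values is $\{0,\lambda\}$ with $\lambda>0$. For an LOMSE it is known that $\lambda$ and the multiplicity $p$ of $\lambda$ (so $0$ has multiplicity $n-p>0$) do not depend on $x$; that $f=i\circ\pi$ where $\pi$ is a Hopf fibration from $S^n$ onto a complex, quaternionic or octonionic projective space $(\mathbb P^p,h)$ of real dimension $p$ and $i:(\mathbb P^p,\lambda^2h)\to S^m$ is a minimal isometric immersion; and that the $m+1$ components of $f$ are spherical harmonics of a common even degree $k$, with $\lambda=\sqrt{k(k+n-1)/p}$. One says $f$ (and its LOC) is of $(n,p,k)$-type. The angle is then determined by $\tan^2\theta=\dfrac{p-n\lambda^{-2}}{n-p}$.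 **Type (II).** $f$ (and its LOC) is of Type (II) if $(n,p)=(3,2)$ and $k\ge 4$, or $(n,p)=(5,4)$ and $k\ge 6$. **Instability.** A minimal cone $C$ with an isolated singularity at the origin is unstable if there is a smooth normal vector field compactly supported in $C\setminus\{0\}$ along which the second variation of volume is negative. *)

theory Defs
  imports "HOL-Analysis.Analysis"
begin

section \<open>Smooth maps and submanifolds of Euclidean spaces\<close>

text \<open>Meant for open sets: derivatives are taken with respect to the ambient space.\<close>

primrec Ck_on :: "nat \<Rightarrow> 'a::euclidean_space set \<Rightarrow> ('a \<Rightarrow> 'b::real_normed_vector) \<Rightarrow> bool" where
  "Ck_on 0 U f \<longleftrightarrow> continuous_on U f"
| "Ck_on (Suc k) U f \<longleftrightarrow> (\<forall>x\<in>U. f differentiable (at x)) \<and>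
     (\<forall>v. Ck_on k U (\<lambda>x. frechet_derivative f (at x) v))"

text \<open>Smoothness on an arbitrary set means that a smooth extension exists near every point.\<close>

definition smooth_on :: "'a::euclidean_space set \<Rightarrow> ('a \<Rightarrow> 'b::real_normed_vector) \<Rightarrow> bool" where
  "smooth_on S f \<longleftrightarrow>
     (\<forall>x\<in>S. \<exists>U g. open U \<and> x \<in> U \<and> (\<forall>k. Ck_on k U g) \<and> (\<forall>y\<in>S \<inter> U. g y = f y))"

text \<open>An embedded smooth submanifold of dimension \<open>d\<close>, described by slice charts
  \<open>\<Phi>\<close> (with smooth inverse \<open>\<Psi>\<close>) of the ambient space.\<close>

definition submanifold :: "nat \<Rightarrow> 'e::euclidean_space set \<Rightarrow> bool" where
  "submanifold d S \<longleftrightarrow>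
     (\<forall>x\<in>S. \<exists>U (\<Phi> :: 'e \<Rightarrow> 'e) (\<Psi> :: 'e \<Rightarrow> 'e) L.
        open U \<and> x \<in> U \<and> open (\<Phi> ` U) \<and> smooth_on U \<Phi> \<and> smooth_on (\<Phi> ` U) \<Psi> \<and>
        (\<forall>y\<in>U. \<Psi> (\<Phi> y) = y) \<and>
        subspace L \<and> dim L = d \<and> \<Phi> ` (S \<inter> U) = L \<inter> \<Phi> ` U)"

definition tangent_space :: "'e::euclidean_space set \<Rightarrow> 'e \<Rightarrow> 'e set" where
  "tangent_space S x =
     {v. \<exists>(\<gamma> :: real \<Rightarrow> 'e) \<epsilon>. \<epsilon> > 0 \<and> smooth_on {-\<epsilon><..<\<epsilon>} \<gamma> \<and> \<gamma> ` {-\<epsilon><..<\<epsilon>} \<subseteq> S \<and>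
         \<gamma> 0 = x \<and> (\<gamma> has_vector_derivative v) (at 0)}"

section \<open>Second fundamental form and minimality\<close>

definition normal_space :: "'e::euclidean_space set \<Rightarrow> 'e set \<Rightarrow> 'e \<Rightarrow> 'e set" where
  "normal_space N S x = {w \<in> tangent_space N x. \<forall>v\<in>tangent_space S x. w \<bullet> v = 0}"

definition orth_proj :: "'e::euclidean_space set \<Rightarrow> 'e \<Rightarrow> 'e" where
  "orth_proj L v = (THE w. w \<in> L \<and> (\<forall>u\<in>L. (v - w) \<bullet> u = 0))"

definition tangent_extension :: "'e::euclidean_space set \<Rightarrow> 'e \<Rightarrow> 'e \<Rightarrow> ('e \<Rightarrow> 'e) \<Rightarrow> bool" where
  "tangent_extension S x w Y \<longleftrightarrow>
     (\<exists>U. open U \<and> x \<in> U \<and> smooth_on (S \<inter> U) Y \<and> (\<forall>y\<in>S \<inter> U. Y y \<in> tangent_space S y)) \<and> Y x = w"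

text \<open>The second fundamental form of \<open>S\<close> in the submanifold \<open>N\<close> of the Euclidean space.
  The Levi-Civita connection of \<open>N\<close> is the tangential part of the flat derivative, so the form is
  the component of \<open>D\<^sub>v Y\<close> in the normal space of \<open>S\<close> in \<open>N\<close>, for any tangential extension \<open>Y\<close> of
  \<open>w\<close>. The derivative within \<open>S\<close> is uniquely determined on vectors \<open>v\<close> tangent to \<open>S\<close>, and the
  normal component does not depend on \<open>Y\<close>.\<close>

definition second_fundamental_form ::
    "'e::euclidean_space set \<Rightarrow> 'e set \<Rightarrow> 'e \<Rightarrow> 'e \<Rightarrow> 'e \<Rightarrow> 'e" where
  "second_fundamental_form N S x v w =
     (let Y = (SOME Y. tangent_extension S x w Y)
      in orth_proj (normal_space N S x) (frechet_derivative Y (at x within S) v))"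

definition orthonormal_basis :: "'e::euclidean_space set \<Rightarrow> 'e set \<Rightarrow> bool" where
  "orthonormal_basis L E \<longleftrightarrow> pairwise orthogonal E \<and> (\<forall>e\<in>E. norm e = 1) \<and> span E = L"

text \<open>The trace (not divided by the dimension); it is independent of the orthonormal basis.\<close>

definition mean_curvature :: "'e::euclidean_space set \<Rightarrow> 'e set \<Rightarrow> 'e \<Rightarrow> 'e" where
  "mean_curvature N S x =
     (let E = (SOME E. orthonormal_basis (tangent_space S x) E)
      in \<Sum>e\<in>E. second_fundamental_form N S x e e)"

definition minimal_submanifold :: "nat \<Rightarrow> 'e::euclidean_space set \<Rightarrow> 'e set \<Rightarrow> bool" where
  "minimal_submanifold d S N \<longleftrightarrow>
     submanifold d S \<and> S \<subseteq> N \<and> (\<forall>x\<in>S. mean_curvature N S x = 0)"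

definition minimal_cone :: "nat \<Rightarrow> 'e::euclidean_space set \<Rightarrow> bool" where
  "minimal_cone d C \<longleftrightarrow> cone C \<and> minimal_submanifold d (C - {0}) UNIV"

section \<open>Second variation of volume\<close>

definition local_parametrization ::
    "'e::euclidean_space set \<Rightarrow> (real^'p \<Rightarrow> 'e) \<Rightarrow> (real^'p) set \<Rightarrow> bool" where
  "local_parametrization S \<phi> U \<longleftrightarrow>
     open U \<and> smooth_on U \<phi> \<and> (\<forall>u\<in>U. inj (frechet_derivative \<phi> (at u))) \<and>
     openin (top_of_set S) (\<phi> ` U) \<and> (\<exists>\<psi>. homeomorphism U (\<phi> ` U) \<phi> \<psi>)"

text \<open>The volume density: the root of the Gram determinant of the partial derivatives.\<close>

definition volume_density :: "(real^'p \<Rightarrow> 'e::euclidean_space) \<Rightarrow> real^'p \<Rightarrow> real" where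
  "volume_density \<phi> u =
     (let D = frechet_derivative \<phi> (at u)
      in sqrt (det (\<chi> i j. D (axis i 1) \<bullet> D (axis j 1))))"

text \<open>A finite family of disjoint parametrized Borel pieces \<open>\<phi> ` B\<close> of \<open>S\<close>, each relatively compact
  in its coordinate patch, that covers \<open>K\<close>.\<close>

definition patchwork ::
    "'e::euclidean_space set \<Rightarrow> 'e set \<Rightarrow> ((real^'p \<Rightarrow> 'e) \<times> (real^'p) set) set \<Rightarrow> bool" where
  "patchwork S K P \<longleftrightarrow>
     finite P \<and> disjoint_family_on (\<lambda>(\<phi>, B). \<phi> ` B) P \<and> K \<subseteq> (\<Union>(\<phi>, B)\<in>P. \<phi> ` B) \<and>
     (\<forall>(\<phi>, B)\<in>P. B \<in> sets borel \<and>
        (\<exists>U. local_parametrization S \<phi> U \<and> bounded B \<and> closure B \<subseteq> U))"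

text \<open>The volume of the image of the patchwork under \<open>x \<mapsto> x + s V(x)\<close>.\<close>

definition varied_volume ::
    "((real^'p \<Rightarrow> 'e::euclidean_space) \<times> (real^'p) set) set \<Rightarrow> ('e \<Rightarrow> 'e) \<Rightarrow> real \<Rightarrow> real" where
  "varied_volume P V s =
     (\<Sum>(\<phi>, B)\<in>P. LINT u:B|lborel. volume_density (\<lambda>u. \<phi> u + s *\<^sub>R V (\<phi> u)) u)"

text \<open>Instability of the cone \<open>C\<close>, whose dimension is the cardinality of the index type \<open>'p\<close>.
  As \<open>V\<close> vanishes off the compact set \<open>K\<close>, the second derivative at \<open>0\<close> does not depend on the
  choice of the patchwork \<open>P\<close> covering \<open>K\<close>; as \<open>C\<close> is minimal, it depends on the variation only
  through its initial velocity \<open>V\<close>.\<close>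

definition unstable_cone :: "'p::finite itself \<Rightarrow> 'e::euclidean_space set \<Rightarrow> bool" where
  "unstable_cone _ C \<longleftrightarrow>
     (\<exists>V K (P :: ((real^'p \<Rightarrow> 'e) \<times> (real^'p) set) set).
        smooth_on (C - {0}) V \<and> (\<forall>x\<in>C - {0}. V x \<in> normal_space UNIV (C - {0}) x) \<and>
        compact K \<and> K \<subseteq> C - {0} \<and> (\<forall>x\<in>C - {0} - K. V x = 0) \<and>
        patchwork (C - {0}) K P \<and>
        (\<exists>A' q. (\<forall>\<^sub>F s in nhds 0. (varied_volume P V has_real_derivative A' s) (at s)) \<and>
                (A' has_real_derivative q) (at 0) \<and> q < 0))"

section \<open>Lawson-Osserman maps and cones\<close>

text \<open>Maps between the unit spheres of \<open>real^'a\<close> and \<open>real^'b\<close> are represented by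
  functions on the whole space of which only the values on the unit sphere matter.\<close>

definition LO_link :: "(real^'a \<Rightarrow> real^'b) \<Rightarrow> real \<Rightarrow> ((real^'a) \<times> (real^'b)) set" where
  "LO_link f \<theta> = {(cos \<theta> *\<^sub>R x, sin \<theta> *\<^sub>R f x) | x. x \<in> sphere 0 1}"

definition LO_cone :: "(real^'a \<Rightarrow> real^'b) \<Rightarrow> real \<Rightarrow> ((real^'a) \<times> (real^'b)) set" where
  "LO_cone f \<theta> = {t *\<^sub>R y | t y. t \<ge> 0 \<and> y \<in> LO_link f \<theta>}"

definition LO_angle :: "(real^'a \<Rightarrow> real^'b) \<Rightarrow> real \<Rightarrow> bool" where
  "LO_angle f \<theta> \<longleftrightarrow> 0 < \<theta> \<and> \<theta> < pi / 2 \<and>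
     minimal_submanifold (CARD('a) - 1) (LO_link f \<theta>) (sphere 0 1)"

definition LOM :: "(real^'a \<Rightarrow> real^'b) \<Rightarrow> bool" where
  "LOM f \<longleftrightarrow> f ` sphere 0 1 \<subseteq> sphere 0 1 \<and> smooth_on (sphere 0 1) f \<and> (\<exists>\<theta>. LO_angle f \<theta>)"

text \<open>For linear \<open>D\<close> on the subspace \<open>T\<close>: the eigenspace of the adjoint of \<open>D\<close> composed with \<open>D\<close>
  for the eigenvalue \<open>\<sigma>\<^sup>2\<close>, with the adjoint (relative to \<open>T\<close>) moved to the other side of the
  inner product.\<close>

definition singular_space ::
    "('a::euclidean_space \<Rightarrow> 'b::euclidean_space) \<Rightarrow> 'a set \<Rightarrow> real \<Rightarrow> 'a set" where
  "singular_space D T \<sigma> = {v \<in> T. \<forall>w\<in>T. D v \<bullet> D w = \<sigma>\<^sup>2 * (v \<bullet> w)}"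

definition singular_values ::
    "('a::euclidean_space \<Rightarrow> 'b::euclidean_space) \<Rightarrow> 'a set \<Rightarrow> real set" where
  "singular_values D T = {\<sigma>. \<sigma> \<ge> 0 \<and> (\<exists>v\<in>singular_space D T \<sigma>. v \<noteq> 0)}"

text \<open>The derivative within the sphere is uniquely determined on tangent vectors,
  where it is the differential of \<open>f\<close>.\<close>

definition sphere_differential :: "(real^'a \<Rightarrow> real^'b) \<Rightarrow> real^'a \<Rightarrow> real^'a \<Rightarrow> real^'b" where
  "sphere_differential f x = frechet_derivative f (at x within sphere 0 1)"

definition LOMSE :: "(real^'a \<Rightarrow> real^'b) \<Rightarrow> bool" where
  "LOMSE f \<longleftrightarrow> LOM f \<and>
     (\<forall>x\<in>sphere 0 1. \<exists>\<sigma>>0.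
        singular_values (sphere_differential f x) (tangent_space (sphere 0 1) x) = {0, \<sigma>})"

definition laplacian :: "('a::euclidean_space \<Rightarrow> real) \<Rightarrow> 'a \<Rightarrow> real" where
  "laplacian P y =
     (\<Sum>b\<in>Basis. frechet_derivative (\<lambda>z. frechet_derivative P (at z) b) (at y) b)"

definition spherical_harmonic :: "nat \<Rightarrow> ('a::euclidean_space \<Rightarrow> real) \<Rightarrow> bool" where
  "spherical_harmonic k g \<longleftrightarrow>
     (\<exists>P. real_polynomial_function P \<and> (\<forall>t y. P (t *\<^sub>R y) = t ^ k * P y) \<and>
          (\<forall>y. laplacian P y = 0) \<and> (\<forall>x\<in>sphere 0 1. g x = P x))"

definition LOMSE_type :: "(real^'a \<Rightarrow> real^'b) \<Rightarrow> nat \<Rightarrow> nat \<Rightarrow> nat \<Rightarrow> bool" where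
  "LOMSE_type f n p k \<longleftrightarrow> LOMSE f \<and> CARD('a) = n + 1 \<and>
     (\<forall>x\<in>sphere 0 1.
        \<forall>\<sigma>\<in>singular_values (sphere_differential f x) (tangent_space (sphere 0 1) x).
          \<sigma> > 0 \<longrightarrow>
          dim (singular_space (sphere_differential f x) (tangent_space (sphere 0 1) x) \<sigma>) = p) \<and>
     even k \<and> (\<forall>i. spherical_harmonic k (\<lambda>x. f x $ i))"

definition Type_II :: "(real^'a \<Rightarrow> real^'b) \<Rightarrow> bool" where
  "Type_II f \<longleftrightarrow>
     (\<exists>n p k. LOMSE_type f n p k \<and>
        ((n, p) = (3, 2) \<and> k \<ge> 4 \<or> (n, p) = (5, 4) \<and> k \<ge> 6))"

end

theory Submission
  imports Defs
begin

text \<open>On the unit sphere \<open>f\<close> agrees with a map \<open>G\<close> that is homogeneous of degree \<open>0\<close>, and the cone without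
  its apex is the graph of \<open>F y = tan \<theta> * norm y * G y\<close>. For a submanifold of a graph the second
  fundamental form is the normal projection of the Hessian of \<open>F\<close>. Hence minimality of the
  link gives minimality of the cone, the radial Hessian being zero, and, after taking the inner product with \<open>G\<close>,
  the equation for \<open>\<theta>\<close>.

  The destabilizing field rotates the ray \<open>r * (cos \<theta>, sin \<theta>)\<close> by an angle \<open>\<psi> r\<close>, so that the varied cone is swept
  out by \<open>(a r * x, b r * f x)\<close> for a plane curve \<open>(a, b)\<close>. The equality of the nonzero singular values
  makes its volume the length of that curve for a conformal metric. With \<open>n = 2 * m + 1\<close> and
  \<open>g r = r * \<psi> r\<close> the second variation is a positive multiple of the integral of
  \<open>r ^ n * (g'\<^sup>2 - \<kappa> * g\<^sup>2 / r\<^sup>2)\<close>, where \<open>\<kappa> = n * (1 - 2 * n / (k * (k + n - 1)))\<close>. It takes negative values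
  as soon as \<open>\<kappa>\<close> exceeds the constant \<open>m\<^sup>2\<close> of Hardy's inequality, which is the case in Type (II).\<close>

section \<open>Calculus of smooth maps\<close>

text \<open>Since \<open>\<kappa>\<close> is smaller than \<open>n = 2 * m + 1\<close>, the
  inequality \<open>\<kappa> > m\<^sup>2\<close> with positive \<open>m\<close> is possible only for
  \<open>m = 1\<close> and \<open>m = 2\<close>, and there it says that \<open>k\<close> is large
  enough: this is the origin of Type (II). Two inputs determine \<open>\<kappa>\<close>. The nonzero
  singular value comes from the Laplacian of the sum of the squared harmonic polynomials that extend
  the components of \<open>f\<close>, and the equation for \<open>\<theta>\<close> then eliminates
  \<open>tan \<theta>\<close>. The obstacle is that \<open>f\<close> is given on the sphere only,
  while connections and traces are defined through chosen extensions and chosen bases, and a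
  derivative within a set is determined on tangent vectors only. Everything is therefore transferred
  to homogeneous maps on the punctured space, where ordinary derivatives exist and the cone without
  its apex is a single graph. One patch then carries the whole variation, and the varied volume is
  computed exactly for small \<open>s\<close> before it is differentiated, so that no Jacobi
  operator has to be formed.\<close>

lemma Ck_on_cong:
  assumes "open U" "\<And>x. x \<in> U \<Longrightarrow> f x = g x" "Ck_on k U f"
  shows "Ck_on k U g"
  using assms(2,3)
proof (induction k arbitrary: f g)
  case 0
  then show ?case using continuous_on_cong[of U U f g] by simp
next
  case (Suc k)
  have eq: "frechet_derivative f (at x) = frechet_derivative g (at x)" if "x \<in> U" for x
    using Suc.prems that \<open>open U\<close>
    by (intro frechet_derivative_transform_within_open[of f x U g]) auto
  have d: "g differentiable (at x)" if "x \<in> U" for x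
  proof -
    have "f differentiable (at x)"
      using Suc.prems(2) that by simp
    then obtain f' where "(f has_derivative f') (at x)"
      unfolding differentiable_def by blast
    then have "(g has_derivative f') (at x)"
      by (rule has_derivative_transform_within_open[OF _ \<open>open U\<close> that]) (rule Suc.prems(1))
    then show ?thesis unfolding differentiable_def by blast
  qed
  have "Ck_on k U (\<lambda>x. frechet_derivative g (at x) v)" for v
    using Suc.IH[of "\<lambda>x. frechet_derivative f (at x) v"] eq Suc.prems by auto
  with d show ?case by simp
qed

lemma Ck_on_SucI:
  assumes "open U" "\<And>x. x \<in> U \<Longrightarrow> (f has_derivative f' x) (at x)"
    "\<And>v. Ck_on k U (\<lambda>x. f' x v)"
  shows "Ck_on (Suc k) U f"
proof -
  have eq: "f' x = frechet_derivative f (at x)" if "x \<in> U" for x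
    using assms(2)[OF that] by (rule frechet_derivative_at)
  have "Ck_on k U (\<lambda>x. frechet_derivative f (at x) v)" for v
    using Ck_on_cong[OF \<open>open U\<close> _ assms(3)[of v]] eq by simp
  with assms(2) show ?thesis by (auto simp: differentiable_def)
qed

lemma Ck_on_SucD:
  assumes "Ck_on (Suc k) U f"
  shows "Ck_on k U f"
  using assms
proof (induction k arbitrary: f)
  case 0
  then show ?case
    by (auto intro!: continuous_at_imp_continuous_on differentiable_imp_continuous_within)
next
  case (Suc k)
  then show ?case by (metis Ck_on.simps(2))
qed

lemma Ck_on_has_derivative:
  assumes "Ck_on (Suc k) U f" "x \<in> U"
  shows "(f has_derivative frechet_derivative f (at x)) (at x)"
  using assms frechet_derivative_works by auto

lemma Ck_on_subset: "Ck_on k U f \<Longrightarrow> V \<subseteq> U \<Longrightarrow> Ck_on k V f"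
  by (induction k arbitrary: f) (auto intro: continuous_on_subset)

lemma Ck_on_const: "Ck_on k U (\<lambda>x. c)"
proof (induction k arbitrary: c)
  case (Suc k)
  have "frechet_derivative (\<lambda>x. c) (at x) = (\<lambda>_. 0)" for x :: 'a
    using frechet_derivative_const by blast
  then show ?case using Suc by simp
qed simp

text \<open>\<open>U\<close> may be any set, whereas \<open>Ck_on_SucI\<close> asks for an open one;
  hence the detour through the whole space, where the derivative of a linear map is
  constant.\<close>

lemma Ck_on_bounded_linear:
  assumes "bounded_linear f"
  shows "Ck_on k U f"
proof (rule Ck_on_subset)
  show "Ck_on k UNIV f"
  proof (cases k)
    case 0
    then show ?thesis using assms by (simp add: linear_continuous_on)
  next
    case (Suc j)
    then show ?thesis
      using Ck_on_SucI[OF open_UNIV, of f "\<lambda>x. f" j] assms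
      by (metis Ck_on_const bounded_linear_imp_has_derivative)
  qed
qed simp

lemma Ck_on_add:
  assumes "open U" "Ck_on k U f" "Ck_on k U g"
  shows "Ck_on k U (\<lambda>x. f x + g x)"
  using assms(2,3)
proof (induction k arbitrary: f g)
  case 0
  then show ?case by (simp add: continuous_on_add)
next
  case (Suc k)
  show ?case
  proof (rule Ck_on_SucI[OF \<open>open U\<close>])
    show "((\<lambda>x. f x + g x) has_derivative
       (\<lambda>v. frechet_derivative f (at x) v + frechet_derivative g (at x) v)) (at x)" if "x \<in> U" for x
      using Suc.prems that by (intro has_derivative_add Ck_on_has_derivative) auto
    show "Ck_on k U (\<lambda>x. frechet_derivative f (at x) v + frechet_derivative g (at x) v)" for v
      using Suc by auto
  qed
qed

lemma Ck_on_bilinear: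
  assumes "open U" "bounded_bilinear B" "Ck_on k U f" "Ck_on k U g"
  shows "Ck_on k U (\<lambda>x. B (f x) (g x))"
  using assms(3,4)
proof (induction k arbitrary: f g)
  case 0
  then show ?case by (simp add: bounded_bilinear.continuous_on[OF assms(2)])
next
  case (Suc k)
  show ?case
  proof (rule Ck_on_SucI[OF \<open>open U\<close>])
    show "((\<lambda>x. B (f x) (g x)) has_derivative
       (\<lambda>v. B (f x) (frechet_derivative g (at x) v) + B (frechet_derivative f (at x) v) (g x))) (at x)"
      if "x \<in> U" for x
      using Suc.prems that
      by (intro bounded_bilinear.FDERIV[OF assms(2)] Ck_on_has_derivative) auto
    show "Ck_on k U (\<lambda>x. B (f x) (frechet_derivative g (at x) v) + B (frechet_derivative f (at x) v) (g x))" for v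
      using Suc.prems Ck_on_SucD[OF Suc.prems(1)] Ck_on_SucD[OF Suc.prems(2)]
      by (intro Ck_on_add[OF \<open>open U\<close>] Suc.IH) auto
  qed
qed

lemmas Ck_on_scaleR = Ck_on_bilinear[OF _ bounded_bilinear_scaleR]
lemmas Ck_on_mult = Ck_on_bilinear[OF _ bounded_bilinear_mult]
lemmas Ck_on_inner = Ck_on_bilinear[OF _ bounded_bilinear_inner]

lemma Ck_on_sum:
  assumes "open U" "\<And>i. i \<in> I \<Longrightarrow> Ck_on k U (f i)"
  shows "Ck_on k U (\<lambda>x. \<Sum>i\<in>I. f i x)"
  using assms(2)
  by (induction I rule: infinite_finite_induct) (auto intro!: Ck_on_add[OF \<open>open U\<close>] Ck_on_const)

text \<open>\<open>Ck_on\<close> controls derivatives in fixed directions, but the chain rule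
  evaluates the derivative of \<open>g\<close> on the moving vector
  \<open>frechet_derivative f (at x) v\<close>. Expanding that vector in \<open>Basis\<close> gives
  a sum of products with fixed directions, to which the induction hypothesis applies.\<close>

lemma Ck_on_compose:
  fixes f :: "'a::euclidean_space \<Rightarrow> 'b::euclidean_space"
    and g :: "'b \<Rightarrow> 'c::real_normed_vector"
  assumes "open U" "open V" "Ck_on k V g" "Ck_on k U f" "\<And>x. x \<in> U \<Longrightarrow> f x \<in> V"
  shows "Ck_on k U (\<lambda>x. g (f x))"
  using assms(3,4)
proof (induction k arbitrary: g)
  case 0
  then show ?case using assms(5) by (auto intro: continuous_on_compose2)
next
  case (Suc k)
  show ?case
  proof (rule Ck_on_SucI[OF \<open>open U\<close>])
    fix x assume x: "x \<in> U"
    have g: "(g has_derivative frechet_derivative g (at (f x))) (at (f x))"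
      using Suc.prems(1) assms(5)[OF x] by (rule Ck_on_has_derivative)
    then interpret bounded_linear "frechet_derivative g (at (f x))"
      by (rule has_derivative_bounded_linear)
    have rep: "frechet_derivative g (at (f x)) w =
        (\<Sum>b\<in>Basis. (w \<bullet> b) *\<^sub>R frechet_derivative g (at (f x)) b)" for w
    proof -
      have "frechet_derivative g (at (f x)) w
          = frechet_derivative g (at (f x)) (\<Sum>b\<in>Basis. (w \<bullet> b) *\<^sub>R b)"
        by (simp only: euclidean_representation)
      then show ?thesis by (simp add: sum scaleR)
    qed
    have "(f has_derivative frechet_derivative f (at x)) (at x)"
      using Suc.prems(2) x by (rule Ck_on_has_derivative)
    from has_derivative_compose[OF this g]
    have "((\<lambda>x. g (f x)) has_derivative
        (\<lambda>v. frechet_derivative g (at (f x)) (frechet_derivative f (at x) v))) (at x)" .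
    then show "((\<lambda>x. g (f x)) has_derivative
      (\<lambda>v. \<Sum>b\<in>Basis. (frechet_derivative f (at x) v \<bullet> b) *\<^sub>R frechet_derivative g (at (f x)) b)) (at x)"
      by (simp only: rep[symmetric])
  next
    show "Ck_on k U (\<lambda>x. \<Sum>b\<in>Basis. (frechet_derivative f (at x) v \<bullet> b) *\<^sub>R frechet_derivative g (at (f x)) b)" for v
    proof (intro Ck_on_sum[OF \<open>open U\<close>] Ck_on_scaleR[OF \<open>open U\<close>] Ck_on_inner[OF \<open>open U\<close>] Ck_on_const)
      show "Ck_on k U (\<lambda>x. frechet_derivative f (at x) v)"
        using Suc.prems(2) by simp
      show "Ck_on k U (\<lambda>x. frechet_derivative g (at (f x)) b)" for b
        using Suc.IH[of "\<lambda>y. frechet_derivative g (at y) b"] Suc.prems(1) Ck_on_SucD[OF Suc.prems(2)]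
        by simp
    qed
  qed
qed

lemma Ck_on_bounded_linear_compose:
  fixes f :: "'a::euclidean_space \<Rightarrow> 'b::euclidean_space"
  assumes "open U" "bounded_linear T" "Ck_on k U f"
  shows "Ck_on k U (\<lambda>x. T (f x))"
  using Ck_on_compose[OF assms(1) open_UNIV Ck_on_bounded_linear[OF assms(2)] assms(3)] by simp

lemma Ck_on_id: "Ck_on k U (\<lambda>x. x)"
  by (intro Ck_on_bounded_linear bounded_linear_ident)

lemma Ck_on_minus: "open U \<Longrightarrow> Ck_on k U f \<Longrightarrow> Ck_on k U (\<lambda>x. - f x)"
  using Ck_on_scaleR[of U k "\<lambda>x. -1" f] Ck_on_const by auto

lemma Ck_on_diff:
  "open U \<Longrightarrow> Ck_on k U f \<Longrightarrow> Ck_on k U g \<Longrightarrow> Ck_on k U (\<lambda>x. f x - g x)"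
  using Ck_on_add[of U k f "\<lambda>x. - g x"] Ck_on_minus[of U k g] by simp

lemma Ck_on_Pair:
  fixes f :: "'a::euclidean_space \<Rightarrow> 'b::euclidean_space"
    and g :: "'a \<Rightarrow> 'c::euclidean_space"
  assumes "open U" "Ck_on k U f" "Ck_on k U g"
  shows "Ck_on k U (\<lambda>x. (f x, g x))"
proof -
  have "Ck_on k U (\<lambda>x. (f x, 0) + (0, g x))"
    by (intro Ck_on_add[OF assms(1)] Ck_on_bounded_linear_compose[OF assms(1) _ assms(2)]
        Ck_on_bounded_linear_compose[OF assms(1) _ assms(3)]
        bounded_linear_Pair bounded_linear_ident bounded_linear_zero)
  then show ?thesis by simp
qed

lemma Ck_on_vec:
  fixes f :: "'a::euclidean_space \<Rightarrow> real^'b"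
  assumes "open U" "\<And>i. Ck_on k U (\<lambda>x. f x $ i)"
  shows "Ck_on k U f"
proof -
  have sum: "Ck_on k U (\<lambda>x. \<Sum>i\<in>UNIV. (f x $ i) *\<^sub>R axis i 1)"
    by (intro Ck_on_sum[OF assms(1)] Ck_on_scaleR[OF assms(1)] assms(2) Ck_on_const)
  show ?thesis
  proof (rule Ck_on_cong[OF assms(1) _ sum])
    show "(\<Sum>i\<in>UNIV. (f x $ i) *\<^sub>R axis i 1) = f x" for x
      using basis_expansion[of "f x"] by (simp add: scalar_mult_eq_scaleR)
  qed
qed

lemma Ck_on_real_SucI:
  fixes f :: "real \<Rightarrow> real"
  assumes "open U" "\<And>x. x \<in> U \<Longrightarrow> (f has_field_derivative f' x) (at x)" "Ck_on k U f'"
  shows "Ck_on (Suc k) U f"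
  using assms
  by (intro Ck_on_SucI[of U f "\<lambda>x v. f' x * v"] Ck_on_mult Ck_on_const)
     (auto simp: has_field_derivative_def)

lemma Ck_on_powr: "Ck_on k {0<..} (\<lambda>x::real. x powr a)"
proof (induction k arbitrary: a)
  case 0
  then show ?case by (auto intro!: continuous_intros)
next
  case (Suc k)
  show ?case
    by (rule Ck_on_real_SucI[where f' = "\<lambda>x. a * x powr (a - 1)"])
       (auto intro!: has_real_derivative_powr Ck_on_mult Ck_on_const Suc)
qed

lemma Ck_on_ln: "Ck_on k {0<..} (ln :: real \<Rightarrow> real)"
proof (cases k)
  case 0
  then show ?thesis by (auto intro!: continuous_intros)
next
  case (Suc j)
  have "Ck_on (Suc j) {0<..} (ln :: real \<Rightarrow> real)"
    by (rule Ck_on_real_SucI[where f' = "\<lambda>x. x powr (-1)", OF _ _ Ck_on_powr])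
       (use DERIV_ln in \<open>auto simp: powr_minus\<close>)
  then show ?thesis using Suc by simp
qed

text \<open>Off the origin \<open>y \<bullet> y\<close> is smooth and positive, so powers of the
  norm inherit smoothness from real powers on the positive half-line.\<close>

lemma Ck_on_norm_powr:
  fixes U :: "'a::euclidean_space set"
  assumes "open U" "0 \<notin> U"
  shows "Ck_on k U (\<lambda>y. norm y powr a)"
proof (rule Ck_on_cong[OF assms(1)])
  show "(y \<bullet> y) powr (a/2) = norm y powr a" if "y \<in> U" for y
    using that assms by (simp add: dot_square_norm powr_powr flip: powr_numeral)
  show "Ck_on k U (\<lambda>y. (y \<bullet> y) powr (a/2))"
    using assms
    by (intro Ck_on_compose[OF assms(1) _ Ck_on_powr Ck_on_inner] Ck_on_id) (auto simp: inner_gt_zero_iff)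
qed

lemma Ck_on_norm:
  fixes U :: "'a::euclidean_space set"
  assumes "open U" "0 \<notin> U"
  shows "Ck_on k U norm"
  using Ck_on_cong[OF assms(1) _ Ck_on_norm_powr[OF assms, of k 1], of norm] by simp

lemma Ck_on_real_polynomial_function:
  assumes "real_polynomial_function p"
  shows "Ck_on k (UNIV :: 'a::euclidean_space set) p"
  using assms
proof induction
  case (linear f)
  then show ?case by (rule Ck_on_bounded_linear)
qed (auto intro: Ck_on_const Ck_on_add Ck_on_mult)

lemma smooth_onI:
  assumes "open U" "S \<subseteq> U" "\<And>k. Ck_on k U f"
  shows "smooth_on S f"
  unfolding smooth_on_def using assms by blast

section \<open>A bump function\<close>

text \<open>The powers of \<open>inverse t\<close> make the family closed under differentiation up
  to linear combinations, so smoothness of all members follows by one induction.\<close>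

definition flat_exp :: "nat \<Rightarrow> real \<Rightarrow> real" where
  "flat_exp j t = (if t > 0 then inverse t ^ j * exp (- inverse t) else 0)"

lemma flat_exp_tendsto_0: "(flat_exp j \<longlongrightarrow> 0) (at 0)"
proof -
  have "((\<lambda>t::real. inverse t ^ j / exp (inverse t)) \<longlongrightarrow> 0) (at_right 0)"
    by (rule filterlim_compose[OF tendsto_power_div_exp_0 filterlim_inverse_at_top_right])
  then have "(flat_exp j \<longlongrightarrow> 0) (at_right 0)"
    by (rule Lim_transform_eventually)
       (auto simp: eventually_at_right_field flat_exp_def exp_minus field_simps intro!: exI[of _ 1])
  moreover have "(flat_exp j \<longlongrightarrow> 0) (at_left 0)"
    by (rule Lim_transform_eventually[of "\<lambda>_. 0"])
       (auto simp: eventually_at_left_field flat_exp_def intro!: exI[of _ "-1"])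
  ultimately show ?thesis by (intro filterlim_split_at)
qed

lemma flat_exp_has_derivative:
  "(flat_exp j has_field_derivative (flat_exp (j + 2) t - of_nat j * flat_exp (j + 1) t)) (at t)"
proof -
  consider "t > 0" | "t < 0" | "t = 0" by linarith
  then show ?thesis
  proof cases
    case 1
    have d1: "((\<lambda>t. inverse t ^ j) has_field_derivative (- of_nat j * inverse t ^ (j + 1))) (at t)"
    proof (induction j)
      case (Suc j)
      show ?case
        using DERIV_mult[OF DERIV_inverse[of t] Suc] 1 by (simp add: algebra_simps)
    qed simp
    have d2: "((\<lambda>t. exp (- inverse t)) has_field_derivative (exp (- inverse t) * inverse t ^ 2)) (at t)"
      using 1 by (auto intro!: derivative_eq_intros simp: power2_eq_square)
    have "((\<lambda>t. inverse t ^ j * exp (- inverse t)) has_field_derivative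
        (flat_exp (j + 2) t - of_nat j * flat_exp (j + 1) t)) (at t)"
      using DERIV_mult[OF d1 d2] 1 by (simp add: flat_exp_def algebra_simps power2_eq_square)
    then show ?thesis
      by (rule has_field_derivative_transform_within_open[of _ _ _ "{0<..}"])
         (use 1 in \<open>auto simp: flat_exp_def\<close>)
  next
    case 2
    have "((\<lambda>t. 0) has_field_derivative (flat_exp (j + 2) t - of_nat j * flat_exp (j + 1) t)) (at t)"
      using 2 by (auto simp: flat_exp_def)
    then show ?thesis
      by (rule has_field_derivative_transform_within_open[of _ _ _ "{..<0}"])
         (use 2 in \<open>auto simp: flat_exp_def\<close>)
  next
    case 3
    \<comment> \<open>The difference quotient of \<open>flat_exp j\<close> at \<open>0\<close> is
      \<open>flat_exp (Suc j)\<close>, whose limit is known.\<close>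
    have "((\<lambda>h. (flat_exp j (0 + h) - flat_exp j 0) / h) \<longlongrightarrow> 0) (at 0)"
      by (rule Lim_transform_eventually[OF flat_exp_tendsto_0[of "Suc j"]])
         (auto simp: eventually_at flat_exp_def field_simps intro!: exI[of _ 1])
    then show ?thesis unfolding 3 DERIV_def by (simp add: flat_exp_def)
  qed
qed

lemma Ck_on_flat_exp: "Ck_on k UNIV (flat_exp j)"
proof (induction k arbitrary: j)
  case 0
  then show ?case
    using DERIV_isCont[OF flat_exp_has_derivative]
    by (simp add: continuous_at_imp_continuous_on)
next
  case (Suc k)
  show ?case
    by (rule Ck_on_real_SucI[OF open_UNIV flat_exp_has_derivative])
       (intro Ck_on_diff[OF open_UNIV] Ck_on_mult[OF open_UNIV] Ck_on_const Suc)
qed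

definition bump :: "real \<Rightarrow> real" where
  "bump x = flat_exp 0 x * flat_exp 0 (1 - x)"

lemma Ck_on_bump: "Ck_on k UNIV bump"
  unfolding bump_def
  by (intro Ck_on_mult[OF open_UNIV] Ck_on_flat_exp
      Ck_on_compose[OF open_UNIV open_UNIV Ck_on_flat_exp] Ck_on_diff[OF open_UNIV] Ck_on_const Ck_on_id) simp

lemma bump_pos: "0 < x \<Longrightarrow> x < 1 \<Longrightarrow> bump x > 0"
  by (simp add: bump_def flat_exp_def)

lemma bump_eq_0: "x \<le> 0 \<or> x \<ge> 1 \<Longrightarrow> bump x = 0"
  by (auto simp: bump_def flat_exp_def)

section \<open>Tangent spaces\<close>

lemma tangent_space_curve:
  assumes "v \<in> tangent_space S x"
  obtains \<gamma> :: "real \<Rightarrow> 'e::euclidean_space" and \<epsilon> where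
    "\<epsilon> > 0" "smooth_on {-\<epsilon><..<\<epsilon>} \<gamma>" "\<gamma> ` {-\<epsilon><..<\<epsilon>} \<subseteq> S" "\<gamma> 0 = x"
    "(\<gamma> has_vector_derivative v) (at 0)"
  using assms unfolding tangent_space_def by blast

text \<open>Derivatives within \<open>S\<close> are not unique, but their values on tangent vectors are.\<close>

lemma has_derivative_within_unique_on_tangent:
  assumes "(f has_derivative A) (at x within S)" "(f has_derivative B) (at x within S)"
    and "v \<in> tangent_space S x"
  shows "A v = B v"
proof -
  obtain \<gamma> \<epsilon> where \<gamma>: "\<epsilon> > 0" "\<gamma> ` {-\<epsilon><..<\<epsilon>} \<subseteq> S" "\<gamma> 0 = x"
    "(\<gamma> has_vector_derivative v) (at 0)"
    using tangent_space_curve[OF assms(3)] by metis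
  have "((f \<circ> \<gamma>) has_vector_derivative D v) (at 0)" if "(f has_derivative D) (at x within S)" for D
  proof -
    have "((f \<circ> \<gamma>) has_vector_derivative D v) (at 0 within {-\<epsilon><..<\<epsilon>})"
      using \<gamma> that
      by (intro vector_derivative_diff_chain_within)
         (auto intro: has_vector_derivative_at_within has_derivative_subset)
    then show ?thesis
      using at_within_open[of 0 "{-\<epsilon><..<\<epsilon>}"] \<open>\<epsilon> > 0\<close> by simp
  qed
  then show ?thesis
    using assms(1,2) vector_derivative_unique_at by blast
qed

text \<open>Within \<open>S\<close> the function \<open>h\<close> also has derivative
  \<open>0\<close>, and derivatives within \<open>S\<close> agree on tangent vectors. This bounds
  tangent spaces from above; \<open>tangent_space_image\<close> supplies the vectors for the
  opposite inclusion.\<close>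

lemma tangent_space_level_set:
  assumes "(h has_derivative D) (at x)" "x \<in> S" "\<And>y. y \<in> S \<Longrightarrow> h y = c" "v \<in> tangent_space S x"
  shows "D v = 0"
proof -
  have "(h has_derivative (\<lambda>_. 0)) (at x within S)"
    by (rule has_derivative_transform[of x S h "\<lambda>_. c"]) (use assms in auto)
  then show ?thesis
    using has_derivative_within_unique_on_tangent assms has_derivative_at_withinI by metis
qed

lemma smooth_on_Ck_compose:
  fixes f :: "'a::euclidean_space \<Rightarrow> 'b::euclidean_space"
  assumes "smooth_on S f" "open V" "\<And>k. Ck_on k V g" "f ` S \<subseteq> V"
  shows "smooth_on S (\<lambda>x. g (f x))"
  unfolding smooth_on_def
proof
  fix x assume "x \<in> S"
  then obtain U h where h: "open U" "x \<in> U" "\<And>k. Ck_on k U h" "\<And>y. y \<in> S \<inter> U \<Longrightarrow> h y = f y"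
    using assms(1) unfolding smooth_on_def by metis
  let ?U = "U \<inter> h -` V"
  have op: "open ?U"
    using h(3)[of 0] h(1) assms(2) by (simp add: continuous_on_open_vimage Int_commute)
  have "Ck_on k ?U (\<lambda>x. g (h x))" for k
    by (rule Ck_on_compose[OF op assms(2) assms(3) Ck_on_subset[OF h(3)]]) auto
  moreover have "x \<in> ?U" using h \<open>x \<in> S\<close> assms(4) by auto
  moreover have "\<forall>y\<in>S \<inter> ?U. g (h y) = g (f y)" using h(4) by auto
  ultimately show "\<exists>U ga. open U \<and> x \<in> U \<and> (\<forall>k. Ck_on k U ga) \<and> (\<forall>y\<in>S \<inter> U. ga y = g (f y))"
    using op by (intro exI[of _ ?U] exI[of _ "\<lambda>x. g (h x)"]) simp
qed

lemma tangent_space_image: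
  fixes \<Phi> :: "'a::euclidean_space \<Rightarrow> 'b::euclidean_space"
  assumes "v \<in> tangent_space S x" "open U" "\<And>k. Ck_on k U \<Phi>" "S \<subseteq> U" "\<Phi> ` S \<subseteq> S'"
  shows "frechet_derivative \<Phi> (at x) v \<in> tangent_space S' (\<Phi> x)"
proof -
  obtain \<gamma> :: "real \<Rightarrow> 'a" and \<epsilon> where \<gamma>: "\<epsilon> > 0" "smooth_on {-\<epsilon><..<\<epsilon>} \<gamma>"
    "\<gamma> ` {-\<epsilon><..<\<epsilon>} \<subseteq> S" "\<gamma> 0 = x" "(\<gamma> has_vector_derivative v) (at 0)"
    using tangent_space_curve[OF assms(1)] by metis
  have "\<gamma> 0 \<in> S" using \<gamma>(1,3) by (metis greaterThanLessThan_iff image_subset_iff neg_less_0_iff_less)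
  then have "(\<Phi> has_derivative frechet_derivative \<Phi> (at x)) (at x)"
    using Ck_on_has_derivative[OF assms(3)[of "Suc 0"]] assms(4) \<gamma>(4) by blast
  then have "((\<Phi> \<circ> \<gamma>) has_vector_derivative frechet_derivative \<Phi> (at x) v) (at 0)"
    using \<gamma>(4,5) by (intro vector_derivative_diff_chain_within)
       (auto intro: has_derivative_at_withinI)
  moreover have "smooth_on {-\<epsilon><..<\<epsilon>} (\<lambda>t. \<Phi> (\<gamma> t))"
    by (rule smooth_on_Ck_compose[OF \<gamma>(2) assms(2,3)]) (use \<gamma>(3) assms(4) in blast)
  ultimately show ?thesis
    unfolding tangent_space_def using \<gamma> assms(5)
    by (intro CollectI exI[of _ "\<Phi> \<circ> \<gamma>"] exI[of _ \<epsilon>]) (auto simp: o_def)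
qed

lemma tangent_space_open:
  fixes S :: "'a::euclidean_space set"
  assumes "open S" "x \<in> S"
  shows "tangent_space S x = UNIV"
proof -
  have "v \<in> tangent_space S x" for v
  proof -
    have "open ((\<lambda>t::real. x + t *\<^sub>R v) -` S)"
      by (intro open_vimage assms(1) continuous_intros)
    moreover have "0 \<in> (\<lambda>t::real. x + t *\<^sub>R v) -` S" using assms(2) by simp
    ultimately obtain \<epsilon> where \<epsilon>: "\<epsilon> > 0" "ball (0::real) \<epsilon> \<subseteq> (\<lambda>t. x + t *\<^sub>R v) -` S"
      by (rule openE)
    moreover have "ball (0::real) \<epsilon> = {-\<epsilon><..<\<epsilon>}"
      by (simp add: ball_eq_greaterThanLessThan)
    moreover have "smooth_on {-\<epsilon><..<\<epsilon>} (\<lambda>t::real. x + t *\<^sub>R v)"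
      by (intro smooth_onI[OF open_UNIV] Ck_on_add Ck_on_scaleR Ck_on_const Ck_on_id) auto
    moreover have "((\<lambda>t::real. x + t *\<^sub>R v) has_vector_derivative v) (at 0)"
      by (auto intro!: derivative_eq_intros)
    ultimately show ?thesis
      unfolding tangent_space_def
      by (intro CollectI exI[of _ "\<lambda>t. x + t *\<^sub>R v"] exI[of _ \<epsilon>]) auto
  qed
  then show ?thesis by auto
qed

lemma tangent_space_sphere:
  fixes x :: "'a::euclidean_space"
  assumes "norm x = 1"
  shows "tangent_space (sphere 0 1) x = {v. v \<bullet> x = 0}"
proof (intro equalityI subsetI CollectI)
  fix v assume v: "v \<in> tangent_space (sphere 0 1) x"
  have "((\<lambda>y. y \<bullet> y) has_derivative (\<lambda>v. 2 * (v \<bullet> x))) (at x)"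
    by (auto intro!: derivative_eq_intros simp: inner_commute)
  from tangent_space_level_set[OF this _ _ v, of 1]
  show "v \<bullet> x = 0" using assms by (simp add: dot_square_norm)
next
  fix v assume "v \<in> {v. v \<bullet> x = 0}"
  then have v: "x \<bullet> v = 0" by (simp add: inner_commute)
  \<comment> \<open>The radial retraction onto the sphere. Its differential at \<open>x\<close> is
    the orthogonal projection along \<open>x\<close> and so fixes \<open>v\<close>.\<close>
  let ?N = "\<lambda>y::'a. norm y powr (-1) *\<^sub>R y"
  have pos: "x \<in> - {0}" using assms by auto
  have N: "Ck_on k (- {0}) ?N" for k
    by (intro Ck_on_scaleR Ck_on_norm_powr Ck_on_id) auto
  have "frechet_derivative ?N (at x) v \<in> tangent_space (sphere 0 1) (?N x)"
  proof (rule tangent_space_image[where U = "- {0}" and S = "- {0}"])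
    show "v \<in> tangent_space (- {0}) x"
      using pos tangent_space_open[of "- {0}" x] by auto
    show "?N ` (- {0}) \<subseteq> sphere 0 1"
      by (auto simp: powr_minus field_simps split: if_splits)
  qed (use N in auto)
  moreover have "frechet_derivative ?N (at x) v = v"
  proof -
    have "(norm has_derivative (\<lambda>v. x \<bullet> v)) (at x)"
      using has_derivative_norm[of x] pos assms by (simp add: sgn_div_norm inner_commute)
    then have "(?N has_derivative (\<lambda>v. v - (x \<bullet> v) *\<^sub>R x)) (at x)"
      using assms pos
      by (auto intro!: derivative_eq_intros simp: sgn_div_norm)
    then show ?thesis using v by (simp flip: frechet_derivative_at)
  qed
  ultimately show "v \<in> tangent_space (sphere 0 1) x" using assms by simp
qed

section \<open>Orthogonal projections and orthonormal bases\<close>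

lemma orth_proj_eqI:
  fixes L :: "'e::euclidean_space set"
  assumes "subspace L" "w \<in> L" "\<And>u. u \<in> L \<Longrightarrow> (v - w) \<bullet> u = 0"
  shows "orth_proj L v = w"
  unfolding orth_proj_def
proof (rule the_equality)
  fix w' assume w': "w' \<in> L \<and> (\<forall>u\<in>L. (v - w') \<bullet> u = 0)"
  have "w - w' \<in> L" using assms w' by (simp add: subspace_diff)
  then have "(v - w') \<bullet> (w - w') - (v - w) \<bullet> (w - w') = 0" using assms w' by simp
  then have "(w - w') \<bullet> (w - w') = 0" by (simp add: algebra_simps)
  then show "w' = w" by simp
qed (use assms in auto)

lemma orth_proj:
  fixes L :: "'e::euclidean_space set"
  assumes "subspace L"
  shows "orth_proj L v \<in> L" and "\<And>u. u \<in> L \<Longrightarrow> (v - orth_proj L v) \<bullet> u = 0"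
proof -
  have L: "span L = L" using assms by (simp add: span_eq_iff)
  obtain y z where yz: "y \<in> L" "\<And>w. w \<in> L \<Longrightarrow> orthogonal z w" "v = y + z"
    using orthogonal_subspace_decomp_exists[of L v] unfolding L by metis
  have eq: "orth_proj L v = y"
    by (rule orth_proj_eqI[OF assms])
       (use yz in \<open>auto simp: orthogonal_def\<close>)
  show "orth_proj L v \<in> L" using eq yz by simp
  show "\<And>u. u \<in> L \<Longrightarrow> (v - orth_proj L v) \<bullet> u = 0"
    unfolding eq using yz by (simp add: orthogonal_def)
qed

lemma orth_proj_add:
  assumes "subspace L"
  shows "orth_proj L (v + w) = orth_proj L v + orth_proj L w"
proof (rule orth_proj_eqI[OF assms])
  show "orth_proj L v + orth_proj L w \<in> L"
    by (intro subspace_add orth_proj(1) assms)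
  show "(v + w - (orth_proj L v + orth_proj L w)) \<bullet> u = 0" if "u \<in> L" for u
    using orth_proj(2)[OF assms that, of v] orth_proj(2)[OF assms that, of w]
    by (simp add: inner_diff_left inner_add_left)
qed

lemma orth_proj_eq_0:
  assumes "subspace L" "\<And>u. u \<in> L \<Longrightarrow> v \<bullet> u = 0"
  shows "orth_proj L v = 0"
  by (rule orth_proj_eqI) (use assms subspace_0 in auto)

lemma orth_proj_sum:
  assumes "subspace L"
  shows "orth_proj L (\<Sum>i\<in>I. v i) = (\<Sum>i\<in>I. orth_proj L (v i))"
  by (induction I rule: infinite_finite_induct)
     (use orth_proj_eq_0[OF assms, of 0] in \<open>auto simp: orth_proj_add[OF assms]\<close>)

lemma orthonormal_basis_finite:
  assumes "orthonormal_basis L E"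
  shows "finite E" and "independent E"
proof -
  show "independent E"
    using assms unfolding orthonormal_basis_def
    by (intro pairwise_orthogonal_independent) auto
  then show "finite E" using independent_bound_general by blast
qed

lemma orthonormal_basis_card:
  assumes "orthonormal_basis L E"
  shows "card E = dim L"
  using orthonormal_basis_finite[OF assms] assms
  unfolding orthonormal_basis_def by (metis dim_eq_card_independent dim_span)

lemma orthonormal_basis_inner:
  assumes "orthonormal_basis L E" "e \<in> E" "e' \<in> E"
  shows "e \<bullet> e' = (if e = e' then 1 else 0)"
  using assms unfolding orthonormal_basis_def pairwise_def orthogonal_def
  by (auto simp: dot_square_norm)

lemma orthonormal_basis_exists:
  assumes "subspace L"
  shows "\<exists>E. orthonormal_basis L E"
  using orthonormal_basis_subspace[OF assms] unfolding orthonormal_basis_def by metis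

lemma orthonormal_basis_subset: "orthonormal_basis L E \<Longrightarrow> e \<in> E \<Longrightarrow> e \<in> L"
  unfolding orthonormal_basis_def using span_base by auto

lemma orthonormal_basis_expand:
  fixes v :: "'e::euclidean_space"
  assumes E: "orthonormal_basis L E" and "v \<in> L"
  shows "v = (\<Sum>e\<in>E. (v \<bullet> e) *\<^sub>R e)"
proof -
  let ?w = "\<Sum>e\<in>E. (v \<bullet> e) *\<^sub>R e"
  note fin = orthonormal_basis_finite(1)[OF E]
  have o: "(v - ?w) \<bullet> e = 0" if "e \<in> E" for e
  proof -
    have "?w \<bullet> e = (\<Sum>e'\<in>E. if e' = e then v \<bullet> e else 0)"
      using that unfolding inner_sum_left
      by (intro sum.cong) (auto simp: orthonormal_basis_inner[OF E])
    then show ?thesis using fin that by (simp add: inner_diff_left)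
  qed
  have "v \<in> span E" using assms unfolding orthonormal_basis_def by simp
  then have "v - ?w \<in> span E"
    by (intro span_diff span_sum span_scale) (simp_all add: span_base)
  then have "(v - ?w) \<bullet> (v - ?w) = 0"
    using orthogonal_to_span[of "v - ?w" E "v - ?w"] o by (auto simp: orthogonal_def)
  then show ?thesis by simp
qed

text \<open>Mean curvature is a trace over a basis picked by choice; this lets a basis adapted to
  the geometry replace it. Expand each \<open>e\<close> in \<open>E'\<close> and use that the
  coefficients form an orthogonal matrix.\<close>

lemma bilinear_trace_independent:
  fixes B :: "'e::euclidean_space \<Rightarrow> 'e \<Rightarrow> 'c::real_vector"
  assumes E: "orthonormal_basis L E" and E': "orthonormal_basis L E'" and B: "bilinear B"
  shows "(\<Sum>e\<in>E. B e e) = (\<Sum>e\<in>E'. B e e)"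
proof -
  have "(\<Sum>e\<in>E. B e e) = (\<Sum>e\<in>E. \<Sum>a\<in>E'. \<Sum>b\<in>E'. ((e \<bullet> a) * (e \<bullet> b)) *\<^sub>R B a b)"
  proof (rule sum.cong)
    fix e assume "e \<in> E"
    then have e: "e = (\<Sum>a\<in>E'. (e \<bullet> a) *\<^sub>R a)"
      by (intro orthonormal_basis_expand[OF E'] orthonormal_basis_subset[OF E])
    have "B e e = B (\<Sum>a\<in>E'. (e \<bullet> a) *\<^sub>R a) (\<Sum>a\<in>E'. (e \<bullet> a) *\<^sub>R a)"
      using e by simp
    then show "B e e = (\<Sum>a\<in>E'. \<Sum>b\<in>E'. ((e \<bullet> a) * (e \<bullet> b)) *\<^sub>R B a b)"
      by (simp only: bilinear_sum[OF B] sum.cartesian_product bilinear_lmul[OF B]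
          bilinear_rmul[OF B] case_prod_unfold scaleR_scaleR mult.commute)
  qed simp
  also have "\<dots> = (\<Sum>a\<in>E'. \<Sum>b\<in>E'. (\<Sum>e\<in>E. (e \<bullet> a) * (e \<bullet> b)) *\<^sub>R B a b)"
    by (subst sum.swap, rule sum.cong, simp, subst sum.swap, simp add: scaleR_sum_left)
  also have "\<dots> = (\<Sum>a\<in>E'. \<Sum>b\<in>E'. (if a = b then B a b else 0))"
  proof (intro sum.cong refl)
    fix a b assume "a \<in> E'" "b \<in> E'"
    then have "a = (\<Sum>e\<in>E. (a \<bullet> e) *\<^sub>R e)"
      by (intro orthonormal_basis_expand[OF E] orthonormal_basis_subset[OF E'])
    then have "a \<bullet> b = (\<Sum>e\<in>E. (a \<bullet> e) *\<^sub>R e) \<bullet> b" by simp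
    also have "\<dots> = (\<Sum>e\<in>E. (e \<bullet> a) * (e \<bullet> b))"
      by (simp add: inner_sum_left inner_commute[of a])
    finally have eq: "(\<Sum>e\<in>E. (e \<bullet> a) * (e \<bullet> b)) = a \<bullet> b" ..
    show "(\<Sum>e\<in>E. (e \<bullet> a) * (e \<bullet> b)) *\<^sub>R B a b = (if a = b then B a b else 0)"
      unfolding eq orthonormal_basis_inner[OF E' \<open>a \<in> E'\<close> \<open>b \<in> E'\<close>] by simp
  qed
  also have "\<dots> = (\<Sum>a\<in>E'. B a a)"
    using orthonormal_basis_finite(1)[OF E'] by simp
  finally show ?thesis .
qed

section \<open>The second fundamental form of a submanifold of a graph\<close>

text \<open>The expansion of \<open>w\<close> in \<open>Basis\<close> makes linearity in
  \<open>w\<close> immediate at every point, whether or not \<open>F\<close> is differentiable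
  there. Linearity in \<open>v\<close> is that of a derivative.\<close>

definition hess :: "('a::euclidean_space \<Rightarrow> 'b::euclidean_space) \<Rightarrow> 'a \<Rightarrow> 'a \<Rightarrow> 'a \<Rightarrow> 'b" where
  "hess F y v w = (\<Sum>b\<in>Basis. (w \<bullet> b) *\<^sub>R frechet_derivative (\<lambda>z. frechet_derivative F (at z) b) (at y) v)"

lemma linear_Basis_expand:
  fixes w :: "'a::euclidean_space"
  assumes "linear D"
  shows "D w = (\<Sum>b\<in>Basis. (w \<bullet> b) *\<^sub>R D b)"
proof -
  have "D w = D (\<Sum>b\<in>Basis. (w \<bullet> b) *\<^sub>R b)" by (simp only: euclidean_representation)
  then show ?thesis by (simp only: linear_sum[OF assms] linear_cmul[OF assms])
qed

locale C2_on =
  fixes U :: "'a::euclidean_space set" and F :: "'a \<Rightarrow> 'b::euclidean_space"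
  assumes open_dom: "open U" and C2: "Ck_on (Suc (Suc 0)) U F"
begin

abbreviation DF :: "'a \<Rightarrow> 'a \<Rightarrow> 'b" where "DF y \<equiv> frechet_derivative F (at y)"

lemma F_deriv: "y \<in> U \<Longrightarrow> (F has_derivative DF y) (at y)"
  using C2 Ck_on_has_derivative by blast

lemma DF_linear: "y \<in> U \<Longrightarrow> linear (DF y)"
  using F_deriv has_derivative_linear by blast

lemma DF_deriv: "y \<in> U \<Longrightarrow>
    ((\<lambda>z. DF z w) has_derivative frechet_derivative (\<lambda>z. DF z w) (at y)) (at y)"
  using C2 Ck_on_has_derivative[of 0 U "\<lambda>z. DF z w" y] by simp

lemma DF_has_hess:
  assumes "y \<in> U"
  shows "((\<lambda>z. DF z w) has_derivative (\<lambda>v. hess F y v w)) (at y)"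
proof (rule has_derivative_transform_within_open[OF _ open_dom assms])
  show "((\<lambda>z. \<Sum>b\<in>Basis. (w \<bullet> b) *\<^sub>R DF z b) has_derivative (\<lambda>v. hess F y v w)) (at y)"
    unfolding hess_def by (auto intro!: derivative_eq_intros DF_deriv assms)
  show "(\<Sum>b\<in>Basis. (w \<bullet> b) *\<^sub>R DF z b) = DF z w" if "z \<in> U" for z
    using linear_Basis_expand[OF DF_linear[OF that]] by metis
qed

lemma hess_bilinear:
  assumes "y \<in> U"
  shows "bilinear (hess F y)"
proof -
  have "linear (\<lambda>v. hess F y v w)" for w
    using DF_has_hess[OF assms] has_derivative_linear by blast
  moreover have "linear (hess F y v)" for v
    unfolding hess_def
    by (intro linearI) (simp_all add: inner_add_left scaleR_add_left sum.distrib scaleR_right.sum)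
  ultimately show ?thesis unfolding bilinear_def by auto
qed

lemma tangent_space_graph_subset:
  assumes "S \<subseteq> (\<lambda>y. (y, F y)) ` U" "p \<in> S" "v \<in> tangent_space S p"
  shows "snd v = DF (fst p) (fst v)"
proof -
  have "fst p \<in> U" using assms by auto
  then have d: "((\<lambda>q. snd q - F (fst q)) has_derivative (\<lambda>v. snd v - DF (fst p) (fst v))) (at p)"
    by (intro derivative_intros has_derivative_compose[OF _ F_deriv]) auto
  have "snd q - F (fst q) = 0" if "q \<in> S" for q
    using assms(1) that by auto
  from tangent_space_level_set[OF d assms(2) this assms(3)] show ?thesis by simp
qed

text \<open>A field \<open>Y\<close> tangent to \<open>S\<close> satisfies
  \<open>snd Y = DF (fst Y)\<close> along \<open>S\<close>. Differentiating this in the direction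
  \<open>v\<close> splits \<open>DY v\<close> into the vertical Hessian term and a vector tangent to
  the graph, which the projection kills; hence the choice of \<open>Y\<close> does not matter. The
  hypothesis on the normal space admits both the cone in Euclidean space and the link in the
  sphere.\<close>

lemma second_fundamental_form_graph:
  fixes A S :: "('a \<times> 'b) set"
  assumes S: "S \<subseteq> (\<lambda>y. (y, F y)) ` U" and p: "p \<in> S"
    and v: "v \<in> tangent_space S p" and ext: "\<exists>Y. tangent_extension S p w Y"
    and N: "normal_space A S p = {w. \<forall>v. w \<bullet> (v, DF (fst p) v) = 0}"
  shows "second_fundamental_form A S p v w =
    orth_proj (normal_space A S p) (0, hess F (fst p) (fst v) (fst w))"
proof -
  have pU: "fst p \<in> U" using S p by auto
  define Y where "Y = (SOME Y. tangent_extension S p w Y)"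
  have "tangent_extension S p w Y" using ext unfolding Y_def by (rule someI_ex)
  then obtain W where W: "open W" "p \<in> W" "smooth_on (S \<inter> W) Y"
      "\<And>y. y \<in> S \<inter> W \<Longrightarrow> Y y \<in> tangent_space S y" and Yp: "Y p = w"
    unfolding tangent_extension_def by blast
  then obtain W' g where W': "open W'" "p \<in> W'" "\<And>k. Ck_on k W' g"
      "\<And>y. y \<in> S \<inter> W \<inter> W' \<Longrightarrow> g y = Y y"
    using p unfolding smooth_on_def by (metis IntI)
  have "open (W \<inter> W')" "p \<in> W \<inter> W'" using W W' by auto
  then obtain d where d: "d > 0" "ball p d \<subseteq> W \<inter> W'" unfolding open_contains_ball by blast
  have "(g has_derivative frechet_derivative g (at p)) (at p)"
    using W'(2) W'(3)[of "Suc 0"] by (rule Ck_on_has_derivative[rotated])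
  then have "(Y has_derivative frechet_derivative g (at p)) (at p within S)"
    by (rule has_derivative_transform_within[OF has_derivative_at_withinI d(1) p])
       (use d W' in \<open>auto simp: dist_commute subset_iff\<close>)
  then have "Y differentiable (at p within S)" unfolding differentiable_def by blast
  define DY where "DY = frechet_derivative Y (at p within S)"
  have DY: "(Y has_derivative DY) (at p within S)"
    unfolding DY_def using \<open>Y differentiable _\<close> frechet_derivative_works by blast
  \<comment> \<open>\<open>?Z\<close> vanishes on \<open>S\<close>, so its derivative vanishes on
    tangent vectors. The basis expansion is needed because \<open>DF\<close> is differentiated at
    fixed vectors only.\<close>
  let ?Z = "\<lambda>q. snd (Y q) - (\<Sum>b\<in>Basis. (fst (Y q) \<bullet> b) *\<^sub>R DF (fst q) b)"
  have DFb: "((\<lambda>q. DF (fst q) b) has_derivative (\<lambda>v. hess F (fst p) (fst v) b)) (at p within S)" for b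
    by (rule has_derivative_compose[OF has_derivative_fst[OF has_derivative_ident] DF_has_hess[OF pU]])
  have "(?Z has_derivative (\<lambda>v. snd (DY v) - (\<Sum>b\<in>Basis. (fst (Y p) \<bullet> b) *\<^sub>R hess F (fst p) (fst v) b
      + (fst (DY v) \<bullet> b) *\<^sub>R DF (fst p) b))) (at p within S)"
    using DY DFb by (auto intro!: derivative_eq_intros)
  moreover have "(?Z has_derivative (\<lambda>_. 0)) (at p within S)"
  proof (rule has_derivative_transform_within[OF has_derivative_const d(1) p])
    fix q assume q: "q \<in> S" "dist q p < d"
    then have "Y q \<in> tangent_space S q"
      using W(4)[of q] d(2) by (metis IntD1 IntI dist_commute mem_ball subsetD)
    then have "snd (Y q) = DF (fst q) (fst (Y q))"
      using tangent_space_graph_subset[OF S q(1)] by blast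
    moreover have "fst q \<in> U" using S q by auto
    ultimately show "0 = ?Z q"
      using linear_Basis_expand[OF DF_linear, of "fst q" "fst (Y q)"] by simp
  qed
  ultimately have "snd (DY v) - (\<Sum>b\<in>Basis. (fst (Y p) \<bullet> b) *\<^sub>R hess F (fst p) (fst v) b
      + (fst (DY v) \<bullet> b) *\<^sub>R DF (fst p) b) = 0"
    using has_derivative_within_unique_on_tangent[OF _ _ v] by fastforce
  moreover have "(\<Sum>b\<in>Basis. (fst w \<bullet> b) *\<^sub>R hess F (fst p) (fst v) b) = hess F (fst p) (fst v) (fst w)"
    using hess_bilinear[OF pU] linear_Basis_expand unfolding bilinear_def by metis
  ultimately have "snd (DY v) = hess F (fst p) (fst v) (fst w) + DF (fst p) (fst (DY v))"
    using linear_Basis_expand[OF DF_linear[OF pU], of "fst (DY v)"]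
    by (simp add: Yp sum.distrib)
  then have split: "DY v = (0, hess F (fst p) (fst v) (fst w)) + (fst (DY v), DF (fst p) (fst (DY v)))"
    by (simp add: prod_eq_iff)
  let ?N = "normal_space A S p"
  have sub: "subspace ?N"
    unfolding N by (auto simp: subspace_def inner_add_left simp del: inner_Pair)
  have "orth_proj ?N (fst (DY v), DF (fst p) (fst (DY v))) = 0"
    by (rule orth_proj_eq_0[OF sub]) (auto simp: N inner_commute)
  with split have "orth_proj ?N (DY v) = orth_proj ?N (0, hess F (fst p) (fst v) (fst w))"
    using orth_proj_add[OF sub] by (metis add.right_neutral)
  then show ?thesis
    unfolding second_fundamental_form_def Let_def Y_def[symmetric] DY_def[symmetric] .
qed

end

section \<open>Linear maps with two singular values\<close>

lemma quadratic_nonpos_imp_linear_coeff_0: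
  fixes a b :: real
  assumes "\<And>t. 2 * t * a + t\<^sup>2 * b \<le> 0"
  shows "a = 0"
proof -
  have "b \<le> 0" using assms[of 1] assms[of "-1"] by simp
  \<comment> \<open>Testing \<open>t = 1\<close> and \<open>t = -1\<close> has shown
    \<open>b \<le> 0\<close>. For this \<open>c\<close> the quadratic has the value
    \<open>c\<^sup>2 * (2 - b)\<close>, which is positive unless \<open>c = 0\<close>.\<close>
  define c where "c = a / (1 - b)"
  have a: "a = c * (1 - b)" using \<open>b \<le> 0\<close> by (simp add: c_def)
  have "2 * c * a + c\<^sup>2 * b = c\<^sup>2 * (2 - b)"
    by (simp add: a power2_eq_square algebra_simps)
  then have "c\<^sup>2 * (2 - b) \<le> 0" using assms[of c] by simp
  then have "c = 0" using \<open>b \<le> 0\<close> by (simp add: mult_le_0_iff)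
  then show ?thesis using a by simp
qed

lemma subspace_singular_space:
  assumes "linear D" "subspace T"
  shows "subspace (singular_space D T \<sigma>)"
  using assms unfolding singular_space_def subspace_def
  by (auto simp: linear_0 linear_add linear_cmul inner_add_left algebra_simps)

text \<open>A maximizer of \<open>norm (D v)\<close> among the unit vectors \<open>v\<close> of \<open>T\<close> orthogonal to the two given
  singular spaces would be a singular vector for a third singular value.\<close>

lemma span_two_singular_spaces:
  fixes D :: "'a::euclidean_space \<Rightarrow> 'b::euclidean_space"
  assumes D: "linear D" and T: "subspace T" and sv: "singular_values D T \<subseteq> {0, \<sigma>}"
  shows "span (singular_space D T 0 \<union> singular_space D T \<sigma>) = T"
proof -
  define S where "S = singular_space D T 0 \<union> singular_space D T \<sigma>"
  define R where "R = {v \<in> T. \<forall>w\<in>S. v \<bullet> w = 0}"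
  have ST: "S \<subseteq> T" unfolding S_def singular_space_def by auto
  have spanT: "span S \<subseteq> T" using ST T by (metis span_minimal)
  have R: "subspace R"
    using T unfolding R_def subspace_def by (auto simp: inner_add_left)
  have R0: "r = 0" if "r \<in> R" for r
  proof (rule ccontr)
    assume "r \<noteq> 0"
    let ?K = "R \<inter> sphere 0 1"
    have "(1 / norm r) *\<^sub>R r \<in> ?K"
      using \<open>r \<noteq> 0\<close> that R by (auto intro: subspace_scale)
    then have ne: "?K \<noteq> {}" by blast
    have cp: "compact ?K"
      by (intro closed_Int_compact closed_subspace R compact_sphere)
    have cont: "continuous_on ?K (\<lambda>v. D v \<bullet> D v)"
      using D by (intro continuous_intros linear_continuous_on) (simp_all add: linear_conv_bounded_linear)
    obtain v where v: "v \<in> ?K" and max: "\<And>w. w \<in> ?K \<Longrightarrow> D w \<bullet> D w \<le> D v \<bullet> D v"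
      using continuous_attains_sup[OF cp ne cont] by blast
    define \<mu> where "\<mu> = D v \<bullet> D v"
    have vR: "v \<in> R" and vv: "v \<bullet> v = 1" using v by (auto simp: dot_square_norm)
    have le: "D w \<bullet> D w \<le> \<mu> * (w \<bullet> w)" if "w \<in> R" for w
    proof (cases "w = 0")
      case False
      have "(1 / norm w) *\<^sub>R w \<in> ?K" using that False R by (auto intro: subspace_scale)
      from max[OF this] have "D w \<bullet> D w / (norm w)\<^sup>2 \<le> \<mu>"
        by (simp add: linear_cmul[OF D] \<mu>_def power2_eq_square)
      then show ?thesis using False by (simp add: dot_square_norm field_simps)
    qed (simp add: linear_0[OF D])
    \<comment> \<open>The first variation at the maximizer: \<open>v + t *\<^sub>R w\<close> obeys
      the bound \<open>le\<close> for every \<open>t\<close>, with equality at \<open>t = 0\<close>,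
      so the coefficient linear in \<open>t\<close> is zero.\<close>
    have onR: "D v \<bullet> D w = \<mu> * (v \<bullet> w)" if "w \<in> R" for w
    proof -
      have "2 * t * (D v \<bullet> D w - \<mu> * (v \<bullet> w)) + t\<^sup>2 * (D w \<bullet> D w - \<mu> * (w \<bullet> w)) \<le> 0" for t
      proof -
        have "v + t *\<^sub>R w \<in> R" using R vR that by (intro subspace_add subspace_scale)
        from le[OF this] show ?thesis
          using vv by (simp add: linear_add[OF D] linear_cmul[OF D] inner_add_left inner_add_right
              inner_commute \<mu>_def[symmetric] algebra_simps power2_eq_square)
      qed
      from quadratic_nonpos_imp_linear_coeff_0[OF this] show ?thesis by simp
    qed
    have onS: "D v \<bullet> D w = 0" if "w \<in> span S" for w
    proof -
      have "w \<in> span S \<Longrightarrow> D v \<bullet> D w = 0"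
      proof (induction rule: span_induct)
        case base
        show ?case by (auto simp: subspace_def linear_0[OF D] linear_add[OF D] linear_cmul[OF D] inner_add_right)
      next
        case (step w)
        have "v \<in> T" "v \<bullet> w = 0" using vR step unfolding R_def by auto
        then have "D w \<bullet> D v = 0"
          using step unfolding S_def singular_space_def by (auto simp: inner_commute)
        then show ?case by (simp add: inner_commute)
      qed
      then show ?thesis using that by blast
    qed
    have "D v \<bullet> D w = \<mu> * (v \<bullet> w)" if "w \<in> T" for w
    proof -
      obtain y z where yz: "y \<in> span S" "\<And>u. u \<in> span S \<Longrightarrow> orthogonal z u" "w = y + z"
        using orthogonal_subspace_decomp_exists by metis
      have "z = w - y" using yz by simp
      then have "z \<in> T" using that yz(1) spanT T by (auto intro: subspace_diff)
      then have "z \<in> R" using yz(2) unfolding R_def by (auto simp: span_base orthogonal_def)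
      moreover have "v \<bullet> y = 0"
      proof -
        have "orthogonal v y"
          using vR yz(1) unfolding R_def by (intro orthogonal_to_span[of y S]) (auto simp: orthogonal_def)
        then show ?thesis by (simp add: orthogonal_def)
      qed
      ultimately show ?thesis
        using onR onS[OF yz(1)] by (simp add: yz(3) linear_add[OF D] inner_add_right)
    qed
    moreover have "(sqrt \<mu>)\<^sup>2 = \<mu>" by (simp add: \<mu>_def)
    moreover have "v \<in> T" using vR unfolding R_def by blast
    ultimately have vs: "v \<in> singular_space D T (sqrt \<mu>)"
      unfolding singular_space_def by simp
    moreover have "v \<noteq> 0" using vv by auto
    ultimately have "sqrt \<mu> \<in> singular_values D T"
      unfolding singular_values_def by (auto simp: \<mu>_def)
    \<comment> \<open>As a singular value \<open>sqrt \<mu>\<close> must be \<open>0\<close> or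
      \<open>\<sigma>\<close>, so \<open>v\<close> lies in the set to which it is
      orthogonal.\<close>
    then have "v \<in> S" using vs sv unfolding S_def by auto
    then have "v \<bullet> v = 0" using vR unfolding R_def by blast
    then show False using vv by simp
  qed
  have "T \<subseteq> span S"
  proof
    fix w assume "w \<in> T"
    obtain y z where yz: "y \<in> span S" "\<And>u. u \<in> span S \<Longrightarrow> orthogonal z u" "w = y + z"
      using orthogonal_subspace_decomp_exists by metis
    have "z = w - y" using yz by simp
    then have "z \<in> T" using \<open>w \<in> T\<close> yz(1) spanT T by (auto intro: subspace_diff)
    then have "z \<in> R" using yz(2) unfolding R_def by (auto simp: span_base orthogonal_def)
    then have "z = 0" by (rule R0)
    then show "w \<in> span S" using yz by simp
  qed
  then show ?thesis using spanT unfolding S_def by blast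
qed

text \<open>By symmetry of \<open>D v \<bullet> D w\<close>, vectors of the two singular spaces
  satisfy \<open>0 = \<sigma>\<^sup>2 * (v \<bullet> w)\<close>. Orthonormal bases of these spaces
  therefore combine to one of \<open>T\<close>.\<close>

lemma two_singular_values_frame:
  fixes D :: "'a::euclidean_space \<Rightarrow> 'b::euclidean_space"
  assumes D: "linear D" and T: "subspace T" and sv: "singular_values D T \<subseteq> {0, \<sigma>}" and "\<sigma> > 0"
  obtains E0 E1 where "orthonormal_basis (singular_space D T 0) E0"
    "orthonormal_basis (singular_space D T \<sigma>) E1" "orthonormal_basis T (E0 \<union> E1)" "E0 \<inter> E1 = {}"
proof -
  obtain E0 E1 where E: "orthonormal_basis (singular_space D T 0) E0"
    "orthonormal_basis (singular_space D T \<sigma>) E1"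
    using orthonormal_basis_exists[OF subspace_singular_space[OF D T]] by metis
  have orth: "v \<bullet> w = 0" if "v \<in> E0" "w \<in> E1" for v w
  proof -
    have vw: "v \<in> singular_space D T 0" "w \<in> singular_space D T \<sigma>"
      using that E orthonormal_basis_subset by blast+
    have "D v \<bullet> D w = 0" "D w \<bullet> D v = \<sigma>\<^sup>2 * (w \<bullet> v)"
      using vw unfolding singular_space_def by auto
    then show ?thesis using \<open>\<sigma> > 0\<close> by (simp add: inner_commute)
  qed
  have "span (E0 \<union> E1) = T"
  proof -
    have "span (E0 \<union> E1) = span (span E0 \<union> span E1)"
    proof
      show "span (E0 \<union> E1) \<subseteq> span (span E0 \<union> span E1)"
        by (intro span_mono Un_mono span_superset)
      show "span (span E0 \<union> span E1) \<subseteq> span (E0 \<union> E1)"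
        by (intro span_minimal Un_least span_mono) auto
    qed
    then show ?thesis
      using E span_two_singular_spaces[OF D T sv] unfolding orthonormal_basis_def by simp
  qed
  moreover have "pairwise orthogonal (E0 \<union> E1)"
    using E orth unfolding orthonormal_basis_def pairwise_def
    by (metis Un_iff inner_commute orthogonal_def)
  ultimately have "orthonormal_basis T (E0 \<union> E1)"
    using E unfolding orthonormal_basis_def by auto
  moreover have "E0 \<inter> E1 = {}"
  proof -
    have False if "v \<in> E0" "v \<in> E1" for v
      using orth[OF that] orthonormal_basis_inner[OF E(1) that(1) that(1)] by simp
    then show ?thesis by blast
  qed
  ultimately show ?thesis using that E by blast
qed

section \<open>Gram determinants\<close>

text \<open>Passing from the standard basis to \<open>E\<close> conjugates the Gram matrix by an
  orthogonal matrix \<open>Q\<close>, whose determinant has square \<open>1\<close>. The volume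
  density can thus be read off in any frame whose image under \<open>D\<close> is
  orthogonal.\<close>

lemma det_Gram_orthonormal_basis:
  fixes D :: "real^'p \<Rightarrow> 'e::euclidean_space"
  assumes D: "linear D" and E: "orthonormal_basis UNIV E"
    and orth: "\<And>e e'. e \<in> E \<Longrightarrow> e' \<in> E \<Longrightarrow> e \<noteq> e' \<Longrightarrow> D e \<bullet> D e' = 0"
  shows "det (\<chi> i j. D (axis i 1) \<bullet> D (axis j 1)) = (\<Prod>e\<in>E. D e \<bullet> D e)"
proof -
  have "card E = CARD('p)" using orthonormal_basis_card[OF E] by simp
  then obtain h where h: "bij_betw h (UNIV :: 'p set) E"
    using finite_same_card_bij orthonormal_basis_finite(1)[OF E] by (metis finite)
  have hE: "h i \<in> E" for i using h by (auto simp: bij_betw_def)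
  have hh: "h i \<bullet> h j = (if i = j then 1 else 0)" for i j
    using orthonormal_basis_inner[OF E hE hE] h by (auto simp: bij_betw_def inj_def)
  define Q :: "real^'p^'p" where "Q = (\<chi> i j. h j $ i)"
  define A :: "real^'p^'p" where "A = (\<chi> i j. D (axis i 1) \<bullet> D (axis j 1))"
  have "transpose Q ** Q = mat 1"
    using hh by (simp add: vec_eq_iff matrix_matrix_mult_def transpose_def Q_def mat_def inner_vec_def)
  then have Q1: "det Q * det Q = 1"
    by (metis det_I det_mul det_transpose)
  have Dh: "D (h j) = (\<Sum>l\<in>UNIV. h j $ l *\<^sub>R D (axis l 1))" for j
  proof -
    have "h j = (\<Sum>l\<in>UNIV. h j $ l *\<^sub>R axis l 1)"
      using basis_expansion[of "h j"] by (simp add: scalar_mult_eq_scaleR)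
    then show ?thesis by (metis (no_types, lifting) linear_sum[OF D] linear_cmul[OF D] sum.cong)
  qed
  define M where "M = transpose Q ** (A ** Q)"
  have M: "M $ i $ j = D (h i) \<bullet> D (h j)" for i j
    unfolding Dh[of i] Dh[of j] inner_sum_left inner_sum_right
    by (subst sum.swap) (simp add: M_def matrix_matrix_mult_def transpose_def Q_def A_def inner_sum_left inner_sum_right
        sum_distrib_left mult_ac)
  have "det M = (\<Prod>i\<in>UNIV. M $ i $ i)"
  proof (rule det_diagonal)
    fix i j :: 'p assume "i \<noteq> j"
    then have "h i \<noteq> h j" using h by (auto simp: bij_betw_def inj_def)
    then show "M $ i $ j = 0" using orth hE M by simp
  qed
  also have "\<dots> = (\<Prod>e\<in>E. D e \<bullet> D e)"
    unfolding M using prod.reindex_bij_betw[OF h] by simp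
  also have "det M = det A"
    using Q1 by (simp add: M_def det_mul mult_ac)
  finally show ?thesis unfolding A_def .
qed

section \<open>Maps to the sphere whose components are spherical harmonics\<close>

locale harmonic_sphere_map =
  fixes P :: "'b::finite \<Rightarrow> real^'a \<Rightarrow> real" and k :: nat
  assumes poly: "\<And>i. real_polynomial_function (P i)"
    and homogeneous: "\<And>i t y. P i (t *\<^sub>R y) = t ^ k * P i y"
    and harmonic: "\<And>i y. laplacian (P i) y = 0"
    and unit: "\<And>x. norm x = 1 \<Longrightarrow> (\<Sum>i\<in>UNIV. (P i x)\<^sup>2) = 1"
    and k_pos: "k > 0"
begin

abbreviation DP :: "'b \<Rightarrow> real^'a \<Rightarrow> real^'a \<Rightarrow> real" where
  "DP i y \<equiv> frechet_derivative (P i) (at y)"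

lemma P_deriv: "(P i has_derivative DP i y) (at y)"
  by (rule Ck_on_has_derivative[OF Ck_on_real_polynomial_function[OF poly, of "Suc 0"]]) simp

lemma DP_deriv: "((\<lambda>z. DP i z b) has_derivative frechet_derivative (\<lambda>z. DP i z b) (at y)) (at y)"
  using Ck_on_real_polynomial_function[OF poly, of "Suc (Suc 0)" i]
  by (intro Ck_on_has_derivative[of 0 UNIV]) auto

lemma DP_Euler: "DP i y y = k * P i y"
proof -
  have "((\<lambda>t::real. P i (t *\<^sub>R y)) has_derivative (\<lambda>h. DP i y (h *\<^sub>R y))) (at 1)"
    by (rule has_derivative_compose[of _ "\<lambda>h. h *\<^sub>R y"])
       (use P_deriv in \<open>auto intro!: derivative_eq_intros\<close>)
  moreover have "((\<lambda>t::real. P i (t *\<^sub>R y)) has_derivative (\<lambda>h. h * (k * P i y))) (at 1)"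
    unfolding homogeneous by (auto intro!: derivative_eq_intros)
  ultimately have "(\<lambda>h::real. DP i y (h *\<^sub>R y)) = (\<lambda>h. h * (k * P i y))"
    by (rule has_derivative_unique)
  from fun_cong[OF this, of 1] show ?thesis by simp
qed

lemma sum_P_squares: "(\<Sum>i\<in>UNIV. (P i y)\<^sup>2) = (y \<bullet> y) ^ k"
proof (cases "y = 0")
  case True
  then have "P i y = 0" for i using homogeneous[of i 0 y] k_pos by (simp add: power_0_left)
  then show ?thesis using True k_pos by (simp add: power_0_left)
next
  case False
  define x where "x = (1 / norm y) *\<^sub>R y"
  have x: "norm x = 1" "y = norm y *\<^sub>R x" using False by (auto simp: x_def)
  have "(P i y)\<^sup>2 = (y \<bullet> y) ^ k * (P i x)\<^sup>2" for i
    using homogeneous[of i "norm y" x] x(2)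
    by (simp add: power_mult_distrib dot_square_norm power_mult[symmetric] mult.commute)
  then show ?thesis using unit[OF x(1)] by (simp flip: sum_distrib_left)
qed

text \<open>Apply the Laplacian to \<open>sum_P_squares\<close>. By harmonicity the left side
  becomes twice the sum of the squared derivatives, and with \<open>N = CARD('a)\<close> the right
  side becomes \<open>2 * k * (2 * k + N - 2)\<close> at unit vectors.\<close>

lemma sum_DP_squares:
  assumes x: "norm x = 1"
  shows "(\<Sum>b\<in>Basis. \<Sum>i\<in>UNIV. (DP i x b)\<^sup>2) = real k * (2 * real k + real CARD('a) - 2)"
proof -
  have grad: "(\<Sum>i\<in>UNIV. 2 * (P i z * DP i z b)) = of_nat k * (2 * (z \<bullet> b)) * (z \<bullet> z) ^ (k - 1)" for z b
  proof -
    have "((\<lambda>z. \<Sum>i\<in>UNIV. (P i z)\<^sup>2) has_derivative (\<lambda>b. \<Sum>i\<in>UNIV. 2 * (P i z * DP i z b))) (at z)"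
      by (auto intro!: derivative_eq_intros P_deriv simp: mult_ac)
    moreover have "((\<lambda>z. \<Sum>i\<in>UNIV. (P i z)\<^sup>2) has_derivative
        (\<lambda>b. of_nat k * (2 * (z \<bullet> b)) * (z \<bullet> z) ^ (k - 1))) (at z)"
      unfolding sum_P_squares
      by (auto intro!: derivative_eq_intros simp: inner_commute)
    ultimately have "(\<lambda>b. \<Sum>i\<in>UNIV. 2 * (P i z * DP i z b)) =
        (\<lambda>b. of_nat k * (2 * (z \<bullet> b)) * (z \<bullet> z) ^ (k - 1))"
      by (rule has_derivative_unique)
    then show ?thesis by (rule fun_cong)
  qed
  let ?H = "\<lambda>i b. frechet_derivative (\<lambda>z. DP i z b) (at x) b"
  have second: "(\<Sum>i\<in>UNIV. 2 * ((DP i x b)\<^sup>2 + P i x * ?H i b))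
      = 4 * of_nat k * (of_nat k - 1) * (x \<bullet> b)\<^sup>2 + 2 * of_nat k" if "b \<in> Basis" for b
  proof -
    have "((\<lambda>z. \<Sum>i\<in>UNIV. 2 * (P i z * DP i z b)) has_derivative
      (\<lambda>v. \<Sum>i\<in>UNIV. 2 * (DP i x v * DP i x b + P i x * frechet_derivative (\<lambda>z. DP i z b) (at x) v))) (at x)"
      by (auto intro!: derivative_eq_intros P_deriv DP_deriv simp: add.commute)
    moreover have "((\<lambda>z. \<Sum>i\<in>UNIV. 2 * (P i z * DP i z b)) has_derivative
      (\<lambda>v. of_nat k * (2 * (v \<bullet> b)) * (x \<bullet> x) ^ (k - 1) +
        of_nat k * (2 * (x \<bullet> b)) * (of_nat (k - 1) * (2 * (x \<bullet> v)) * (x \<bullet> x) ^ (k - 1 - 1)))) (at x)"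
      unfolding grad by (auto intro!: derivative_eq_intros simp: inner_commute)
    ultimately have "(\<lambda>v. \<Sum>i\<in>UNIV. 2 * (DP i x v * DP i x b + P i x * frechet_derivative (\<lambda>z. DP i z b) (at x) v)) =
      (\<lambda>v. of_nat k * (2 * (v \<bullet> b)) * (x \<bullet> x) ^ (k - 1) +
        of_nat k * (2 * (x \<bullet> b)) * (of_nat (k - 1) * (2 * (x \<bullet> v)) * (x \<bullet> x) ^ (k - 1 - 1)))"
      by (rule has_derivative_unique)
    from fun_cong[OF this, of b] show ?thesis
      using x that k_pos by (simp add: power2_eq_square dot_square_norm of_nat_diff algebra_simps)
  qed
  have "(\<Sum>b\<in>Basis. \<Sum>i\<in>UNIV. 2 * ((DP i x b)\<^sup>2 + P i x * ?H i b))
      = 2 * (\<Sum>b\<in>Basis. \<Sum>i\<in>UNIV. (DP i x b)\<^sup>2) + 2 * (\<Sum>i\<in>UNIV. P i x * laplacian (P i) x)"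
  proof -
    have "(\<Sum>i\<in>UNIV. P i x * laplacian (P i) x) = (\<Sum>b\<in>Basis. \<Sum>i\<in>UNIV. P i x * ?H i b)"
      unfolding laplacian_def sum_distrib_left by (rule sum.swap)
    then show ?thesis by (simp add: sum.distrib sum_distrib_left algebra_simps)
  qed
  moreover have "(\<Sum>b\<in>Basis. \<Sum>i\<in>UNIV. 2 * ((DP i x b)\<^sup>2 + P i x * ?H i b))
     = 4 * of_nat k * (of_nat k - 1) * (\<Sum>b\<in>Basis. (x \<bullet> b)\<^sup>2) + 2 * of_nat k * of_nat CARD('a)"
    using second by (simp add: sum.distrib sum_distrib_left)
  moreover have "(\<Sum>b\<in>Basis. (x \<bullet> b)\<^sup>2) = 1"
    using x euclidean_inner[of x x] by (simp add: dot_square_norm power2_eq_square)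
  ultimately show ?thesis
    by (simp add: harmonic algebra_simps)
qed

definition G :: "real^'a \<Rightarrow> real^'b" where
  "G y = (\<chi> i. norm y powr (- real k) * P i y)"

lemma Ck_on_G: "Ck_on j (- {0}) G"
  unfolding G_def
  by (intro Ck_on_vec)
     (auto intro!: Ck_on_mult Ck_on_norm_powr Ck_on_subset[OF Ck_on_real_polynomial_function[OF poly]])

abbreviation DG :: "real^'a \<Rightarrow> real^'a \<Rightarrow> real^'b" where
  "DG y \<equiv> frechet_derivative G (at y)"

lemma G_deriv: "y \<noteq> 0 \<Longrightarrow> (G has_derivative DG y) (at y)"
  using Ck_on_has_derivative[OF Ck_on_G[of "Suc 0"]] by auto

lemma DG_linear: "y \<noteq> 0 \<Longrightarrow> linear (DG y)"
  using G_deriv has_derivative_linear by blast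

lemma G_unit_sphere: "norm x = 1 \<Longrightarrow> G x = (\<chi> i. P i x)"
  by (simp add: G_def)

lemma G_scale:
  assumes "t > 0"
  shows "G (t *\<^sub>R y) = G y"
  using assms
  by (simp add: G_def homogeneous vec_eq_iff powr_mult powr_minus powr_realpow field_simps)

lemma norm_G:
  assumes "y \<noteq> 0"
  shows "norm (G y) = 1"
proof -
  have "G y = G ((1 / norm y) *\<^sub>R y)" using assms by (simp add: G_scale)
  also have "norm \<dots> = 1"
  proof -
    have n: "norm ((1 / norm y) *\<^sub>R y) = 1" using assms by simp
    show ?thesis unfolding G_unit_sphere[OF n] using unit[OF n] by (simp add: norm_vec_def L2_set_def)
  qed
  finally show ?thesis .
qed

lemma G_inner_DG:
  assumes "y \<noteq> 0"
  shows "G y \<bullet> DG y v = 0"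
proof -
  have "((\<lambda>z. G z \<bullet> G z) has_derivative (\<lambda>v. 2 * (G y \<bullet> DG y v))) (at y)"
    using G_deriv[OF assms] by (auto intro!: derivative_eq_intros simp: inner_commute)
  moreover have "G z \<bullet> G z = 1" if "z \<in> - {0}" for z
    using norm_G that by (simp add: dot_square_norm)
  moreover have "v \<in> tangent_space (- {0}) y"
    using assms tangent_space_open[of "- {0}" y] by auto
  ultimately have "2 * (G y \<bullet> DG y v) = 0"
    using assms by (intro tangent_space_level_set[of "\<lambda>z. G z \<bullet> G z" _ y "- {0}" 1 v]) auto
  then show ?thesis by simp
qed

lemma DG_radial:
  assumes "y \<noteq> 0"
  shows "DG y y = 0"
proof -
  have "((\<lambda>t::real. G (t *\<^sub>R y)) has_derivative (\<lambda>h. DG y (h *\<^sub>R y))) (at 1)"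
    by (rule has_derivative_compose[of _ "\<lambda>h. h *\<^sub>R y"])
       (use G_deriv[OF assms] in \<open>auto intro!: derivative_eq_intros\<close>)
  moreover have "((\<lambda>t::real. G (t *\<^sub>R y)) has_derivative (\<lambda>h. 0)) (at 1)"
    by (rule has_derivative_transform_within_open[of "\<lambda>_. G y" _ _ _ "{0<..}"]) (auto simp: G_scale)
  ultimately have "(\<lambda>h::real. DG y (h *\<^sub>R y)) = (\<lambda>h. 0)"
    by (rule has_derivative_unique)
  from fun_cong[OF this, of 1] show ?thesis by simp
qed

lemma DG_scale:
  assumes "y \<noteq> 0" "t > 0"
  shows "DG (t *\<^sub>R y) v = (1 / t) *\<^sub>R DG y v"
proof -
  have "((\<lambda>z. G (t *\<^sub>R z)) has_derivative (\<lambda>v. DG (t *\<^sub>R y) (t *\<^sub>R v))) (at y)"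
    by (rule has_derivative_compose[of _ "\<lambda>v. t *\<^sub>R v"])
       (use G_deriv[of "t *\<^sub>R y"] assms in \<open>auto intro!: derivative_eq_intros\<close>)
  then have "(\<lambda>v. DG (t *\<^sub>R y) (t *\<^sub>R v)) = DG y"
    unfolding G_scale[OF assms(2)] by (rule has_derivative_unique[OF _ G_deriv[OF assms(1)]])
  then have "DG (t *\<^sub>R y) (t *\<^sub>R ((1 / t) *\<^sub>R v)) = DG y ((1 / t) *\<^sub>R v)" by metis
  then show ?thesis using assms linear_cmul[OF DG_linear[OF assms(1)]] by simp
qed

lemma DG_unit_sphere:
  assumes x: "norm x = 1"
  shows "DG x v = (\<chi> i. DP i x v - k * (x \<bullet> v) * P i x)"
proof -
  have x0: "x \<noteq> 0" using x by auto
  have n: "(norm has_derivative (\<lambda>v. x \<bullet> v)) (at x)"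
    using has_derivative_norm[of x] x0 x by (simp add: sgn_div_norm inner_commute)
  have "((\<lambda>y. norm y powr (- real k) * P i y) has_derivative
      (\<lambda>v. DP i x v - k * (x \<bullet> v) * P i x)) (at x)" for i
    using x x0 by (auto intro!: derivative_eq_intros n P_deriv)
  moreover have "((\<lambda>y. G y $ i) has_derivative (\<lambda>v. DG x v $ i)) (at x)" for i
    by (intro bounded_linear.has_derivative[OF bounded_linear_vec_nth] G_deriv x0)
  ultimately have "(\<lambda>v. DG x v $ i) = (\<lambda>v. DP i x v - k * (x \<bullet> v) * P i x)" for i
    by (intro has_derivative_unique[of "\<lambda>y. G y $ i"]) (simp_all add: G_def)
  then show ?thesis by (simp add: vec_eq_iff fun_eq_iff)
qed

text \<open>Making the map homogeneous of degree \<open>0\<close> removes the radial derivative,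
  which is \<open>k * P i x\<close> by Euler's identity; its squares contribute
  \<open>k\<^sup>2\<close>. What remains is the eigenvalue of degree \<open>k\<close> spherical
  harmonics.\<close>

lemma trace_DG:
  assumes x: "norm x = 1" and E: "orthonormal_basis UNIV E"
  shows "(\<Sum>e\<in>E. DG x e \<bullet> DG x e) = real k * (real k + real CARD('a) - 2)"
proof -
  have x0: "x \<noteq> 0" using x by auto
  have "bilinear (\<lambda>v w. DG x v \<bullet> DG x w)"
    using DG_linear[OF x0]
    by (auto simp: bilinear_def linear_add linear_cmul inner_add_left inner_add_right intro!: linearI)
  moreover have "orthonormal_basis UNIV (Basis :: (real^'a) set)"
    unfolding orthonormal_basis_def
    by (auto simp: pairwise_def orthogonal_def inner_Basis)
  ultimately have "(\<Sum>e\<in>E. DG x e \<bullet> DG x e) = (\<Sum>b\<in>Basis. DG x b \<bullet> DG x b)"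
    using bilinear_trace_independent[OF E] by blast
  also have "\<dots> = (\<Sum>b\<in>Basis. \<Sum>i\<in>UNIV. (DP i x b)\<^sup>2 - 2 * k * ((x \<bullet> b) * (P i x * DP i x b))
      + k\<^sup>2 * ((x \<bullet> b)\<^sup>2 * (P i x)\<^sup>2))"
    by (intro sum.cong refl)
       (simp add: DG_unit_sphere[OF x] inner_vec_def power2_eq_square algebra_simps)
  also have "\<dots> = (\<Sum>b\<in>Basis. \<Sum>i\<in>UNIV. (DP i x b)\<^sup>2)
      - 2 * k * (\<Sum>b\<in>Basis. \<Sum>i\<in>UNIV. P i x * ((x \<bullet> b) * DP i x b))
      + k\<^sup>2 * (\<Sum>b\<in>Basis. (x \<bullet> b)\<^sup>2 * (\<Sum>i\<in>UNIV. (P i x)\<^sup>2))"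
    by (simp add: sum.distrib sum_subtractf sum_distrib_left mult_ac)
  also have "(\<Sum>b\<in>Basis. \<Sum>i\<in>UNIV. P i x * ((x \<bullet> b) * DP i x b))
      = (\<Sum>i\<in>UNIV. P i x * (\<Sum>b\<in>Basis. (x \<bullet> b) * DP i x b))"
    by (subst sum.swap) (simp add: sum_distrib_left)
  also have "\<dots> = (\<Sum>i\<in>UNIV. P i x * DP i x x)"
    using linear_Basis_expand[OF has_derivative_linear[OF P_deriv], of _ _ x]
    by (metis (no_types, lifting) real_scaleR_def sum.cong)
  also have "\<dots> = k"
    using unit[OF x] by (simp add: DP_Euler power2_eq_square mult_ac flip: sum_distrib_left)
  also have "(\<Sum>b\<in>Basis. (x \<bullet> b)\<^sup>2 * (\<Sum>i\<in>UNIV. (P i x)\<^sup>2)) = 1"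
    using x euclidean_inner[of x x] unit[OF x] by (simp add: dot_square_norm power2_eq_square)
  finally show ?thesis
    using sum_DP_squares[OF x] by (simp add: power2_eq_square algebra_simps)
qed

end

section \<open>Integrals of radial functions\<close>

text \<open>Integration in polar coordinates for functions of the norm needs only the volumes of
  balls: both measures are finite on half-lines and agree there. Restricting to
  \<open>cball 0 b\<close> provides the finiteness.\<close>

lemma distr_norm_cball:
  assumes "b > 0"
  defines "N \<equiv> DIM('a::euclidean_space)"
  shows "distr (restrict_space lborel (cball (0::'a) b)) borel norm =
    density lborel (\<lambda>r. ennreal (unit_ball_vol (real N) * (N * r ^ (N - 1)) * indicator {0..b} r))"
    (is "?M = ?D")
proof (rule measure_eqI_lessThan)
  let ?c = "unit_ball_vol (real N)"
  have N: "N > 0" unfolding N_def by simp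
  have vol: "emeasure lborel (cball (0::'a) r) = ennreal (?c * r ^ N)" if "r \<ge> 0" for r
    using emeasure_cball[of r "0::'a"] that by (simp add: N_def)
  have meas: "norm \<in> measurable (restrict_space lborel (cball (0::'a) b)) borel"
    by (intro measurable_restrict_space1) simp
  \<comment> \<open>Clamping \<open>x\<close> to the interval from \<open>0\<close> to
    \<open>b\<close> covers half-lines that start before, inside or beyond it by one
    formula.\<close>
  have eM: "emeasure ?M {x<..} = ennreal (?c * (b ^ N - max 0 (min b x) ^ N))" for x
  proof -
    have "emeasure ?M {x<..} = emeasure (restrict_space lborel (cball (0::'a) b)) (norm -` {x<..} \<inter> cball 0 b)"
      using meas by (subst emeasure_distr) (auto simp: space_restrict_space)
    also have "\<dots> = emeasure lborel (norm -` {x<..} \<inter> cball (0::'a) b)"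
      by (intro emeasure_restrict_space) auto
    also have "\<dots> = ennreal (?c * (b ^ N - max 0 (min b x) ^ N))"
    proof (cases "x < 0")
      case True
      then have "norm -` {x<..} \<inter> cball (0::'a) b = cball 0 b"
        by (auto intro: less_le_trans[OF _ norm_ge_zero])
      then show ?thesis using True vol[of b] assms N by (simp add: max_def min_def)
    next
      case False
      have "norm -` {x<..} \<inter> cball (0::'a) b = cball 0 b - cball 0 (min b x)" by auto
      moreover have "emeasure lborel (cball (0::'a) b - cball 0 (min b x)) =
          ennreal (?c * b ^ N) - ennreal (?c * (min b x) ^ N)"
        using False assms vol[of b] vol[of "min b x"]
        by (subst emeasure_Diff) auto
      ultimately show ?thesis
        using False assms by (simp add: ennreal_minus right_diff_distrib)
    qed
    finally show ?thesis .
  qed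
  have eD: "emeasure ?D {x<..} = ennreal (?c * (b ^ N - max 0 (min b x) ^ N))" for x
  proof -
    let ?x = "max 0 (min b x)"
    have "emeasure ?D {x<..} =
        (\<integral>\<^sup>+r. ennreal (?c * (N * r ^ (N - 1)) * indicator {0..b} r) * indicator {x<..} r \<partial>lborel)"
      by (subst emeasure_density) auto
    also have "\<dots> = (\<integral>\<^sup>+r. ennreal (?c * (N * r ^ (N - 1))) * indicator {?x..b} r \<partial>lborel)"
    proof (intro nn_integral_cong_AE)
      \<comment> \<open>The half-line is open and the interval of integration closed; they differ at
        most in an endpoint.\<close>
      have "AE r in lborel. r \<noteq> ?x \<and> r \<noteq> b"
        by (simp add: AE_lborel_singleton)
      then show "AE r in lborel. ennreal (?c * (N * r ^ (N - 1)) * indicator {0..b} r) * indicator {x<..} r =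
        ennreal (?c * (N * r ^ (N - 1))) * indicator {?x..b} r"
        by eventually_elim (auto simp: indicator_def max_def min_def split: if_splits)
    qed
    also have "\<dots> = ennreal (?c * b ^ N - ?c * ?x ^ N)"
      using assms
      by (intro nn_integral_FTC_Icc) (auto intro!: derivative_eq_intros simp: field_simps)
    finally show ?thesis by (simp add: right_diff_distrib)
  qed
  show "emeasure ?M {x<..} < \<infinity>" "emeasure ?M {x<..} = emeasure ?D {x<..}" for x
    unfolding eM eD by simp_all
qed simp_all

lemma integral_radial:
  fixes h :: "real \<Rightarrow> real"
  assumes ab: "0 \<le> a" "a < b" and h: "continuous_on {a..b} h"
  shows "(LINT u:{u::'a::euclidean_space. a \<le> norm u \<and> norm u \<le> b}|lborel. h (norm u)) =
    unit_ball_vol (real DIM('a)) * real DIM('a) * integral {a..b} (\<lambda>r. r ^ (DIM('a) - 1) * h r)"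
proof -
  let ?c = "unit_ball_vol (real DIM('a))" and ?N = "DIM('a)"
  \<comment> \<open>Continuity is known on the interval only; the extension by zero is Borel on the
    whole line, as the change of measure requires.\<close>
  let ?h = "\<lambda>r. indicator {a..b} r *\<^sub>R h r"
  have meas: "?h \<in> borel_measurable borel"
    using borel_measurable_continuous_on_indicator[OF _ h] by simp
  have "(LINT u:{u::'a. a \<le> norm u \<and> norm u \<le> b}|lborel. h (norm u)) =
      (LINT u|lborel. indicator (cball (0::'a) b) u *\<^sub>R ?h (norm u))"
    unfolding set_lebesgue_integral_def by (intro Bochner_Integration.integral_cong) (auto simp: indicator_def)
  also have "\<dots> = (LINT u|restrict_space lborel (cball (0::'a) b). ?h (norm u))"
    by (subst integral_restrict_space) auto
  also have "\<dots> = (LINT r|distr (restrict_space lborel (cball (0::'a) b)) borel norm. ?h r)"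
    by (rule integral_distr[symmetric, OF _ meas]) (intro measurable_restrict_space1, simp)
  also have "\<dots> = (LINT r|lborel. (?c * (?N * r ^ (?N - 1)) * indicator {0..b} r) *\<^sub>R ?h r)"
  proof -
    have "(\<lambda>r. ?c * (?N * r ^ (?N - 1)) * indicator {0..b} r) \<in> borel_measurable lborel"
      by measurable
    moreover have "AE r in lborel. 0 \<le> ?c * (?N * r ^ (?N - 1)) * indicator {0..b} r"
      by (intro AE_I2) (simp add: indicator_def)
    moreover have "?h \<in> borel_measurable lborel" using meas by simp
    moreover have "b > 0" using ab by simp
    ultimately show ?thesis
      by (simp only: distr_norm_cball integral_density)
  qed
  also have "\<dots> = (LINT r:{a..b}|lborel. ?c * ?N * (r ^ (?N - 1) * h r))"
    unfolding set_lebesgue_integral_def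
    using ab by (intro Bochner_Integration.integral_cong) (auto simp: indicator_def)
  also have "\<dots> = integral {a..b} (\<lambda>r. ?c * ?N * (r ^ (?N - 1) * h r))"
    using h by (intro set_borel_integral_eq_integral borel_integrable_atLeastAtMost' continuous_intros)
  finally show ?thesis by simp
qed

section \<open>A one-dimensional second variation\<close>

text \<open>The integrand is the length element of a varied ray times its weight, differentiated
  twice under the integral. At \<open>s = 0\<close> the root is stationary with second derivative
  \<open>(g r)\<^sup>2\<close>, so the mixed terms drop out. In the application \<open>g\<close> is
  the derivative of the radial profile, not the profile itself.\<close>

lemma second_variation_weighted_length:
  fixes \<mu> g \<psi> :: "real \<Rightarrow> real" and w w1 w2 :: "real \<Rightarrow> real"
  assumes cont: "continuous_on {a..b} \<mu>" "continuous_on {a..b} g" "continuous_on {a..b} \<psi>"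
    and w: "\<And>x. (w has_field_derivative w1 x) (at x)"
    and w1: "\<And>x. (w1 has_field_derivative w2 x) (at x)"
    and cw2: "continuous_on UNIV w2"
  obtains A' where
    "\<And>s. ((\<lambda>s. integral {a..b} (\<lambda>r. \<mu> r * (sqrt (1 + s\<^sup>2 * (g r)\<^sup>2) * w (s * \<psi> r))))
      has_field_derivative A' s) (at s)"
    "(A' has_field_derivative integral {a..b} (\<lambda>r. \<mu> r * ((g r)\<^sup>2 * w 0 + (\<psi> r)\<^sup>2 * w2 0))) (at 0)"
proof -
  define q where "q = (\<lambda>s r. sqrt (1 + s\<^sup>2 * (g r)\<^sup>2))"
  have q0: "q s r > 0" for s r unfolding q_def by (simp add: add_pos_nonneg)
  have dq: "((\<lambda>s. q s r) has_field_derivative s * (g r)\<^sup>2 / q s r) (at s)" for s r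
    unfolding q_def
    by (auto intro!: derivative_eq_intros simp: field_simps add_pos_nonneg)
       (use add_pos_nonneg[of 1 "s\<^sup>2 * (g r)\<^sup>2"] in auto)
  define f0 where "f0 = (\<lambda>s r. \<mu> r * (q s r * w (s * \<psi> r)))"
  define f1 where "f1 = (\<lambda>s r. \<mu> r * (s * (g r)\<^sup>2 / q s r * w (s * \<psi> r) + q s r * (\<psi> r * w1 (s * \<psi> r))))"
  define f2 where "f2 = (\<lambda>s r. \<mu> r * (((g r)\<^sup>2 / q s r - s * (g r)\<^sup>2 * (s * (g r)\<^sup>2 / q s r) / (q s r)\<^sup>2) * w (s * \<psi> r)
     + 2 * (s * (g r)\<^sup>2 / q s r) * (\<psi> r * w1 (s * \<psi> r)) + q s r * ((\<psi> r)\<^sup>2 * w2 (s * \<psi> r))))"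
  have lin: "((\<lambda>s. s * c) has_field_derivative c) (at s)" for s c :: real
    by (auto intro!: derivative_eq_intros)
  have dw: "((\<lambda>s. w (s * c)) has_field_derivative c * w1 (s * c)) (at s)"
    and dw1: "((\<lambda>s. w1 (s * c)) has_field_derivative c * w2 (s * c)) (at s)" for s c
    using DERIV_chain2[OF w lin, of c s] DERIV_chain2[OF w1 lin, of c s]
    by (simp_all add: mult.commute)
  have d0: "((\<lambda>s. f0 s r) has_field_derivative f1 s r) (at s)" for s r
    unfolding f0_def f1_def
    by (rule DERIV_cmult, rule DERIV_cong[OF DERIV_mult[OF dq dw]]) (simp add: algebra_simps)
  have dsq: "((\<lambda>s. s * (g r)\<^sup>2 / q s r) has_field_derivative
      ((g r)\<^sup>2 / q s r - s * (g r)\<^sup>2 * (s * (g r)\<^sup>2 / q s r) / (q s r)\<^sup>2)) (at s)" for s r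
    using q0[of s r]
    by (intro DERIV_cong[OF DERIV_divide[OF _ dq]])
       (auto intro!: derivative_eq_intros simp: field_simps power2_eq_square)
  have d1: "((\<lambda>s. f1 s r) has_field_derivative f2 s r) (at s)" for s r
    unfolding f1_def f2_def
    by (rule DERIV_cmult, rule DERIV_cong[OF DERIV_add[OF DERIV_mult[OF dsq dw] DERIV_mult[OF dq DERIV_cmult[OF dw1]]]])
       (simp add: algebra_simps power2_eq_square)
  have cw: "continuous_on UNIV w" "continuous_on UNIV w1"
    using w w1 by (auto intro!: continuous_at_imp_continuous_on DERIV_isCont)
  have comp: "continuous_on (UNIV \<times> {a..b}) (\<lambda>x. f (snd x))" if "continuous_on {a..b} f" for f :: "real \<Rightarrow> real"
    by (rule continuous_on_compose2[OF that]) (auto intro!: continuous_intros)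
  have compw: "continuous_on (UNIV \<times> {a..b}) (\<lambda>x. f (fst x * \<psi> (snd x)))"
    if "continuous_on UNIV f" for f :: "real \<Rightarrow> real"
    by (rule continuous_on_compose2[OF that]) (auto intro!: continuous_intros comp cont)
  have cq: "continuous_on (UNIV \<times> {a..b}) (\<lambda>x. q (fst x) (snd x))"
    unfolding q_def by (intro continuous_intros comp cont)
  note ci = continuous_intros comp[OF cont(1)] comp[OF cont(2)] comp[OF cont(3)]
    compw[OF cw(1)] compw[OF cw(2)] compw[OF cw2] cq
  have q0': "q s r \<noteq> 0" for s r using q0[of s r] by simp
  have c0: "continuous_on (UNIV \<times> {a..b}) (\<lambda>(s, r). f0 s r)"
    unfolding f0_def case_prod_unfold by (intro ci)
  have c1: "continuous_on (UNIV \<times> {a..b}) (\<lambda>(s, r). f1 s r)"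
    unfolding f1_def case_prod_unfold by (intro ci ballI q0')
  have c2: "continuous_on (UNIV \<times> {a..b}) (\<lambda>(s, r). f2 s r)"
    unfolding f2_def case_prod_unfold by (intro ci ballI q0' power_not_zero)
  have int: "f s integrable_on cbox a b"
    if "continuous_on (UNIV \<times> {a..b}) (\<lambda>(s, r). f s r)" for f :: "real \<Rightarrow> real \<Rightarrow> real" and s
  proof -
    have "continuous_on {a..b} (\<lambda>r. (\<lambda>(s, r). f s r) (s, r))"
      by (rule continuous_on_compose2[OF that]) (auto intro!: continuous_intros)
    then show ?thesis by (simp add: integrable_continuous_real)
  qed
  have D0: "((\<lambda>s. integral {a..b} (f0 s)) has_field_derivative integral {a..b} (f1 s)) (at s)" for s
    using leibniz_rule_field_derivative[of UNIV a b f0 f1 s] d0 int[OF c0] c1 by simp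
  have D1: "((\<lambda>s. integral {a..b} (f1 s)) has_field_derivative integral {a..b} (f2 s)) (at s)" for s
    using leibniz_rule_field_derivative[of UNIV a b f1 f2 s] d1 int[OF c1] c2 by simp
  have "f2 0 = (\<lambda>r. \<mu> r * ((g r)\<^sup>2 * w 0 + (\<psi> r)\<^sup>2 * w2 0))"
    by (simp add: f2_def q_def fun_eq_iff)
  then show ?thesis
    using that[of "\<lambda>s. integral {a..b} (f1 s)"] D0 D1[of 0] unfolding f0_def q_def by simp
qed

section \<open>Sharpness of Hardy's inequality\<close>

definition dbump :: "real \<Rightarrow> real" where
  "dbump x = frechet_derivative bump (at x) 1"

lemma bump_deriv: "(bump has_field_derivative dbump x) (at x)"
proof -
  have "(bump has_derivative frechet_derivative bump (at x)) (at x)"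
    by (rule Ck_on_has_derivative[OF Ck_on_bump[of "Suc 0"]]) simp
  moreover have "frechet_derivative bump (at x) = (*) (dbump x)"
  proof
    fix h :: real
    show "frechet_derivative bump (at x) h = dbump x * h"
      unfolding dbump_def
      using linear_cmul[OF has_derivative_linear[OF calculation], of h 1] by (simp add: mult.commute)
  qed
  ultimately show ?thesis by (simp only: has_field_derivative_def)
qed

lemma continuous_on_dbump: "continuous_on S dbump"
  using Ck_on_bump[of "Suc 0"] unfolding dbump_def
  by (auto intro: continuous_on_subset)

lemma continuous_on_bump: "continuous_on S bump"
  using Ck_on_bump[of 0] by (auto intro: continuous_on_subset)

text \<open>The power \<open>r ^ (-m)\<close> is critical for Hardy's inequality: with weight
  \<open>r ^ (2 * m + 1)\<close> both of its terms are then multiples of \<open>1 / r\<close>, in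
  the ratio \<open>m\<^sup>2\<close>. The cutoff is stretched on the logarithmic scale, which makes
  its cost small for large \<open>L\<close>.\<close>

definition radial_profile :: "nat \<Rightarrow> real \<Rightarrow> real \<Rightarrow> real" where
  "radial_profile m L r = bump (ln r / L) / r ^ m"

definition radial_profile_deriv :: "nat \<Rightarrow> real \<Rightarrow> real \<Rightarrow> real" where
  "radial_profile_deriv m L r = (dbump (ln r / L) / L - m * bump (ln r / L)) / r ^ (m + 1)"

lemma radial_profile_deriv:
  assumes "r > 0" "L > 0"
  shows "(radial_profile m L has_field_derivative radial_profile_deriv m L r) (at r)"
proof -
  have "((\<lambda>r. bump (ln r / L)) has_field_derivative dbump (ln r / L) * (1 / (r * L))) (at r)"
    using assms by (intro DERIV_chain2[OF bump_deriv]) (auto intro!: derivative_eq_intros simp: field_simps)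
  moreover have "((\<lambda>r. r ^ m) has_field_derivative m * r ^ (m - 1)) (at r)"
    by (auto intro!: derivative_eq_intros)
  ultimately have "((\<lambda>r. bump (ln r / L) / r ^ m) has_field_derivative
      (dbump (ln r / L) * (1 / (r * L)) * r ^ m - bump (ln r / L) * (m * r ^ (m - 1))) / (r ^ m * r ^ m)) (at r)"
    using assms by (intro DERIV_divide) auto
  moreover have "(dbump (ln r / L) * (1 / (r * L)) * r ^ m - bump (ln r / L) * (m * r ^ (m - 1))) / (r ^ m * r ^ m)
      = radial_profile_deriv m L r"
    using assms by (cases m) (simp_all add: radial_profile_deriv_def field_simps)
  ultimately show ?thesis unfolding radial_profile_def[abs_def] by simp
qed

text \<open>With \<open>x = ln r / L\<close> all powers of \<open>r\<close> cancel, and the integral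
  becomes \<open>L\<close> times that of \<open>j\<close> over the unit interval. The cross term
  \<open>bump x * dbump x\<close> is half the derivative of \<open>(bump x)\<^sup>2\<close> and
  integrates to zero, which leaves
  \<open>I1 / L\<^sup>2 - (\<kappa> - m\<^sup>2) * I2\<close>.\<close>

lemma Hardy_sharp:
  assumes "\<kappa> > (real m)\<^sup>2"
  obtains L where "L > 0"
    "integral {1..exp L} (\<lambda>r. r ^ (2 * m + 1) * ((radial_profile_deriv m L r)\<^sup>2 - \<kappa> * (radial_profile m L r / r)\<^sup>2)) < 0"
proof -
  define I1 where "I1 = integral {0..1} (\<lambda>x. (dbump x)\<^sup>2)"
  define I2 where "I2 = integral {0..1} (\<lambda>x. (bump x)\<^sup>2)"
  note c = continuous_on_bump continuous_on_dbump
  have "I1 \<ge> 0" unfolding I1_def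
    by (intro integral_nonneg integrable_continuous_real continuous_intros c) simp
  have "I2 \<ge> 0" unfolding I2_def
    by (intro integral_nonneg integrable_continuous_real continuous_intros c) simp
  moreover have "I2 \<noteq> 0"
  proof
    assume "I2 = 0"
    then have "\<forall>x\<in>{0..1}. (bump x)\<^sup>2 = 0"
      unfolding I2_def by (subst (asm) integral_eq_0_iff) (auto intro!: continuous_intros c)
    then have "(bump (1/2))\<^sup>2 = 0" by simp
    then show False using bump_pos[of "1/2"] by simp
  qed
  ultimately have "I2 > 0" by simp
  have bb: "integral {0..1} (\<lambda>x. bump x * dbump x) = 0"
  proof -
    have "((\<lambda>x. bump x * dbump x) has_integral (bump 1)\<^sup>2 / 2 - (bump 0)\<^sup>2 / 2) {0..1}"
      by (intro fundamental_theorem_of_calculus)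
         (auto intro!: derivative_eq_intros has_field_derivative_at_within[OF bump_deriv]
           simp flip: has_real_derivative_iff_has_vector_derivative)
    then show ?thesis by (simp add: bump_eq_0 integral_unique)
  qed
  define \<delta> where "\<delta> = (\<kappa> - (real m)\<^sup>2) * I2"
  have "\<delta> > 0" using assms \<open>I2 > 0\<close> by (simp add: \<delta>_def)
  \<comment> \<open>Chosen so that \<open>L * \<delta>\<close> exceeds \<open>I1\<close>, while
    \<open>L \<ge> 1\<close> allows passing from \<open>L\<close> to
    \<open>L\<^sup>2\<close>.\<close>
  define L where "L = I1 / \<delta> + 1"
  have L: "L \<ge> 1" using \<open>I1 \<ge> 0\<close> \<open>\<delta> > 0\<close> by (simp add: L_def)
  have "I1 < L * \<delta>" using \<open>\<delta> > 0\<close> by (simp add: L_def field_simps)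
  also have "\<dots> \<le> L\<^sup>2 * \<delta>" using L \<open>\<delta> > 0\<close> by (intro mult_right_mono self_le_power) auto
  finally have less: "I1 / L\<^sup>2 < \<delta>" using L by (simp add: field_simps)
  define j where "j = (\<lambda>x. (dbump x / L - m * bump x)\<^sup>2 - \<kappa> * (bump x)\<^sup>2)"
  have cj: "continuous_on S j" for S
    unfolding j_def using L by (intro continuous_intros c) auto
  have ints: "((\<lambda>x. (dbump x)\<^sup>2) has_integral I1) {0..1}"
      "((\<lambda>x. (bump x)\<^sup>2) has_integral I2) {0..1}"
      "((\<lambda>x. bump x * dbump x) has_integral 0) {0..1}"
  proof -
    show "((\<lambda>x. (dbump x)\<^sup>2) has_integral I1) {0..1}" "((\<lambda>x. (bump x)\<^sup>2) has_integral I2) {0..1}"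
      unfolding I1_def I2_def
      by (intro integrable_integral integrable_continuous_real continuous_intros c)+
    have "(\<lambda>x. bump x * dbump x) integrable_on {0..1}"
      by (intro integrable_continuous_real continuous_intros c)
    then show "((\<lambda>x. bump x * dbump x) has_integral 0) {0..1}"
      using bb integrable_integral by fastforce
  qed
  have "j = (\<lambda>x. 1 / L\<^sup>2 * (dbump x)\<^sup>2 + ((- 2 * real m / L) * (bump x * dbump x) + ((real m)\<^sup>2 - \<kappa>) * (bump x)\<^sup>2))"
    using L by (auto simp: j_def fun_eq_iff power2_eq_square field_simps)
  moreover have "((\<lambda>x. 1 / L\<^sup>2 * (dbump x)\<^sup>2 + ((- 2 * real m / L) * (bump x * dbump x) + ((real m)\<^sup>2 - \<kappa>) * (bump x)\<^sup>2))
      has_integral (1 / L\<^sup>2 * I1 + ((- 2 * real m / L) * 0 + ((real m)\<^sup>2 - \<kappa>) * I2))) {0..1}"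
    by (intro has_integral_add has_integral_mult_right ints)
  ultimately have "integral {0..1} j = 1 / L\<^sup>2 * I1 + ((- 2 * real m / L) * 0 + ((real m)\<^sup>2 - \<kappa>) * I2)"
    by (simp only: integral_unique)
  then have jneg: "integral {0..1} j < 0"
    using less by (simp add: \<delta>_def algebra_simps)
  have "((\<lambda>r. (1 / (r * L)) *\<^sub>R j (ln r / L)) has_integral integral {ln 1 / L..ln (exp L) / L} j) {1..exp L}"
  proof (rule has_integral_substitution[where c = 0 and d = 1])
    show "(\<lambda>r. ln r / L) ` {1..exp L} \<subseteq> {0..1}"
      using L by (auto simp: field_simps ln_ge_iff[symmetric]) (metis exp_gt_zero ln_exp ln_le_cancel_iff less_le_trans zero_less_one)
    show "((\<lambda>r. ln r / L) has_field_derivative 1 / (x * L)) (at x within {1..exp L})" if "x \<in> {1..exp L}" for x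
      using that L by (auto intro!: derivative_eq_intros simp: field_simps)
  qed (use L cj in auto)
  then have "((\<lambda>r. L * ((1 / (r * L)) *\<^sub>R j (ln r / L))) has_integral L * integral {0..1} j) {1..exp L}"
    using L by (intro has_integral_mult_right) simp
  then have "((\<lambda>r. r ^ (2 * m + 1) * ((radial_profile_deriv m L r)\<^sup>2 - \<kappa> * (radial_profile m L r / r)\<^sup>2))
      has_integral L * integral {0..1} j) {1..exp L}"
  proof (rule has_integral_eq[rotated])
    fix r assume "r \<in> {1..exp L}"
    then have r: "r > 0" by auto
    have "r ^ (2 * m + 1) * ((radial_profile_deriv m L r)\<^sup>2 - \<kappa> * (radial_profile m L r / r)\<^sup>2)
       = r ^ (2 * m + 1) * (1 / (r ^ (m + 1))\<^sup>2 * j (ln r / L))"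
      using r by (simp add: radial_profile_deriv_def radial_profile_def j_def power_divide
          power_mult_distrib mult.commute right_diff_distrib diff_divide_distrib[of _ _ "_ ^ 2"])
    also have "r ^ (2 * m + 1) * (1 / (r ^ (m + 1))\<^sup>2 * j (ln r / L)) = (1 / r) * j (ln r / L)"
      using r by (simp add: field_simps power2_eq_square power_mult_distrib mult_2_right power_add)
    finally show "L * ((1 / (r * L)) *\<^sub>R j (ln r / L)) =
      r ^ (2 * m + 1) * ((radial_profile_deriv m L r)\<^sup>2 - \<kappa> * (radial_profile m L r / r)\<^sup>2)"
      using L by simp
  qed
  then have "integral {1..exp L} (\<lambda>r. r ^ (2 * m + 1) *
      ((radial_profile_deriv m L r)\<^sup>2 - \<kappa> * (radial_profile m L r / r)\<^sup>2)) = L * integral {0..1} j"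
    by (rule integral_unique)
  also have "\<dots> < 0" using L jneg by (simp add: mult_less_0_iff)
  finally show ?thesis using that[of L] L by simp
qed

section \<open>Orthonormal frames at a point of the sphere\<close>

lemma orthonormal_basis_insert:
  fixes x :: "'a::euclidean_space"
  assumes E: "orthonormal_basis {v. v \<bullet> x = 0} E" and x: "norm x = 1"
  shows "orthonormal_basis UNIV (insert x E)" "x \<notin> E"
proof -
  have orth: "e \<bullet> x = 0" if "e \<in> E" for e using orthonormal_basis_subset[OF E that] by simp
  then show "x \<notin> E" using x by (metis dot_square_norm one_power2 zero_neq_one)
  have "v \<in> span (insert x E)" for v
  proof -
    have "v - (v \<bullet> x) *\<^sub>R x \<in> span E"
      using E x unfolding orthonormal_basis_def by (simp add: inner_diff_left dot_square_norm)
    then have "v - (v \<bullet> x) *\<^sub>R x \<in> span (insert x E)" using span_mono[of E "insert x E"] by blast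
    then have "v - (v \<bullet> x) *\<^sub>R x + (v \<bullet> x) *\<^sub>R x \<in> span (insert x E)"
      by (intro span_add span_scale) (auto intro: span_base)
    then show ?thesis by simp
  qed
  then show "orthonormal_basis UNIV (insert x E)"
    using E x orth unfolding orthonormal_basis_def
    by (auto simp: pairwise_insert orthogonal_def inner_commute)
qed

lemma subspace_orthogonal_to_vector: "subspace {v. v \<bullet> x = 0}"
  by (auto simp: subspace_def inner_add_left)

section \<open>The cone as a graph\<close>

locale LO_map = harmonic_sphere_map P k
  for P :: "'b::finite \<Rightarrow> real^'a \<Rightarrow> real" and k :: nat +
  fixes \<theta> :: real
  assumes \<theta>: "0 < \<theta>" "\<theta> < pi / 2"
begin

lemma cos_pos: "cos \<theta> > 0" and sin_pos: "sin \<theta> > 0" and tan_pos: "tan \<theta> > 0"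
  using \<theta> cos_gt_zero sin_gt_zero_02 tan_gt_zero sin_gt_zero pi_gt_zero by auto

definition F :: "real^'a \<Rightarrow> real^'b" where
  "F y = (tan \<theta> * norm y) *\<^sub>R G y"

lemma Ck_on_F: "Ck_on j (- {0}) F"
  unfolding F_def by (intro Ck_on_scaleR Ck_on_mult Ck_on_const Ck_on_norm Ck_on_G) auto

sublocale C2_on "- {0}" F
  by unfold_locales (auto intro: Ck_on_F simp del: Ck_on.simps)

lemma DF_eq:
  assumes "y \<noteq> 0"
  shows "DF y v = tan \<theta> *\<^sub>R (((y \<bullet> v) / norm y) *\<^sub>R G y + norm y *\<^sub>R DG y v)"
proof -
  have n: "(norm has_derivative (\<lambda>v. (y \<bullet> v) / norm y)) (at y)"
    using has_derivative_norm[OF assms] by (simp add: sgn_div_norm inner_commute divide_inverse mult.commute)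
  have "(F has_derivative (\<lambda>v. tan \<theta> *\<^sub>R (((y \<bullet> v) / norm y) *\<^sub>R G y + norm y *\<^sub>R DG y v))) (at y)"
    unfolding F_def[abs_def]
    by (rule has_derivative_eq_rhs, rule has_derivative_scaleR[OF has_derivative_mult_right[OF n] G_deriv[OF assms]])
       (auto simp: algebra_simps)
  then show ?thesis by (simp flip: frechet_derivative_at)
qed

lemma DF_scale:
  assumes "y \<noteq> 0" "t > 0"
  shows "DF (t *\<^sub>R y) v = DF y v"
  using assms by (simp add: DF_eq G_scale DG_scale)

lemma F_scale: "t > 0 \<Longrightarrow> F (t *\<^sub>R y) = t *\<^sub>R F y"
  by (simp add: F_def G_scale)

lemma DF_radial: "y \<noteq> 0 \<Longrightarrow> DF y y = F y"
  by (simp add: DF_eq F_def DG_radial dot_square_norm power2_eq_square)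

text \<open>\<open>F\<close> is homogeneous of degree \<open>1\<close>, so \<open>DF\<close> is
  constant along rays. This is the flatness of a cone in its radial direction.\<close>

lemma hess_radial:
  assumes "y \<noteq> 0"
  shows "hess F y y w = 0"
proof -
  have "((\<lambda>t::real. DF (t *\<^sub>R y) w) has_derivative (\<lambda>h. hess F y (h *\<^sub>R y) w)) (at 1)"
    by (rule has_derivative_compose[of _ "\<lambda>h. h *\<^sub>R y"])
       (use DF_has_hess assms in \<open>auto intro!: derivative_eq_intros\<close>)
  moreover have "((\<lambda>t::real. DF (t *\<^sub>R y) w) has_derivative (\<lambda>h. 0)) (at 1)"
    by (rule has_derivative_transform_within_open[of "\<lambda>_. DF y w" _ _ _ "{0<..}"])
       (auto simp: DF_scale assms)
  ultimately have "(\<lambda>h::real. hess F y (h *\<^sub>R y) w) = (\<lambda>h. 0)"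
    by (rule has_derivative_unique)
  from fun_cong[OF this, of 1] show ?thesis by simp
qed

lemma hess_scale:
  assumes "y \<noteq> 0" "t > 0"
  shows "hess F (t *\<^sub>R y) v w = (1 / t) *\<^sub>R hess F y v w"
proof -
  have "((\<lambda>z. DF (t *\<^sub>R z) w) has_derivative (\<lambda>v. hess F (t *\<^sub>R y) (t *\<^sub>R v) w)) (at y)"
    by (rule has_derivative_compose[of _ "\<lambda>v. t *\<^sub>R v"])
       (use DF_has_hess[of "t *\<^sub>R y"] assms in \<open>auto intro!: derivative_eq_intros\<close>)
  then have "((\<lambda>z. DF z w) has_derivative (\<lambda>v. hess F (t *\<^sub>R y) (t *\<^sub>R v) w)) (at y)"
    by (rule has_derivative_transform_within_open[of _ _ _ _ "- {0}"])
       (use assms DF_scale in auto)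
  then have "(\<lambda>v. hess F (t *\<^sub>R y) (t *\<^sub>R v) w) = (\<lambda>v. hess F y v w)"
    by (rule has_derivative_unique[OF _ DF_has_hess]) (use assms in auto)
  from fun_cong[OF this, of "(1 / t) *\<^sub>R v"] show ?thesis
    using assms hess_bilinear[of y] by (simp add: bilinear_lmul)
qed

text \<open>Differentiate the identity \<open>G \<bullet> F = tan \<theta> * norm\<close> twice.\<close>

lemma G_inner_hess:
  assumes y: "y \<noteq> 0" and v: "y \<bullet> v = 0"
  shows "G y \<bullet> hess F y v v = tan \<theta> * ((v \<bullet> v) / norm y - norm y * (DG y v \<bullet> DG y v))"
proof -
  have n: "(norm has_derivative (\<lambda>v. (y \<bullet> v) / norm y)) (at y)"
    using has_derivative_norm[OF y] by (simp add: sgn_div_norm inner_commute divide_inverse mult.commute)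
  have eq: "G z \<bullet> DF z v = tan \<theta> * ((z \<bullet> v) / norm z)" if "z \<noteq> 0" for z
    using that G_inner_DG[OF that] norm_G[OF that]
    by (simp add: DF_eq inner_add_right dot_square_norm)
  have "((\<lambda>z. G z \<bullet> DF z v) has_derivative (\<lambda>w. G y \<bullet> hess F y w v + DG y w \<bullet> DF y v)) (at y)"
    using y by (intro has_derivative_inner G_deriv DF_has_hess) auto
  then have "((\<lambda>z. tan \<theta> * ((z \<bullet> v) / norm z)) has_derivative
      (\<lambda>w. G y \<bullet> hess F y w v + DG y w \<bullet> DF y v)) (at y)"
    by (rule has_derivative_transform_within_open[of _ _ _ _ "- {0}"]) (use y eq in auto)
  moreover have "((\<lambda>z. tan \<theta> * ((z \<bullet> v) / norm z)) has_derivative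
      (\<lambda>w. tan \<theta> * ((w \<bullet> v) / norm y))) (at y)"
    using y v by (auto intro!: derivative_eq_intros n simp: field_simps)
  ultimately have "(\<lambda>w. G y \<bullet> hess F y w v + DG y w \<bullet> DF y v) = (\<lambda>w. tan \<theta> * ((w \<bullet> v) / norm y))"
    by (rule has_derivative_unique)
  from fun_cong[OF this, of v] have "G y \<bullet> hess F y v v + DG y v \<bullet> DF y v = tan \<theta> * ((v \<bullet> v) / norm y)" .
  moreover have "DG y v \<bullet> DF y v = tan \<theta> * (norm y * (DG y v \<bullet> DG y v))"
    using v by (simp add: DF_eq[OF y])
  ultimately show ?thesis by (simp add: algebra_simps)
qed

definition cone_graph :: "((real^'a) \<times> (real^'b)) set" where
  "cone_graph = (\<lambda>y. (y, F y)) ` (- {0})"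

lemma LO_link_G: "LO_link G \<theta> = (\<lambda>x. (cos \<theta> *\<^sub>R x, sin \<theta> *\<^sub>R G x)) ` sphere 0 1"
  unfolding LO_link_def by auto

lemma link_point: "norm x = 1 \<Longrightarrow> (cos \<theta> *\<^sub>R x, sin \<theta> *\<^sub>R G x) = (cos \<theta> *\<^sub>R x, F (cos \<theta> *\<^sub>R x))"
  using cos_pos by (simp add: F_def G_scale tan_def)

lemma link_subset_cone_graph: "LO_link G \<theta> \<subseteq> cone_graph"
proof
  fix q assume "q \<in> LO_link G \<theta>"
  then obtain x where x: "norm x = 1" "q = (cos \<theta> *\<^sub>R x, sin \<theta> *\<^sub>R G x)"
    unfolding LO_link_G by auto
  have "cos \<theta> *\<^sub>R x \<in> - {0}" using x cos_pos by auto
  then show "q \<in> cone_graph" unfolding cone_graph_def x(2) link_point[OF x(1)] by blast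
qed

lemma cone_minus_0: "LO_cone G \<theta> - {0} = cone_graph"
proof (intro equalityI subsetI)
  fix q assume "q \<in> LO_cone G \<theta> - {0}"
  then obtain t x where t: "t \<ge> 0" "norm x = 1" "q = t *\<^sub>R (cos \<theta> *\<^sub>R x, sin \<theta> *\<^sub>R G x)" "q \<noteq> 0"
    unfolding LO_cone_def LO_link_def by auto
  then have "t > 0" by (cases "t = 0") (auto simp: zero_prod_def)
  have "q = (t *\<^sub>R (cos \<theta> *\<^sub>R x), F (t *\<^sub>R (cos \<theta> *\<^sub>R x)))"
    using t(3) link_point[OF t(2)] F_scale[OF \<open>t > 0\<close>] by (metis scaleR_Pair)
  moreover have "t *\<^sub>R (cos \<theta> *\<^sub>R x) \<in> - {0}" using t(2) \<open>t > 0\<close> cos_pos by auto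
  ultimately show "q \<in> cone_graph" unfolding cone_graph_def by blast
next
  fix q assume "q \<in> cone_graph"
  then obtain y where y: "y \<noteq> 0" "q = (y, F y)" unfolding cone_graph_def by auto
  let ?x = "(1 / norm y) *\<^sub>R y" and ?t = "norm y / cos \<theta>"
  have x: "norm ?x = 1" "?t > 0" using y cos_pos by auto
  have "?t *\<^sub>R (cos \<theta> *\<^sub>R ?x) = y" using y cos_pos by simp
  then have "q = ?t *\<^sub>R (cos \<theta> *\<^sub>R ?x, sin \<theta> *\<^sub>R G ?x)"
    using F_scale[OF x(2), of "cos \<theta> *\<^sub>R ?x"] unfolding link_point[OF x(1)] y(2) by simp
  then have "q \<in> LO_cone G \<theta>"
    unfolding LO_cone_def LO_link_G using x(1) less_imp_le[OF x(2)]
    by (intro CollectI exI[of _ ?t] exI[of _ "(cos \<theta> *\<^sub>R ?x, sin \<theta> *\<^sub>R G ?x)"] conjI image_eqI[of _ _ ?x])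
       (simp_all only: mem_sphere dist_0_norm)
  moreover have "q \<noteq> 0" using y by (auto simp: zero_prod_def)
  ultimately show "q \<in> LO_cone G \<theta> - {0}" by blast
qed

lemma open_fst_nonzero: "open {q :: (real^'a) \<times> (real^'b). fst q \<noteq> 0}"
  by (intro open_Collect_neq continuous_intros)

lemma Ck_on_F_fst: "Ck_on j {q. fst q \<noteq> 0} (\<lambda>q :: (real^'a) \<times> (real^'b). F (fst q))"
  by (rule Ck_on_compose[OF open_fst_nonzero _ Ck_on_F Ck_on_bounded_linear]) (auto intro: bounded_linear_fst)

text \<open>The shear that subtracts \<open>F\<close> flattens the whole graph at once, so one slice
  chart serves every point.\<close>

lemma submanifold_graph: "submanifold CARD('a) cone_graph"
  unfolding submanifold_def
proof
  fix q assume "q \<in> cone_graph"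
  let ?U = "{q :: (real^'a) \<times> (real^'b). fst q \<noteq> 0}"
  let ?\<Phi> = "\<lambda>q :: (real^'a) \<times> (real^'b). (fst q, snd q - F (fst q))"
  let ?\<Psi> = "\<lambda>q :: (real^'a) \<times> (real^'b). (fst q, snd q + F (fst q))"
  let ?L = "(UNIV :: (real^'a) set) \<times> {0 :: real^'b}"
  note fst = Ck_on_bounded_linear[OF bounded_linear_fst] and snd = Ck_on_bounded_linear[OF bounded_linear_snd]
  have im: "?\<Phi> ` ?U = ?U"
  proof (intro equalityI subsetI)
    fix z assume "z \<in> ?U"
    then show "z \<in> ?\<Phi> ` ?U" by (intro image_eqI[of _ _ "?\<Psi> z"]) auto
  qed auto
  have "smooth_on ?U ?\<Phi>" "smooth_on ?U ?\<Psi>"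
    by (intro smooth_onI[OF open_fst_nonzero] Ck_on_Pair Ck_on_diff Ck_on_add fst snd Ck_on_F_fst open_fst_nonzero subset_refl)+
  moreover have "dim ?L = CARD('a)"
    by (subst dim_Times) auto
  moreover have "subspace ?L" by (simp add: subspace_Times)
  moreover have "?\<Phi> ` (cone_graph \<inter> ?U) = ?L \<inter> ?\<Phi> ` ?U"
    unfolding im
  proof (intro equalityI subsetI)
    fix z assume "z \<in> ?L \<inter> ?U"
    then show "z \<in> ?\<Phi> ` (cone_graph \<inter> ?U)"
      by (intro image_eqI[of _ _ "?\<Psi> z"]) (auto simp: cone_graph_def)
  qed (auto simp: cone_graph_def)
  moreover have "q \<in> ?U" using \<open>q \<in> cone_graph\<close> by (auto simp: cone_graph_def)
  ultimately have key: "open ?U \<and> q \<in> ?U \<and> open (?\<Phi> ` ?U) \<and> smooth_on ?U ?\<Phi> \<and> smooth_on (?\<Phi> ` ?U) ?\<Psi> \<and>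
      (\<forall>y\<in>?U. ?\<Psi> (?\<Phi> y) = y) \<and> subspace ?L \<and> dim ?L = CARD('a) \<and> ?\<Phi> ` (cone_graph \<inter> ?U) = ?L \<inter> ?\<Phi> ` ?U"
    using open_fst_nonzero unfolding im by simp
  show "\<exists>U (\<Phi> :: (real^'a) \<times> (real^'b) \<Rightarrow> (real^'a) \<times> (real^'b)) \<Psi> L. open U \<and> q \<in> U \<and> open (\<Phi> ` U) \<and> smooth_on U \<Phi> \<and> smooth_on (\<Phi> ` U) \<Psi> \<and>
      (\<forall>y\<in>U. \<Psi> (\<Phi> y) = y) \<and> subspace L \<and> dim L = CARD('a) \<and> \<Phi> ` (cone_graph \<inter> U) = L \<inter> \<Phi> ` U"
    by (rule exI[where x = ?U], rule exI[where x = ?\<Phi>], rule exI[where x = ?\<Psi>],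
        rule exI[where x = ?L], rule key)
qed

section \<open>Tangent spaces, tangential extensions and normal spaces of the cone and of its
  link\<close>

lemma tangent_space_graph:
  assumes "y \<noteq> 0"
  shows "tangent_space cone_graph (y, F y) = range (\<lambda>v. (v, DF y v))"
proof (intro equalityI subsetI)
  fix v assume v: "v \<in> tangent_space cone_graph (y, F y)"
  have "cone_graph \<subseteq> (\<lambda>y. (y, F y)) ` (- {0})" "(y, F y) \<in> cone_graph"
    using assms unfolding cone_graph_def by blast+
  from tangent_space_graph_subset[OF this v] have "v = (fst v, DF y (fst v))"
    by (simp add: prod_eq_iff)
  then show "v \<in> range (\<lambda>v. (v, DF y v))" by (rule range_eqI)
next
  fix q assume "q \<in> range (\<lambda>v. (v, DF y v))"
  then obtain v where v: "q = (v, DF y v)" by auto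
  have "v \<in> tangent_space (- {0}) y" using assms tangent_space_open[of "- {0}" y] by auto
  then have "frechet_derivative (\<lambda>y. (y, F y)) (at y) v \<in> tangent_space cone_graph (y, F y)"
    by (rule tangent_space_image[where U = "- {0}"])
       (auto simp: cone_graph_def intro!: Ck_on_Pair Ck_on_id Ck_on_F)
  moreover have "((\<lambda>y. (y, F y)) has_derivative (\<lambda>v. (v, DF y v))) (at y)"
    using assms by (intro has_derivative_Pair has_derivative_ident F_deriv) auto
  ultimately show "q \<in> tangent_space cone_graph (y, F y)"
    unfolding v by (simp flip: frechet_derivative_at)
qed

lemma tangent_space_link:
  assumes x: "norm x = 1"
  defines "y \<equiv> cos \<theta> *\<^sub>R x"
  shows "tangent_space (LO_link G \<theta>) (y, F y) = (\<lambda>v. (v, DF y v)) ` {v. v \<bullet> x = 0}"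
proof (intro equalityI subsetI)
  have y0: "y \<noteq> 0" and x0: "x \<noteq> 0" using x cos_pos by (auto simp: y_def)
  have mem: "(y, F y) \<in> LO_link G \<theta>"
    using x link_point[OF x] unfolding LO_link_G y_def by auto
  {
    fix v assume v: "v \<in> tangent_space (LO_link G \<theta>) (y, F y)"
    have "snd v = DF y (fst v)"
      using tangent_space_graph_subset[OF _ mem v] link_subset_cone_graph unfolding cone_graph_def by auto
    moreover have "2 * (fst v \<bullet> y) = 0"
    proof (rule tangent_space_level_set[OF _ mem _ v])
      show "((\<lambda>q. fst q \<bullet> fst q) has_derivative (\<lambda>v. 2 * (fst v \<bullet> y))) (at (y, F y))"
        by (auto intro!: derivative_eq_intros simp: inner_commute)
      show "fst q \<bullet> fst q = (cos \<theta>)\<^sup>2" if "q \<in> LO_link G \<theta>" for q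
        using that unfolding LO_link_G by (auto simp: dot_square_norm)
    qed
    ultimately show "v \<in> (\<lambda>v. (v, DF y v)) ` {v. v \<bullet> x = 0}"
      using cos_pos by (intro image_eqI[of _ _ "fst v"]) (auto simp: y_def prod_eq_iff)
  next
    fix q assume "q \<in> (\<lambda>v. (v, DF y v)) ` {v. v \<bullet> x = 0}"
    then obtain v where v: "q = (v, DF y v)" "v \<bullet> x = 0" by auto
    let ?w = "(1 / cos \<theta>) *\<^sub>R v" and ?\<Phi> = "\<lambda>x. (cos \<theta> *\<^sub>R x, sin \<theta> *\<^sub>R G x)"
    have "?w \<in> tangent_space (sphere 0 1) x" using v x by (simp add: tangent_space_sphere)
    then have "frechet_derivative ?\<Phi> (at x) ?w \<in> tangent_space (LO_link G \<theta>) (?\<Phi> x)"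
      by (rule tangent_space_image[where U = "- {0}"])
         (auto simp: LO_link_G intro!: Ck_on_Pair Ck_on_scaleR Ck_on_const Ck_on_id Ck_on_G)
    moreover have "(?\<Phi> has_derivative (\<lambda>v. (cos \<theta> *\<^sub>R v, sin \<theta> *\<^sub>R DG x v))) (at x)"
      using x0 by (intro has_derivative_Pair has_derivative_scaleR_right has_derivative_ident G_deriv)
    moreover have "sin \<theta> *\<^sub>R DG x ?w = DF y v"
      using x x0 v cos_pos
      by (simp add: DF_eq[OF y0, unfolded y_def] y_def DG_scale linear_cmul[OF DG_linear[OF x0]] inner_commute tan_def)
    ultimately show "q \<in> tangent_space (LO_link G \<theta>) (y, F y)"
      using cos_pos link_point[OF x] unfolding v y_def by (simp flip: frechet_derivative_at)
  }
qed

text \<open>Fields of this form witness that tangential extensions exist; without a witness the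
  choice in \<open>second_fundamental_form\<close> would say nothing. The value of \<open>DF\<close>
  at a moving vector is again expanded in \<open>Basis\<close>.\<close>

lemma Ck_on_graph_field:
  assumes "\<And>j. Ck_on j (- {0}) W"
  shows "Ck_on j {q. fst q \<noteq> 0} (\<lambda>q :: (real^'a) \<times> (real^'b). (W (fst q), DF (fst q) (W (fst q))))"
proof (rule Ck_on_cong[OF open_fst_nonzero])
  have comp: "Ck_on j {q. fst q \<noteq> 0} (\<lambda>q :: (real^'a) \<times> (real^'b). h (fst q))"
    if "Ck_on j (- {0}) h" for h :: "real^'a \<Rightarrow> 'c::real_normed_vector"
    by (rule Ck_on_compose[OF open_fst_nonzero _ that Ck_on_bounded_linear]) (auto intro: bounded_linear_fst)
  have "Ck_on j (- {0}) (\<lambda>y. DF y b)" for b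
    using Ck_on_F[of "Suc j"] by simp
  then show "Ck_on j {q. fst q \<noteq> 0} (\<lambda>q :: (real^'a) \<times> (real^'b).
      (W (fst q), \<Sum>b\<in>Basis. (W (fst q) \<bullet> b) *\<^sub>R DF (fst q) b))"
    by (intro Ck_on_Pair Ck_on_sum Ck_on_scaleR Ck_on_inner Ck_on_const comp assms open_fst_nonzero)
  show "(W (fst q), \<Sum>b\<in>Basis. (W (fst q) \<bullet> b) *\<^sub>R DF (fst q) b) = (W (fst q), DF (fst q) (W (fst q)))"
    if "q \<in> {q. fst q \<noteq> 0}" for q :: "(real^'a) \<times> (real^'b)"
    using linear_Basis_expand[OF DF_linear, of "fst q" "W (fst q)"] that by simp
qed

lemma tangent_extension_graph:
  assumes "y \<noteq> 0" "w \<in> tangent_space cone_graph (y, F y)"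
  shows "\<exists>Y. tangent_extension cone_graph (y, F y) w Y"
proof -
  let ?Y = "\<lambda>q. (fst w, DF (fst q) (fst w))"
  have "smooth_on (cone_graph \<inter> UNIV) ?Y"
    by (rule smooth_onI[OF open_fst_nonzero _ Ck_on_graph_field[OF Ck_on_const]])
       (auto simp: cone_graph_def)
  moreover have "?Y q \<in> tangent_space cone_graph q" if q: "q \<in> cone_graph" for q
  proof -
    obtain z where "z \<noteq> 0" "q = (z, F z)" using q unfolding cone_graph_def by auto
    then show ?thesis using tangent_space_graph[of z] by simp
  qed
  moreover have "?Y (y, F y) = w" using assms tangent_space_graph by auto
  ultimately show ?thesis unfolding tangent_extension_def by (intro exI[of _ ?Y] conjI exI[of _ UNIV]) auto
qed

lemma tangent_extension_link:
  assumes x: "norm x = 1"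
  defines "y \<equiv> cos \<theta> *\<^sub>R x"
  assumes w: "w \<in> tangent_space (LO_link G \<theta>) (y, F y)"
  shows "\<exists>Y. tangent_extension (LO_link G \<theta>) (y, F y) w Y"
proof -
  \<comment> \<open>The constant vector \<open>fst w\<close> made orthogonal to the position
    \<open>z\<close>. The power \<open>-2\<close> keeps the field smooth on the punctured space, and
    at \<open>y\<close> nothing is subtracted.\<close>
  let ?W = "\<lambda>z. fst w - (norm z powr (-2) * (fst w \<bullet> z)) *\<^sub>R z"
  let ?Y = "\<lambda>q. (?W (fst q), DF (fst q) (?W (fst q)))"
  have "smooth_on (LO_link G \<theta> \<inter> UNIV) ?Y"
  proof (rule smooth_onI[OF open_fst_nonzero _ Ck_on_graph_field])
    show "Ck_on j (- {0}) ?W" for j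
      by (intro Ck_on_diff Ck_on_scaleR Ck_on_mult Ck_on_inner Ck_on_const Ck_on_id Ck_on_norm_powr) auto
  qed (use link_subset_cone_graph in \<open>auto simp: cone_graph_def\<close>)
  moreover have "?Y q \<in> tangent_space (LO_link G \<theta>) q" if q: "q \<in> LO_link G \<theta>" for q
  proof -
    obtain u where u: "norm u = 1" "q = (cos \<theta> *\<^sub>R u, F (cos \<theta> *\<^sub>R u))"
      using q link_point unfolding LO_link_G by auto
    have "?W (fst q) \<bullet> u = 0"
      using u cos_pos by (simp add: inner_diff_left powr_minus power2_eq_square dot_square_norm field_simps)
    then show ?thesis using u tangent_space_link[OF u(1)] by auto
  qed
  moreover have "?Y (y, F y) = w"
  proof -
    have "fst w \<bullet> y = 0" "w = (fst w, DF y (fst w))"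
      using w tangent_space_link[OF x] unfolding y_def by auto
    then show ?thesis by simp
  qed
  ultimately show ?thesis unfolding tangent_extension_def by (intro exI[of _ ?Y] conjI exI[of _ UNIV]) auto
qed

definition graph_normal :: "real^'a \<Rightarrow> ((real^'a) \<times> (real^'b)) set" where
  "graph_normal y = {w. \<forall>v. w \<bullet> (v, DF y v) = 0}"

lemma normal_space_graph:
  assumes "y \<noteq> 0"
  shows "normal_space UNIV cone_graph (y, F y) = graph_normal y"
  unfolding normal_space_def tangent_space_graph[OF assms] graph_normal_def
  by (auto simp: tangent_space_open)

text \<open>Inside the sphere the radial direction is excluded from the start. It equals
  \<open>(y, DF y y)\<close> and is tangent to the graph, so the link in the sphere and the cone in
  Euclidean space have the same normal vectors.\<close>

lemma normal_space_link:
  assumes x: "norm x = 1"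
  defines "y \<equiv> cos \<theta> *\<^sub>R x"
  shows "normal_space (sphere 0 1) (LO_link G \<theta>) (y, F y) = graph_normal y"
proof -
  have y0: "y \<noteq> 0" and x0: "x \<noteq> 0" using x cos_pos by (auto simp: y_def)
  have "norm (y, F y) = 1"
    using link_point[OF x] norm_G[OF x0] x cos_pos sin_pos
    unfolding y_def by (metis (no_types, lifting) norm_Pair norm_scaleR abs_of_pos mult.right_neutral
        power_one_over real_sqrt_one sin_cos_squared_add2)
  then have ts: "tangent_space (sphere 0 1) (y, F y) = {v. v \<bullet> (y, F y) = 0}"
    by (rule tangent_space_sphere)
  have Fy: "F y = DF y y" using DF_radial[OF y0] by simp
  have "w \<bullet> (v, DF y v) = 0"
    if "w \<bullet> (y, F y) = 0" and w: "\<And>u. u \<bullet> x = 0 \<Longrightarrow> w \<bullet> (u, DF y u) = 0" for w :: "(real^'a) \<times> (real^'b)" and v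
  proof -
    let ?c = "(v \<bullet> x) / cos \<theta>" and ?u = "v - (v \<bullet> x) *\<^sub>R x"
    have "v = ?u + ?c *\<^sub>R y" using cos_pos by (simp add: y_def)
    then have d: "(v, DF y v) = (?u, DF y ?u) + ?c *\<^sub>R (y, F y)"
      using Fy linear_add[OF DF_linear] linear_cmul[OF DF_linear] y0
      by (metis (no_types, lifting) ComplI add_Pair scaleR_Pair singletonD)
    have "?u \<bullet> x = 0" using x by (simp add: inner_diff_left dot_square_norm)
    from w[OF this] that(1) show ?thesis unfolding d inner_add_right inner_scaleR_right by simp
  qed
  then show ?thesis
    unfolding normal_space_def ts graph_normal_def tangent_space_link[OF x, folded y_def]
    using Fy by auto
qed

lemma subspace_graph_normal: "subspace (graph_normal y)"
  unfolding graph_normal_def subspace_def by (auto simp: inner_add_left simp del: inner_Pair)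

text \<open>Such a vector is tangent to the graph, hence of the form \<open>(v, DF y v)\<close>, and
  being vertical it has \<open>v = 0\<close>. Vanishing mean curvature thereby becomes an equation
  for the trace of the Hessian itself, with no projection left.\<close>

lemma vertical_normal_projection_eq_0:
  assumes "y \<noteq> 0" "orth_proj (graph_normal y) (0, \<zeta>) = 0"
  shows "\<zeta> = 0"
proof -
  have lin: "linear (DF y)" using assms DF_linear by simp
  let ?T = "range (\<lambda>v. (v, DF y v))"
  have lin2: "linear (\<lambda>v. (v, DF y v))"
    using lin by (intro linearI) (simp_all add: linear_add linear_cmul)
  then have "subspace ?T" by (rule linear_subspace_image[OF _ subspace_UNIV])
  then have T: "span ?T = ?T" by (simp add: span_eq_iff)
  obtain a z where az: "a \<in> ?T" "\<And>w. w \<in> ?T \<Longrightarrow> orthogonal z w" "(0, \<zeta>) = a + z"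
    using orthogonal_subspace_decomp_exists[of ?T "(0, \<zeta>)"] unfolding T by blast
  have "z \<in> graph_normal y" using az(2) by (auto simp: graph_normal_def orthogonal_def)
  then have "(0, \<zeta>) \<bullet> z = 0"
    using orth_proj(2)[OF subspace_graph_normal, of z y "(0, \<zeta>)"] assms by simp
  moreover have "a \<bullet> z = 0" using az(2)[OF az(1)] by (simp add: orthogonal_def inner_commute)
  ultimately have "z \<bullet> z = 0" by (simp add: az(3) inner_add_left)
  then have "(0, \<zeta>) \<in> ?T" using az by simp
  then show ?thesis using linear_0[OF lin] by auto
qed

section \<open>Mean curvature as a trace of the Hessian, and minimality of the cone\<close>

lemma mean_curvature_eq:
  assumes S: "S \<subseteq> cone_graph" and p: "(y, F y) \<in> S"
    and ext: "\<And>w. w \<in> tangent_space S (y, F y) \<Longrightarrow> \<exists>Y. tangent_extension S (y, F y) w Y"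
    and N: "normal_space A S (y, F y) = graph_normal y"
    and sub: "subspace (tangent_space S (y, F y))"
  obtains E where "orthonormal_basis (tangent_space S (y, F y)) E"
    "mean_curvature A S (y, F y) = orth_proj (graph_normal y) (0, \<Sum>e\<in>E. hess F y (fst e) (fst e))"
proof -
  define E where "E = (SOME E. orthonormal_basis (tangent_space S (y, F y)) E)"
  have E: "orthonormal_basis (tangent_space S (y, F y)) E"
    unfolding E_def using orthonormal_basis_exists[OF sub] by (rule someI_ex)
  have "mean_curvature A S (y, F y) = (\<Sum>e\<in>E. second_fundamental_form A S (y, F y) e e)"
    by (simp add: mean_curvature_def E_def)
  also have "\<dots> = (\<Sum>e\<in>E. orth_proj (graph_normal y) (0, hess F y (fst e) (fst e)))"
  proof (rule sum.cong)
    fix e assume "e \<in> E"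
    then have e: "e \<in> tangent_space S (y, F y)" by (rule orthonormal_basis_subset[OF E])
    show "second_fundamental_form A S (y, F y) e e = orth_proj (graph_normal y) (0, hess F y (fst e) (fst e))"
      using second_fundamental_form_graph[OF S[unfolded cone_graph_def] p e ext[OF e], of A] N
      by (simp add: graph_normal_def)
  qed simp
  also have "\<dots> = orth_proj (graph_normal y) (\<Sum>e\<in>E. (0, hess F y (fst e) (fst e)))"
    by (rule orth_proj_sum[OF subspace_graph_normal, symmetric])
  also have "(\<Sum>e\<in>E. (0, hess F y (fst e) (fst e))) = (0, \<Sum>e\<in>E. hess F y (fst e) (fst e))"
    by (induction E rule: infinite_finite_induct) (auto simp: zero_prod_def)
  finally show ?thesis using that E by blast
qed

lemma bilinear_hess_fst:
  assumes "y \<noteq> 0"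
  shows "bilinear (\<lambda>(v :: (real^'a) \<times> (real^'b)) (w :: (real^'a) \<times> (real^'b)). hess F y (fst v) (fst w))"
proof -
  have "bilinear (hess F y)" using hess_bilinear assms by simp
  then have B: "linear (hess F y a)" "linear (\<lambda>v. hess F y v a)" for a
    unfolding bilinear_def by blast+
  show ?thesis
    unfolding bilinear_def
  proof (intro conjI allI)
    fix v :: "(real^'a) \<times> (real^'b)"
    show "linear (\<lambda>w :: (real^'a) \<times> (real^'b). hess F y (fst v) (fst w))"
      using linear_compose[OF linear_fst B(1)[of "fst v"]] by (simp only: o_def)
    show "linear (\<lambda>w :: (real^'a) \<times> (real^'b). hess F y (fst w) (fst v))"
      using linear_compose[OF linear_fst B(2)[of "fst v"]] by (simp only: o_def)
  qed
qed

lemma linear_graph_tangent: "y \<noteq> 0 \<Longrightarrow> linear (\<lambda>v. (v, DF y v))"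
  using DF_linear[of y] by (intro linearI) (simp_all add: linear_add linear_cmul)

lemma trace_hess_link:
  assumes x: "norm x = 1"
  defines "y \<equiv> cos \<theta> *\<^sub>R x"
  assumes H: "mean_curvature (sphere 0 1) (LO_link G \<theta>) (y, F y) = 0"
    and E: "orthonormal_basis (tangent_space (LO_link G \<theta>) (y, F y)) E"
  shows "(\<Sum>e\<in>E. hess F y (fst e) (fst e)) = 0"
proof -
  have y0: "y \<noteq> 0" using x cos_pos by (auto simp: y_def)
  have "(y, F y) \<in> LO_link G \<theta>"
    using x link_point[OF x] unfolding LO_link_G y_def by auto
  moreover have "subspace (tangent_space (LO_link G \<theta>) (y, F y))"
    unfolding y_def tangent_space_link[OF x]
    using linear_subspace_image[OF linear_graph_tangent[OF y0] subspace_orthogonal_to_vector] by (simp add: y_def)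
  ultimately obtain E' where E': "orthonormal_basis (tangent_space (LO_link G \<theta>) (y, F y)) E'"
    "mean_curvature (sphere 0 1) (LO_link G \<theta>) (y, F y) =
      orth_proj (graph_normal y) (0, \<Sum>e\<in>E'. hess F y (fst e) (fst e))"
    using mean_curvature_eq[OF link_subset_cone_graph, of y "sphere 0 1"] tangent_extension_link[OF x]
      normal_space_link[OF x] unfolding y_def by blast
  have "(\<Sum>e\<in>E'. hess F y (fst e) (fst e)) = 0"
    using vertical_normal_projection_eq_0[OF y0] E'(2) H by simp
  then show ?thesis using bilinear_trace_independent[OF E E'(1) bilinear_hess_fst[OF y0]] by simp
qed

text \<open>Along a ray the tangent space of the cone is constant and the Hessian scales by
  \<open>1 / t\<close>, so it is enough to look at the point on the link. There an orthonormal basis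
  consists of one of the link together with the unit radial vector, which contributes nothing to the
  trace.\<close>

lemma minimal_cone_LO_cone:
  assumes H: "\<And>q. q \<in> LO_link G \<theta> \<Longrightarrow> mean_curvature (sphere 0 1) (LO_link G \<theta>) q = 0"
  shows "minimal_cone CARD('a) (LO_cone G \<theta>)"
proof -
  have "mean_curvature UNIV cone_graph q = 0" if q: "q \<in> cone_graph" for q
  proof -
    obtain y' where y': "y' \<noteq> 0" "q = (y', F y')" using q unfolding cone_graph_def by auto
    \<comment> \<open>The ray through \<open>q\<close> meets the link in \<open>(y, F y)\<close>,
      and \<open>q\<close> is \<open>t\<close> times that point.\<close>
    define x where "x = (1 / norm y') *\<^sub>R y'"
    define t where "t = norm y' / cos \<theta>"
    define y where "y = cos \<theta> *\<^sub>R x"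
    have x: "norm x = 1" and t: "t > 0" using y' cos_pos by (auto simp: x_def t_def)
    have y't: "y' = t *\<^sub>R y" using y' cos_pos by (simp add: x_def t_def y_def)
    have y0: "y \<noteq> 0" using x cos_pos by (auto simp: y_def)
    have sub: "subspace (tangent_space cone_graph (y', F y'))"
      unfolding tangent_space_graph[OF y'(1)]
      using linear_subspace_image[OF linear_graph_tangent[OF y'(1)] subspace_UNIV] .
    obtain E' where E': "orthonormal_basis (tangent_space cone_graph (y', F y')) E'"
      "mean_curvature UNIV cone_graph (y', F y') = orth_proj (graph_normal y') (0, \<Sum>e\<in>E'. hess F y' (fst e) (fst e))"
      using mean_curvature_eq[OF subset_refl, of y' UNIV] tangent_extension_graph[OF y'(1)]
        normal_space_graph[OF y'(1)] sub q y'(2) by blast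
    have subM: "subspace (tangent_space (LO_link G \<theta>) (y, F y))"
      unfolding y_def tangent_space_link[OF x]
      using linear_subspace_image[OF linear_graph_tangent[OF y0] subspace_orthogonal_to_vector] by (simp add: y_def)
    obtain E where E: "orthonormal_basis (tangent_space (LO_link G \<theta>) (y, F y)) E"
      using orthonormal_basis_exists[OF subM] by blast
    have mem: "(y, F y) \<in> LO_link G \<theta>"
      using x link_point[OF x] unfolding LO_link_G y_def by auto
    have normp: "norm (y, F y) = 1"
    proof -
      have "x \<noteq> 0" using x by (metis norm_zero zero_neq_one)
      then have "norm (G x) = 1" by (rule norm_G)
      then have "(norm (cos \<theta> *\<^sub>R x, sin \<theta> *\<^sub>R G x))\<^sup>2 = 1"
        using x by (simp add: norm_Pair)
      then have "(norm (y, F y))\<^sup>2 = 1" unfolding link_point[OF x] y_def .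
      then show ?thesis using norm_ge_zero[of "(y, F y)"] by (simp only: power2_eq_1_iff) linarith
    qed
    have orth: "e \<bullet> (y, F y) = 0" if "e \<in> E" for e
    proof -
      have e: "e \<in> tangent_space (LO_link G \<theta>) (y, F y)" using that by (rule orthonormal_basis_subset[OF E])
      have "2 * (e \<bullet> (y, F y)) = 0"
      proof (rule tangent_space_level_set[OF _ mem _ e])
        show "((\<lambda>q. q \<bullet> q) has_derivative (\<lambda>v. 2 * (v \<bullet> (y, F y)))) (at (y, F y))"
          by (auto intro!: derivative_eq_intros simp: inner_commute simp del: inner_Pair)
        show "q \<bullet> q = 1" if "q \<in> LO_link G \<theta>" for q
        proof -
          obtain u where u: "norm u = 1" "q = (cos \<theta> *\<^sub>R u, sin \<theta> *\<^sub>R G u)"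
            using \<open>q \<in> LO_link G \<theta>\<close> unfolding LO_link_G by auto
          have "u \<noteq> 0" using u(1) by (metis norm_zero zero_neq_one)
          then have "norm (G u) = 1" by (rule norm_G)
          then show ?thesis
            using u(1) unfolding u(2) by (simp add: dot_square_norm norm_Pair)
        qed
      qed
      then show ?thesis by simp
    qed
    have "orthonormal_basis (range (\<lambda>v. (v, DF y v))) (insert (y, F y) E)"
    proof -
      have "span (insert (y, F y) E) = range (\<lambda>v. (v, DF y v))"
      proof (rule span_subspace)
        have "E \<subseteq> range (\<lambda>v. (v, DF y v))"
          using orthonormal_basis_subset[OF E] unfolding y_def tangent_space_link[OF x] by auto
        moreover have "(y, F y) \<in> range (\<lambda>v. (v, DF y v))" using DF_radial[OF y0] by (metis rangeI)
        ultimately show "insert (y, F y) E \<subseteq> range (\<lambda>v. (v, DF y v))" by blast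
        show "subspace (range (\<lambda>v. (v, DF y v)))"
          using linear_subspace_image[OF linear_graph_tangent[OF y0] subspace_UNIV] .
        show "range (\<lambda>v. (v, DF y v)) \<subseteq> span (insert (y, F y) E)"
        proof
          fix q assume "q \<in> range (\<lambda>v. (v, DF y v))"
          then obtain v where v: "q = (v, DF y v)" by auto
          let ?c = "(v \<bullet> x) / cos \<theta>" and ?u = "v - (v \<bullet> x) *\<^sub>R x"
          have "v = ?u + ?c *\<^sub>R y" using cos_pos by (simp add: y_def)
          then have q: "q = (?u, DF y ?u) + ?c *\<^sub>R (y, F y)"
            using DF_radial[OF y0] linear_add[OF DF_linear] linear_cmul[OF DF_linear] y0 v
            by (metis (no_types, lifting) ComplI add_Pair scaleR_Pair singletonD)
          have "?u \<bullet> x = 0" using x by (simp add: inner_diff_left dot_square_norm)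
          then have "(?u, DF y ?u) \<in> span E"
            using E tangent_space_link[OF x, folded y_def] unfolding orthonormal_basis_def by auto
          then have "(?u, DF y ?u) \<in> span (insert (y, F y) E)"
            using span_mono[of E "insert (y, F y) E"] by blast
          then show "q \<in> span (insert (y, F y) E)"
            unfolding q by (intro span_add span_scale) (auto intro: span_base)
        qed
      qed
      then show ?thesis
        using E orth normp unfolding orthonormal_basis_def
        by (auto simp: pairwise_insert orthogonal_def inner_commute simp del: inner_Pair)
    qed
    moreover have "range (\<lambda>v. (v, DF y v)) = tangent_space cone_graph (y', F y')"
    proof -
      have "DF y' = DF y" using DF_scale[OF y0 t] by (simp add: y't fun_eq_iff)
      then show ?thesis unfolding tangent_space_graph[OF y'(1)] by simp
    qed
    ultimately have "(\<Sum>e\<in>E'. hess F y' (fst e) (fst e)) = (\<Sum>e\<in>insert (y, F y) E. hess F y' (fst e) (fst e))"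
      using bilinear_trace_independent[OF E'(1) _ bilinear_hess_fst[OF y'(1)]] by simp
    also have "\<dots> = (1 / t) *\<^sub>R (\<Sum>e\<in>insert (y, F y) E. hess F y (fst e) (fst e))"
      by (simp add: y't hess_scale[OF y0 t] scaleR_right.sum)
    also have "(\<Sum>e\<in>insert (y, F y) E. hess F y (fst e) (fst e)) = (\<Sum>e\<in>E. hess F y (fst e) (fst e))"
    proof -
      have "(y, F y) \<notin> E" using orth[of "(y, F y)"] normp by (metis dot_square_norm one_power2 zero_neq_one)
      then show ?thesis
        using orthonormal_basis_finite(1)[OF E] hess_radial[OF y0] by simp
    qed
    also have "\<dots> = 0"
      using trace_hess_link[OF x] H[OF mem] E unfolding y_def by blast
    finally have "mean_curvature UNIV cone_graph q = orth_proj (graph_normal y') 0"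
      using E'(2) y'(2) by (simp add: zero_prod_def)
    also have "\<dots> = 0" by (rule orth_proj_eq_0[OF subspace_graph_normal]) simp
    finally show ?thesis .
  qed
  moreover have "cone (LO_cone G \<theta>)"
    unfolding cone_def LO_cone_def
  proof (intro ballI allI impI)
    fix q c assume "q \<in> {t *\<^sub>R y |t y. 0 \<le> t \<and> y \<in> LO_link G \<theta>}" "(0::real) \<le> c"
    then obtain t y where "q = t *\<^sub>R y" "0 \<le> t" "y \<in> LO_link G \<theta>" by auto
    then show "c *\<^sub>R q \<in> {t *\<^sub>R y |t y. 0 \<le> t \<and> y \<in> LO_link G \<theta>}"
      using \<open>0 \<le> c\<close> by (intro CollectI exI[of _ "c * t"] exI[of _ y]) simp
  qed
  ultimately show ?thesis
    unfolding minimal_cone_def minimal_submanifold_def cone_minus_0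
    using submanifold_graph by simp
qed

end

section \<open>Adapted frames and the angle\<close>

context harmonic_sphere_map
begin

text \<open>\<open>D\<close> is a derivative within the sphere and matches \<open>DG x\<close> on
  tangent vectors only. The singular value is found by computing the trace in this frame:
  \<open>E0\<close> and the radial vector contribute \<open>0\<close> and \<open>E1\<close>
  contributes \<open>p * \<sigma>\<^sup>2\<close>, to be compared with
  \<open>trace_DG\<close>.\<close>

lemma adapted_frame:
  assumes x: "norm x = 1" and D: "linear D" "\<And>v. v \<bullet> x = 0 \<Longrightarrow> D v = DG x v"
    and sv: "singular_values D {v. v \<bullet> x = 0} = {0, \<sigma>}" and \<sigma>: "\<sigma> > 0"
    and p: "dim (singular_space D {v. v \<bullet> x = 0} \<sigma>) = p" "p > 0"
  obtains E0 E1 where "orthonormal_basis {v. v \<bullet> x = 0} (E0 \<union> E1)" "E0 \<inter> E1 = {}"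
    "card E0 + p + 1 = CARD('a)" "card E1 = p" "\<And>e. e \<in> E0 \<Longrightarrow> DG x e = 0"
    "\<And>e w. e \<in> E1 \<Longrightarrow> DG x e \<bullet> DG x w = real k * (real k + real CARD('a) - 2) / real p * (e \<bullet> w)"
proof -
  let ?T = "{v. v \<bullet> x = 0}"
  have x0: "x \<noteq> 0" using x by auto
  obtain E0 E1 where E: "orthonormal_basis (singular_space D ?T 0) E0"
    "orthonormal_basis (singular_space D ?T \<sigma>) E1" "orthonormal_basis ?T (E0 \<union> E1)" "E0 \<inter> E1 = {}"
    using two_singular_values_frame[OF D(1) subspace_orthogonal_to_vector _ \<sigma>] sv by blast
  have E1: "card E1 = p" using orthonormal_basis_card[OF E(2)] p by simp
  note ins = orthonormal_basis_insert[OF E(3) x]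
  have fin: "finite E0" "finite E1" using orthonormal_basis_finite E by blast+
  have "card (insert x (E0 \<union> E1)) = CARD('a)" using orthonormal_basis_card[OF ins(1)] by simp
  then have card: "card E0 + p + 1 = CARD('a)"
    using ins(2) fin E1 E(4) by (simp add: card_Un_disjoint)
  have e0: "DG x e = 0" if "e \<in> E0" for e
  proof -
    have "e \<in> singular_space D ?T 0" using orthonormal_basis_subset[OF E(1) that] .
    then have "e \<in> ?T" "D e \<bullet> D e = 0" unfolding singular_space_def by auto
    then show ?thesis using D(2) by simp
  qed
  have e1: "DG x e \<bullet> DG x w = \<sigma>\<^sup>2 * (e \<bullet> w)" if "e \<in> E1" for e w
  proof -
    have e: "e \<in> ?T" "\<And>w. w \<in> ?T \<Longrightarrow> D e \<bullet> D w = \<sigma>\<^sup>2 * (e \<bullet> w)"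
      using orthonormal_basis_subset[OF E(2) that] unfolding singular_space_def by auto
    \<comment> \<open>Neither \<open>DG x\<close> nor the inner product with \<open>e\<close> sees
      the radial part of \<open>w\<close>, so the identity extends from tangent vectors to all
      \<open>w\<close>.\<close>
    let ?w = "w - (w \<bullet> x) *\<^sub>R x"
    have w: "?w \<in> ?T" using x by (simp add: inner_diff_left dot_square_norm)
    have "DG x ?w = DG x w"
      using DG_linear[OF x0] by (simp add: linear_diff linear_cmul DG_radial[OF x0])
    moreover have "e \<bullet> ?w = e \<bullet> w" using e(1) by (simp add: inner_diff_right)
    ultimately show ?thesis using e(2)[OF w] D(2) e(1) w by simp
  qed
  have "(\<Sum>e\<in>insert x (E0 \<union> E1). DG x e \<bullet> DG x e) = (\<Sum>e\<in>E1. DG x e \<bullet> DG x e)"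
    using ins(2) fin E(4) e0 by (simp add: sum.union_disjoint DG_radial[OF x0])
  also have "\<dots> = (\<Sum>e\<in>E1. \<sigma>\<^sup>2)"
    using orthonormal_basis_inner[OF E(2)] e1 by (intro sum.cong) auto
  also have "\<dots> = p * \<sigma>\<^sup>2" using E1 by simp
  finally have "\<sigma>\<^sup>2 = real k * (real k + real CARD('a) - 2) / real p"
    using trace_DG[OF x ins(1)] p(2) by (simp add: field_simps)
  then show ?thesis using that E card E1 e0 e1 by simp
qed

end

text \<open>Here \<open>n = 2 * m + 1\<close>, \<open>p = 2 * m\<close>, and \<open>l\<close> is the square of the nonzero singular value.\<close>

locale LO_minimal_type_II = LO_map P k \<theta>
  for P :: "'b::finite \<Rightarrow> real^'a \<Rightarrow> real" and k :: nat and \<theta> :: real +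
  fixes m :: nat and l \<kappa> :: real
  assumes m: "m > 0" and card_a: "CARD('a) = 2 * m + 2"
    and l_def: "l = real k * (real k + 2 * real m) / (2 * real m)"
    and \<kappa>_def: "\<kappa> = (2 * real m + 1) * (1 - (2 * real m + 1) / (real m * l))"
    and \<kappa>: "\<kappa> > (real m)\<^sup>2"
    and frame: "\<And>x. norm x = 1 \<Longrightarrow> \<exists>E0 E1. orthonormal_basis {v. v \<bullet> x = 0} (E0 \<union> E1) \<and> E0 \<inter> E1 = {} \<and>
      card E0 = 1 \<and> card E1 = 2 * m \<and> (\<forall>e\<in>E0. DG x e = 0) \<and>
      (\<forall>e\<in>E1. \<forall>w. DG x e \<bullet> DG x w = l * (e \<bullet> w))"
    and minimal: "\<And>q. q \<in> LO_link G \<theta> \<Longrightarrow> mean_curvature (sphere 0 1) (LO_link G \<theta>) q = 0"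
begin

lemma l_pos: "l > 0"
  using m k_pos by (simp add: l_def add_pos_pos)

text \<open>This is \<open>tan\<^sup>2 \<theta> = (p - n / l) / (n - p)\<close> with
  \<open>n - p = 1\<close>. The trace of the Hessian over the link is tested against
  \<open>G y\<close>: by \<open>G_inner_hess\<close> a vector of \<open>E0\<close> contributes
  \<open>1\<close> and a vector of \<open>E1\<close> contributes \<open>(1 - l) / ?d\<close>, up to
  the common factor \<open>tan \<theta> / cos \<theta>\<close>.\<close>

lemma angle: "1 + (tan \<theta>)\<^sup>2 * l = 2 * real m * (l - 1)"
proof -
  define x :: "real^'a" where "x = axis undefined 1"
  have x: "norm x = 1" by (simp add: x_def)
  then have x0: "x \<noteq> 0" by auto
  define y where "y = cos \<theta> *\<^sub>R x"
  have y0: "y \<noteq> 0" using x cos_pos by (auto simp: y_def)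
  have ny: "norm y = cos \<theta>" using x cos_pos by (simp add: y_def)
  obtain E0 E1 where E: "orthonormal_basis {v. v \<bullet> x = 0} (E0 \<union> E1)" "E0 \<inter> E1 = {}"
    "card E0 = 1" "card E1 = 2 * m" "\<And>e. e \<in> E0 \<Longrightarrow> DG x e = 0"
    "\<And>e w. e \<in> E1 \<Longrightarrow> DG x e \<bullet> DG x w = l * (e \<bullet> w)"
    using frame[OF x] by metis
  have orth: "e \<bullet> x = 0" if "e \<in> E0 \<union> E1" for e
    using orthonormal_basis_subset[OF E(1) that] by simp
  have fin: "finite E0" "finite E1" using orthonormal_basis_finite(1)[OF E(1)] by auto
  have DFe: "DF y v = tan \<theta> *\<^sub>R DG x v" if "v \<bullet> x = 0" for v
    using that x x0 cos_pos by (simp add: DF_eq[OF y0, unfolded y_def] y_def DG_scale inner_commute)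
  let ?d = "1 + (tan \<theta>)\<^sup>2 * l"
  have d: "?d > 0" using l_pos by (simp add: add_pos_nonneg)
  \<comment> \<open>The lift \<open>(e, DF y e)\<close> has length \<open>1\<close> on the kernel
    directions \<open>E0\<close> and \<open>sqrt ?d\<close> on \<open>E1\<close>; \<open>sc\<close>
    normalizes it.\<close>
  define sc where "sc = (\<lambda>e. if e \<in> E0 then 1 else 1 / sqrt ?d)"
  define h where "h = (\<lambda>e. sc e *\<^sub>R (e, DF y e))"
  have sc: "sc e > 0" for e using d by (simp add: sc_def)
  have hh: "h e \<bullet> h e' = (if e = e' then 1 else 0)" if e: "e \<in> E0 \<union> E1" "e' \<in> E0 \<union> E1" for e e'
  proof -
    have hE: "h e \<bullet> h e' = sc e * sc e' * (e \<bullet> e' + (tan \<theta>)\<^sup>2 * (DG x e \<bullet> DG x e'))"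
      using DFe orth e by (simp add: h_def power2_eq_square algebra_simps)
    have ee: "e \<bullet> e' = (if e = e' then 1 else 0)" using orthonormal_basis_inner[OF E(1) e] .
    consider "e \<in> E0" | "e' \<in> E0" | "e \<in> E1" "e' \<in> E1" using e by blast
    then show ?thesis
    proof cases
      case 1
      then show ?thesis using hE ee E(5) by (auto simp: sc_def)
    next
      case 2
      then show ?thesis using hE ee E(5) by (auto simp: sc_def)
    next
      case 3
      then have "e \<notin> E0" "e' \<notin> E0" using E(2) by auto
      then show ?thesis using hE ee E(6)[OF 3(1)] d by (auto simp: sc_def)
    qed
  qed
  have hinj: "inj_on h (E0 \<union> E1)"
    using hh by (intro inj_onI) (metis zero_neq_one)
  have "orthonormal_basis (tangent_space (LO_link G \<theta>) (y, F y)) (h ` (E0 \<union> E1))"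
  proof -
    have "span (h ` (E0 \<union> E1)) = (\<lambda>v. (v, DF y v)) ` {v. v \<bullet> x = 0}"
    proof (rule span_subspace)
      show sub: "subspace ((\<lambda>v. (v, DF y v)) ` {v. v \<bullet> x = 0})"
        by (rule linear_subspace_image[OF linear_graph_tangent[OF y0] subspace_orthogonal_to_vector])
      show "h ` (E0 \<union> E1) \<subseteq> (\<lambda>v. (v, DF y v)) ` {v. v \<bullet> x = 0}"
        unfolding h_def using orth by (auto intro!: subspace_scale[OF sub] simp del: scaleR_Pair)
      have "span (E0 \<union> E1) = {v. v \<bullet> x = 0}" using E(1) by (simp add: orthonormal_basis_def)
      then have "(\<lambda>v. (v, DF y v)) ` {v. v \<bullet> x = 0} = span ((\<lambda>v. (v, DF y v)) ` (E0 \<union> E1))"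
        using linear_span_image[OF linear_graph_tangent[OF y0]] by metis
      also have "\<dots> \<subseteq> span (h ` (E0 \<union> E1))"
      proof (rule span_minimal)
        have "(e, DF y e) \<in> span (h ` (E0 \<union> E1))" if "e \<in> E0 \<union> E1" for e
        proof -
          have "(1 / sc e) *\<^sub>R h e \<in> span (h ` (E0 \<union> E1))"
            using that by (intro span_scale span_base) blast
          then show ?thesis using sc[of e] by (simp add: h_def)
        qed
        then show "(\<lambda>v. (v, DF y v)) ` (E0 \<union> E1) \<subseteq> span (h ` (E0 \<union> E1))" by blast
      qed simp
      finally show "(\<lambda>v. (v, DF y v)) ` {v. v \<bullet> x = 0} \<subseteq> span (h ` (E0 \<union> E1))" .
    qed
    moreover have "norm (h e) = 1" if "e \<in> E0 \<union> E1" for e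
      using hh[OF that that] by (simp add: norm_eq_sqrt_inner)
    moreover have "pairwise orthogonal (h ` (E0 \<union> E1))"
      unfolding pairwise_def orthogonal_def
    proof (intro ballI impI)
      fix a b assume "a \<in> h ` (E0 \<union> E1)" "b \<in> h ` (E0 \<union> E1)" "a \<noteq> b"
      then obtain e e' where "e \<in> E0 \<union> E1" "e' \<in> E0 \<union> E1" "a = h e" "b = h e'" by blast
      with \<open>a \<noteq> b\<close> show "a \<bullet> b = 0" using hh[of e e'] by (cases "e = e'") auto
    qed
    ultimately show ?thesis
      unfolding orthonormal_basis_def tangent_space_link[OF x, folded y_def] by blast
  qed
  moreover have "(y, F y) \<in> LO_link G \<theta>"
    using x link_point[OF x] unfolding LO_link_G y_def by auto
  ultimately have "(\<Sum>e\<in>h ` (E0 \<union> E1). hess F y (fst e) (fst e)) = 0"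
    using trace_hess_link[OF x, folded y_def] minimal by blast
  then have "(\<Sum>e\<in>E0 \<union> E1. hess F y (sc e *\<^sub>R e) (sc e *\<^sub>R e)) = 0"
    unfolding sum.reindex[OF hinj] by (simp add: h_def o_def)
  then have "0 = G y \<bullet> (\<Sum>e\<in>E0 \<union> E1. (sc e)\<^sup>2 *\<^sub>R hess F y e e)"
    using hess_bilinear[of y] y0 by (simp add: bilinear_lmul bilinear_rmul power2_eq_square)
  also have "\<dots> = (\<Sum>e\<in>E0 \<union> E1. (sc e)\<^sup>2 * (G y \<bullet> hess F y e e))"
    by (simp add: inner_sum_right)
  also have "\<dots> = (\<Sum>e\<in>E0 \<union> E1. (sc e)\<^sup>2 * (tan \<theta> / cos \<theta> * (1 - DG x e \<bullet> DG x e)))"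
  proof (intro sum.cong refl)
    fix e assume e: "e \<in> E0 \<union> E1"
    have "y \<bullet> e = 0" using orth[OF e] by (simp add: y_def inner_commute)
    moreover have "DG y e = (1 / cos \<theta>) *\<^sub>R DG x e"
      using DG_scale[OF x0 cos_pos] by (simp add: y_def)
    moreover have "e \<bullet> e = 1" using orthonormal_basis_inner[OF E(1) e e] by simp
    ultimately show "(sc e)\<^sup>2 * (G y \<bullet> hess F y e e) = (sc e)\<^sup>2 * (tan \<theta> / cos \<theta> * (1 - DG x e \<bullet> DG x e))"
      using cos_pos by (simp add: G_inner_hess[OF y0] ny field_simps)
  qed
  also have "\<dots> = (\<Sum>e\<in>E0. tan \<theta> / cos \<theta>) + (\<Sum>e\<in>E1. 1 / ?d * (tan \<theta> / cos \<theta> * (1 - l)))"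
    unfolding sum.union_disjoint[OF fin E(2)]
  proof (intro arg_cong2[where f = "(+)"] sum.cong refl)
    show "(sc e)\<^sup>2 * (tan \<theta> / cos \<theta> * (1 - DG x e \<bullet> DG x e)) = tan \<theta> / cos \<theta>" if "e \<in> E0" for e
      using that E(5) by (simp add: sc_def)
    show "(sc e)\<^sup>2 * (tan \<theta> / cos \<theta> * (1 - DG x e \<bullet> DG x e)) = 1 / ?d * (tan \<theta> / cos \<theta> * (1 - l))"
      if e: "e \<in> E1" for e
    proof -
      have "e \<notin> E0" using e E(2) by auto
      moreover have "e \<bullet> e = 1" using orthonormal_basis_inner[OF E(1)] e by auto
      ultimately show ?thesis using E(6)[OF e, of e] d by (simp add: sc_def power_divide)
    qed
  qed
  also have "\<dots> = tan \<theta> / cos \<theta> * (1 + 2 * real m * (1 - l) / ?d)"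
    using E(3,4) by (simp add: algebra_simps add_divide_distrib diff_divide_distrib)
  finally have "1 + 2 * real m * (1 - l) / ?d = 0"
    using tan_pos cos_pos by simp
  then show ?thesis using d by (simp add: field_simps)
qed

section \<open>The profile of the volume density\<close>

text \<open>\<open>w z\<close> is the conformal weight \<open>a * (a\<^sup>2 + l * b\<^sup>2) ^ m\<close> at the point
  \<open>(a, b) = (cos \<theta>, sin \<theta>) + z * (- sin \<theta>, cos \<theta>)\<close>.\<close>

definition A :: "real \<Rightarrow> real" where "A z = cos \<theta> - z * sin \<theta>"
definition B :: "real \<Rightarrow> real" where "B z = (A z)\<^sup>2 + l * (sin \<theta> + z * cos \<theta>)\<^sup>2"
definition B1 :: "real \<Rightarrow> real" where
  "B1 z = - 2 * sin \<theta> * A z + 2 * l * cos \<theta> * (sin \<theta> + z * cos \<theta>)"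
definition B2 :: real where "B2 = 2 * (sin \<theta>)\<^sup>2 + 2 * l * (cos \<theta>)\<^sup>2"
definition w :: "real \<Rightarrow> real" where "w z = A z * B z ^ m"
definition w1 :: "real \<Rightarrow> real" where
  "w1 z = - sin \<theta> * B z ^ m + A z * (m * B z ^ (m - 1) * B1 z)"
definition w2 :: "real \<Rightarrow> real" where
  "w2 z = - 2 * sin \<theta> * (m * B z ^ (m - 1) * B1 z) +
     A z * (m * (real (m - 1) * B z ^ (m - 1 - 1) * (B1 z)\<^sup>2 + B z ^ (m - 1) * B2))"

lemma A_deriv: "(A has_field_derivative - sin \<theta>) (at z)"
  unfolding A_def[abs_def] by (auto intro!: derivative_eq_intros)

lemma B_deriv: "(B has_field_derivative B1 z) (at z)"
  unfolding B_def[abs_def]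
  by (auto intro!: derivative_eq_intros A_deriv simp: B1_def algebra_simps)

lemma B1_deriv: "(B1 has_field_derivative B2) (at z)"
  unfolding B1_def[abs_def]
  by (auto intro!: derivative_eq_intros A_deriv simp: B2_def power2_eq_square algebra_simps)

lemma B_power_deriv: "((\<lambda>z. B z ^ j) has_field_derivative real j * B z ^ (j - 1) * B1 z) (at z)"
  by (auto intro!: derivative_eq_intros B_deriv simp: algebra_simps)

lemma w_deriv: "(w has_field_derivative w1 z) (at z)"
  unfolding w_def[abs_def]
  by (rule DERIV_cong[OF DERIV_mult[OF A_deriv B_power_deriv]]) (simp add: w1_def algebra_simps)

lemma w1_deriv: "(w1 has_field_derivative w2 z) (at z)"
  unfolding w1_def[abs_def]
  by (rule DERIV_cong[OF DERIV_add[OF DERIV_cmult[OF B_power_deriv]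
      DERIV_mult[OF A_deriv DERIV_mult[OF DERIV_cmult[OF B_power_deriv] B1_deriv]]]])
     (simp add: w2_def power2_eq_square algebra_simps)

lemma continuous_on_w2: "continuous_on S w2"
proof -
  have "continuous_on S A" "continuous_on S B" "continuous_on S B1"
    using A_deriv B_deriv B1_deriv by (auto intro!: continuous_at_imp_continuous_on DERIV_isCont)
  then show ?thesis unfolding w2_def[abs_def] by (intro continuous_intros)
qed

lemma B_pos: "B 0 > 0"
  using cos_pos l_pos by (simp add: B_def A_def add_pos_nonneg)

lemma w_pos: "w 0 > 0"
  using B_pos cos_pos by (simp add: w_def A_def)

text \<open>Here \<open>\<kappa>\<close> arises. After division by \<open>B 0 ^ m\<close> only
  \<open>t = tan \<theta>\<close>, \<open>l\<close> and \<open>m\<close> remain, and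
  \<open>angle\<close> expresses \<open>t\<^sup>2\<close> through \<open>l\<close> and
  \<open>m\<close>.\<close>

lemma w2_0: "w2 0 = - \<kappa> * w 0"
proof -
  define c s where "c = cos \<theta>" and "s = sin \<theta>"
  define t where "t = tan \<theta>"
  have c: "c > 0" and s: "s = t * c" using cos_pos by (auto simp: c_def s_def t_def tan_def)
  have mm: "real m > 0" using m by simp
  have an: "1 + t\<^sup>2 * l = 2 * real m * (l - 1)" using angle by (simp add: t_def)
  have l1: "l > 1"
  proof (rule ccontr)
    assume "\<not> l > 1"
    then have "2 * real m * (l - 1) \<le> 0" using mm by (simp add: mult_nonneg_nonpos)
    moreover have "1 + t\<^sup>2 * l > 0" using l_pos by (simp add: add_pos_nonneg)
    ultimately show False using an by simp
  qed
  have t2: "t\<^sup>2 = (2 * real m * (l - 1) - 1) / l" using an l_pos by (simp add: field_simps)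
  have B0: "B 0 = c\<^sup>2 * (2 * real m * (l - 1))"
    unfolding an[symmetric]
    by (simp add: B_def A_def c_def[symmetric] s_def[symmetric] s power_mult_distrib algebra_simps)
  \<comment> \<open>This is equivalent to \<open>w1 0 = 0\<close>: the weight is stationary at the
    ray of angle \<open>\<theta>\<close>, as minimality demands.\<close>
  have B10: "B1 0 = B 0 * (t / real m)"
    using mm by (simp add: B0 B1_def A_def c_def[symmetric] s_def[symmetric] s power2_eq_square field_simps)
  have B2': "B2 = 2 * c\<^sup>2 * (t\<^sup>2 + l)"
    by (simp add: B2_def c_def[symmetric] s_def[symmetric] s power_mult_distrib algebra_simps)
  have p1: "B 0 ^ (m - 1) = B 0 ^ m / B 0"
    using m B_pos by (cases m) auto
  \<comment> \<open>For \<open>m = 1\<close> the natural exponent is truncated, but the factor in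
    front of it vanishes.\<close>
  have p2: "real (m - 1) * B 0 ^ (m - 1 - 1) = (real m - 1) * B 0 ^ m / (B 0)\<^sup>2"
  proof -
    have "m = 1 \<or> m = (m - 2) + 2" using m by linarith
    then consider "m = 1" | j where "m = j + 2" by blast
    then show ?thesis using B_pos by cases (simp_all add: power2_eq_square)
  qed
  have "w2 0 = B 0 ^ m * (- 2 * s * real m * (B1 0 / B 0) +
      c * real m * ((real m - 1) * (B1 0 / B 0)\<^sup>2 + B2 / B 0))"
  proof -
    have alg: "- 2 * s * (M * (X / b) * b1) + c * (M * ((M - 1) * X / b\<^sup>2 * b1\<^sup>2 + X / b * b2)) =
        X * (- 2 * s * M * (b1 / b) + c * M * ((M - 1) * (b1 / b)\<^sup>2 + b2 / b))"
      for X b b1 b2 M :: real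
      by (simp add: power_divide algebra_simps)
    have "A 0 = c" by (simp add: A_def c_def)
    then show ?thesis unfolding w2_def p1 p2 s_def[symmetric] by (simp only: alg)
  qed
  also have "B1 0 / B 0 = t / real m" using B10 B_pos by simp
  also have "B2 / B 0 = (t\<^sup>2 + l) / (real m * (l - 1))"
    using c mm l1 by (simp add: B0 B2' field_simps)
  also have "- 2 * s * real m * (t / real m) + c * real m * ((real m - 1) * (t / real m)\<^sup>2 + (t\<^sup>2 + l) / (real m * (l - 1)))
     = c * (- 2 * t\<^sup>2 + (real m - 1) * t\<^sup>2 / real m + (t\<^sup>2 + l) / (l - 1))"
    using mm l1 by (simp add: s power_divide power2_eq_square field_simps)
  also have "(t\<^sup>2 + l) / (l - 1) = (l + 2 * real m + 1) / l"
    using l1 unfolding t2 by (simp add: field_simps)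
  also have "- 2 * t\<^sup>2 + (real m - 1) * t\<^sup>2 / real m + (l + 2 * real m + 1) / l = - \<kappa>"
    using mm l1 unfolding t2 \<kappa>_def by (simp add: field_simps)
  finally show ?thesis by (simp add: w_def A_def c_def[symmetric])
qed

section \<open>The destabilizing variation\<close>

definition \<psi> :: "real \<Rightarrow> real \<Rightarrow> real" where "\<psi> L r = radial_profile m L r / r"

text \<open>With the factor \<open>cos \<theta>\<close>, \<open>norm u\<close> is the distance of
  \<open>param u\<close> from the apex, that is, the radius \<open>r\<close>.\<close>

definition param :: "real^'a \<Rightarrow> (real^'a) \<times> (real^'b)" where
  "param u = (cos \<theta> *\<^sub>R u, F (cos \<theta> *\<^sub>R u))"

text \<open>The unit normal obtained by turning the ray through a right angle in its plane, times
  \<open>r * \<psi> L r\<close>. As \<open>varied_volume\<close> moves points along straight lines,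
  \<open>s * \<psi> L r\<close> is the coordinate \<open>z\<close> of the weight \<open>w\<close>
  and is an angle only to first order.\<close>

definition V :: "real \<Rightarrow> (real^'a) \<times> (real^'b) \<Rightarrow> (real^'a) \<times> (real^'b)" where
  "V L q = \<psi> L (norm (fst q) / cos \<theta>) *\<^sub>R (- tan \<theta> *\<^sub>R fst q, norm (fst q) *\<^sub>R G (fst q))"

lemma V_param: "V L (param u) = \<psi> L (norm u) *\<^sub>R (- sin \<theta> *\<^sub>R u, (cos \<theta> * norm u) *\<^sub>R G u)"
  using cos_pos by (simp add: V_def param_def G_scale tan_def)

lemma param_eq: "param u = (cos \<theta> *\<^sub>R u, (sin \<theta> * norm u) *\<^sub>R G u)"
  using cos_pos by (simp add: param_def F_def G_scale tan_def)

lemma varied_param: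
  "param u + s *\<^sub>R V L (param u) =
    ((cos \<theta> - s * sin \<theta> * \<psi> L (norm u)) *\<^sub>R u,
     ((sin \<theta> + s * cos \<theta> * \<psi> L (norm u)) * norm u) *\<^sub>R G u)"
  unfolding V_param unfolding param_eq by (simp add: algebra_simps)

lemma \<psi>_deriv:
  assumes "r > 0" "L > 0"
  shows "(\<psi> L has_field_derivative (radial_profile_deriv m L r - \<psi> L r) / r) (at r)"
  unfolding \<psi>_def[abs_def]
  by (rule DERIV_cong[OF DERIV_divide[OF radial_profile_deriv[OF assms] DERIV_ident]])
     (use assms in \<open>auto simp: field_simps\<close>)

text \<open>The differential keeps the frame formed by the radial vector, \<open>E0\<close> and
  \<open>E1\<close> orthogonal. The squared lengths are \<open>1 + s\<^sup>2 * g'\<^sup>2\<close>,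
  \<open>\<alpha>\<^sup>2\<close> and, \<open>2 * m\<close> times,
  \<open>\<alpha>\<^sup>2 + l * \<beta>\<^sup>2\<close>. Their product is a perfect square up to the
  first factor, and \<open>pos\<close> removes the absolute value from its root.\<close>

lemma volume_density_varied:
  assumes u: "u \<noteq> 0" and L: "L > 0" and pos: "cos \<theta> - s * sin \<theta> * \<psi> L (norm u) \<ge> 0"
  shows "volume_density (\<lambda>u. param u + s *\<^sub>R V L (param u)) u =
    sqrt (1 + s\<^sup>2 * (radial_profile_deriv m L (norm u))\<^sup>2) * w (s * \<psi> L (norm u))"
proof -
  define r where "r = norm u"
  define x where "x = (1 / r) *\<^sub>R u"
  have r: "r > 0" using u by (simp add: r_def)
  have x: "norm x = 1" and ux: "u = r *\<^sub>R x" using r by (simp_all add: x_def r_def)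
  have x0: "x \<noteq> 0" using x by auto
  define g' where "g' = radial_profile_deriv m L r"
  define \<alpha> where "\<alpha> = cos \<theta> - s * sin \<theta> * \<psi> L r"
  define \<beta> where "\<beta> = sin \<theta> + s * cos \<theta> * \<psi> L r"
  \<comment> \<open>By \<open>\<psi>_deriv\<close>, \<open>r\<close> times the derivative of
    \<open>\<psi> L\<close> is \<open>g' - \<psi> L r\<close>; so in the radial direction
    \<open>\<psi>\<close> cancels and only \<open>g'\<close> is left.\<close>
  define D where "D = (\<lambda>v. (\<alpha> *\<^sub>R v + (- s * sin \<theta> * ((g' - \<psi> L r) * (x \<bullet> v))) *\<^sub>R x,
    ((sin \<theta> + s * cos \<theta> * g') * (x \<bullet> v)) *\<^sub>R G x + \<beta> *\<^sub>R DG x v))"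
  have n: "(norm has_derivative (\<lambda>v. x \<bullet> v)) (at u)"
    using has_derivative_norm[OF u] by (simp add: sgn_div_norm inner_commute x_def r_def divide_inverse mult.commute)
  have "(\<psi> L has_derivative (\<lambda>h. h * ((g' - \<psi> L r) / r))) (at (norm u))"
    using \<psi>_deriv[OF r L] unfolding has_field_derivative_def r_def[symmetric] g'_def
    by (rule has_derivative_eq_rhs) (simp add: fun_eq_iff)
  from has_derivative_compose[OF n this]
  have dps: "((\<lambda>u. \<psi> L (norm u)) has_derivative (\<lambda>v. (x \<bullet> v) * ((g' - \<psi> L r) / r))) (at u)" .
  have Gu: "G u = G x" "\<And>v. DG u v = (1 / r) *\<^sub>R DG x v"
    using r x0 by (simp_all add: ux G_scale DG_scale)
  have "((\<lambda>u. param u + s *\<^sub>R V L (param u)) has_derivative D) (at u)"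
    unfolding varied_param D_def
  proof (rule has_derivative_Pair)
    show "((\<lambda>u. (cos \<theta> - s * sin \<theta> * \<psi> L (norm u)) *\<^sub>R u) has_derivative
        (\<lambda>v. \<alpha> *\<^sub>R v + (- s * sin \<theta> * ((g' - \<psi> L r) * (x \<bullet> v))) *\<^sub>R x)) (at u)"
    proof (rule has_derivative_eq_rhs)
      show "((\<lambda>u. (cos \<theta> - s * sin \<theta> * \<psi> L (norm u)) *\<^sub>R u) has_derivative
        (\<lambda>v. (cos \<theta> - s * sin \<theta> * \<psi> L (norm u)) *\<^sub>R v +
          (0 - s * sin \<theta> * ((x \<bullet> v) * ((g' - \<psi> L r) / r))) *\<^sub>R u)) (at u)"
        by (rule has_derivative_scaleR[OF has_derivative_diff[OF has_derivative_const
              has_derivative_mult_right[OF dps]] has_derivative_ident])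
      have "(s * sin \<theta> * ((x \<bullet> v) * ((g' - \<psi> L r) / r))) *\<^sub>R (r *\<^sub>R x)
          = (s * sin \<theta> * ((g' - \<psi> L r) * (x \<bullet> v))) *\<^sub>R x" for v
        using r by simp
      then show "(\<lambda>v. (cos \<theta> - s * sin \<theta> * \<psi> L (norm u)) *\<^sub>R v +
          (0 - s * sin \<theta> * ((x \<bullet> v) * ((g' - \<psi> L r) / r))) *\<^sub>R u) =
        (\<lambda>v. \<alpha> *\<^sub>R v + (- s * sin \<theta> * ((g' - \<psi> L r) * (x \<bullet> v))) *\<^sub>R x)"
        unfolding r_def[symmetric] \<alpha>_def[symmetric] using ux by (simp add: fun_eq_iff)
    qed
    show "((\<lambda>u. ((sin \<theta> + s * cos \<theta> * \<psi> L (norm u)) * norm u) *\<^sub>R G u) has_derivative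
        (\<lambda>v. ((sin \<theta> + s * cos \<theta> * g') * (x \<bullet> v)) *\<^sub>R G x + \<beta> *\<^sub>R DG x v)) (at u)"
    proof (rule has_derivative_eq_rhs)
      show "((\<lambda>u. ((sin \<theta> + s * cos \<theta> * \<psi> L (norm u)) * norm u) *\<^sub>R G u) has_derivative
        (\<lambda>v. ((sin \<theta> + s * cos \<theta> * \<psi> L (norm u)) * norm u) *\<^sub>R DG u v +
          ((sin \<theta> + s * cos \<theta> * \<psi> L (norm u)) * (x \<bullet> v) +
            (0 + s * cos \<theta> * ((x \<bullet> v) * ((g' - \<psi> L r) / r))) * norm u) *\<^sub>R G u)) (at u)"
        by (rule has_derivative_scaleR[OF has_derivative_mult[OF has_derivative_add[OF
              has_derivative_const has_derivative_mult_right[OF dps]] n] G_deriv[OF u]])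
      have "\<beta> * (x \<bullet> v) + (0 + s * cos \<theta> * ((x \<bullet> v) * ((g' - \<psi> L r) / r))) * r =
          (sin \<theta> + s * cos \<theta> * g') * (x \<bullet> v)" for v
        using r by (simp add: \<beta>_def field_simps)
      then show "(\<lambda>v. ((sin \<theta> + s * cos \<theta> * \<psi> L (norm u)) * norm u) *\<^sub>R DG u v +
          ((sin \<theta> + s * cos \<theta> * \<psi> L (norm u)) * (x \<bullet> v) +
            (0 + s * cos \<theta> * ((x \<bullet> v) * ((g' - \<psi> L r) / r))) * norm u) *\<^sub>R G u) =
        (\<lambda>v. ((sin \<theta> + s * cos \<theta> * g') * (x \<bullet> v)) *\<^sub>R G x + \<beta> *\<^sub>R DG x v)"
        unfolding r_def[symmetric] \<beta>_def[symmetric] Gu using r by (simp add: fun_eq_iff)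
    qed
  qed
  then have fd: "frechet_derivative (\<lambda>u. param u + s *\<^sub>R V L (param u)) (at u) = D" and lin: "linear D"
    by (simp_all flip: frechet_derivative_at add: has_derivative_linear)
  obtain E0 E1 where E: "orthonormal_basis {v. v \<bullet> x = 0} (E0 \<union> E1)" "E0 \<inter> E1 = {}"
    "card E0 = 1" "card E1 = 2 * m" "\<And>e. e \<in> E0 \<Longrightarrow> DG x e = 0"
    "\<And>e w. e \<in> E1 \<Longrightarrow> DG x e \<bullet> DG x w = l * (e \<bullet> w)"
    using frame[OF x] by metis
  note ins = orthonormal_basis_insert[OF E(1) x]
  have fin: "finite E0" "finite E1" using orthonormal_basis_finite(1)[OF E(1)] by auto
  have orth: "x \<bullet> e = 0" if "e \<in> E0 \<union> E1" for e
    using orthonormal_basis_subset[OF E(1) that] by (simp add: inner_commute)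
  have De: "D e = (\<alpha> *\<^sub>R e, \<beta> *\<^sub>R DG x e)" if "e \<in> E0 \<union> E1" for e
    using orth[OF that] by (simp add: D_def)
  have xx: "x \<bullet> x = 1" using x by (simp add: dot_square_norm)
  have Dx: "D x = ((cos \<theta> - s * sin \<theta> * g') *\<^sub>R x, (sin \<theta> + s * cos \<theta> * g') *\<^sub>R G x)"
    by (simp add: D_def xx DG_radial[OF x0] \<alpha>_def algebra_simps)
  have GG: "G x \<bullet> G x = 1" using norm_G[OF x0] by (simp add: dot_square_norm)
  have Dxx: "D x \<bullet> D x = 1 + s\<^sup>2 * g'\<^sup>2"
  proof -
    \<comment> \<open>The two coefficients are those of the vector \<open>(1, s * g')\<close>
      rotated by \<open>\<theta>\<close>.\<close>
    have "D x \<bullet> D x = (cos \<theta> - s * sin \<theta> * g')\<^sup>2 + (sin \<theta> + s * cos \<theta> * g')\<^sup>2"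
      by (simp add: Dx xx GG power2_eq_square)
    also have "\<dots> = ((sin \<theta>)\<^sup>2 + (cos \<theta>)\<^sup>2) * (1 + s\<^sup>2 * g'\<^sup>2)"
      by algebra
    finally show ?thesis by simp
  qed
  have Dxe: "D x \<bullet> D e = 0" if "e \<in> E0 \<union> E1" for e
    using orth[OF that] by (simp add: Dx De[OF that] G_inner_DG[OF x0])
  have Dee: "D e \<bullet> D e' = \<alpha>\<^sup>2 * (e \<bullet> e') + \<beta>\<^sup>2 * (DG x e \<bullet> DG x e')"
    if "e \<in> E0 \<union> E1" "e' \<in> E0 \<union> E1" for e e'
    by (simp add: De[OF that(1)] De[OF that(2)] power2_eq_square)
  have De0: "D e \<bullet> D e = \<alpha>\<^sup>2" if "e \<in> E0" for e
    using that orthonormal_basis_inner[OF E(1), of e e] by (simp add: Dee E(5))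
  have De1: "D e \<bullet> D e = \<alpha>\<^sup>2 + l * \<beta>\<^sup>2" if "e \<in> E1" for e
    using that orthonormal_basis_inner[OF E(1), of e e] by (simp add: Dee E(6))
  have off: "D e \<bullet> D e' = 0" if "e \<in> insert x (E0 \<union> E1)" "e' \<in> insert x (E0 \<union> E1)" "e \<noteq> e'" for e e'
  proof -
    have "D e \<bullet> D e' = 0" if ee: "e \<in> E0 \<union> E1" "e' \<in> E0 \<union> E1" "e \<noteq> e'" for e e'
    proof -
      have "e \<bullet> e' = 0" using orthonormal_basis_inner[OF E(1) ee(1,2)] ee(3) by simp
      moreover have "DG x e \<bullet> DG x e' = 0"
        using ee(1) calculation E(5)[of e] E(6)[of e e'] by auto
      ultimately show ?thesis by (simp add: Dee[OF ee(1,2)])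
    qed
    then show ?thesis using that Dxe by (auto simp: inner_commute)
  qed
  have "det (\<chi> i j. D (axis i 1) \<bullet> D (axis j 1)) = (\<Prod>e\<in>insert x (E0 \<union> E1). D e \<bullet> D e)"
    by (rule det_Gram_orthonormal_basis[OF lin ins(1) off])
  also have "\<dots> = (1 + s\<^sup>2 * g'\<^sup>2) * ((\<Prod>e\<in>E0. \<alpha>\<^sup>2) * (\<Prod>e\<in>E1. \<alpha>\<^sup>2 + l * \<beta>\<^sup>2))"
    using fin ins(2) E(2) by (simp add: prod.union_disjoint Dxx De0 De1)
  also have "\<dots> = (1 + s\<^sup>2 * g'\<^sup>2) * (\<alpha> * (\<alpha>\<^sup>2 + l * \<beta>\<^sup>2) ^ m)\<^sup>2"
    using E(3,4) by (simp add: power_mult_distrib power_mult[symmetric] mult.commute)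
  finally have "volume_density (\<lambda>u. param u + s *\<^sub>R V L (param u)) u
      = sqrt (1 + s\<^sup>2 * g'\<^sup>2) * \<bar>\<alpha> * (\<alpha>\<^sup>2 + l * \<beta>\<^sup>2) ^ m\<bar>"
    by (simp add: volume_density_def fd real_sqrt_mult)
  also have "\<bar>\<alpha> * (\<alpha>\<^sup>2 + l * \<beta>\<^sup>2) ^ m\<bar> = \<alpha> * (\<alpha>\<^sup>2 + l * \<beta>\<^sup>2) ^ m"
  proof -
    have "\<alpha> \<ge> 0" using pos by (simp add: \<alpha>_def r_def)
    moreover have "\<alpha>\<^sup>2 + l * \<beta>\<^sup>2 \<ge> 0" using l_pos by simp
    ultimately show ?thesis by simp
  qed
  also have "\<dots> = w (s * \<psi> L r)"
    by (simp add: w_def A_def B_def \<alpha>_def \<beta>_def algebra_simps)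
  finally show ?thesis by (simp add: g'_def r_def)
qed

lemma Ck_on_\<psi>:
  "Ck_on j {0<..} (\<psi> L)"
proof (rule Ck_on_cong)
  show "Ck_on j {0<..} (\<lambda>r. bump (ln r * (1 / L)) * r powr (- real (m + 1)))"
    by (intro Ck_on_mult Ck_on_powr Ck_on_compose[OF _ open_UNIV Ck_on_bump] Ck_on_ln Ck_on_const) auto
  show "bump (ln r * (1 / L)) * r powr (- real (m + 1)) = \<psi> L r" if "r \<in> {0<..}" for r
    using that powr_realpow[of r "m + 1"] unfolding powr_minus
    by (simp add: \<psi>_def radial_profile_def field_simps)
qed simp

lemma param_image: "param ` (- {0}) = cone_graph"
proof (intro equalityI subsetI)
  fix q assume "q \<in> cone_graph"
  then obtain y where "y \<noteq> 0" "q = (y, F y)" unfolding cone_graph_def by auto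
  then show "q \<in> param ` (- {0})"
    using cos_pos by (intro image_eqI[of _ _ "(1 / cos \<theta>) *\<^sub>R y"]) (auto simp: param_def)
qed (use cos_pos in \<open>auto simp: param_def cone_graph_def\<close>)

lemma Ck_on_param: "Ck_on j (- {0}) param"
  unfolding param_def[abs_def]
  using cos_pos
  by (intro Ck_on_Pair Ck_on_compose[OF _ _ Ck_on_F] Ck_on_scaleR Ck_on_const Ck_on_id) auto

text \<open>One patch covers the whole cone without its apex. Its inverse and the injectivity of its
  differential are read off from the first component, which is multiplication by
  \<open>cos \<theta>\<close>.\<close>

lemma local_parametrization_param: "local_parametrization cone_graph param (- {0})"
  unfolding local_parametrization_def param_image
proof (intro conjI ballI)
  show "smooth_on (- {0}) param" by (rule smooth_onI[OF _ subset_refl Ck_on_param]) (simp add: open_Compl)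
  show "inj (frechet_derivative param (at u))" if "u \<in> - {0}" for u
  proof -
    have d: "(param has_derivative frechet_derivative param (at u)) (at u)"
      using that by (rule Ck_on_has_derivative[OF Ck_on_param[of "Suc 0"]])
    then have "((\<lambda>u. fst (param u)) has_derivative (\<lambda>v. fst (frechet_derivative param (at u) v))) (at u)"
      by (rule has_derivative_fst)
    moreover have "((\<lambda>u. fst (param u)) has_derivative (\<lambda>v. cos \<theta> *\<^sub>R v)) (at u)"
      by (auto simp: param_def intro!: derivative_eq_intros)
    ultimately have "(\<lambda>v. fst (frechet_derivative param (at u) v)) = (\<lambda>v. cos \<theta> *\<^sub>R v)"
      by (rule has_derivative_unique)
    then have "fst (frechet_derivative param (at u) v) = cos \<theta> *\<^sub>R v" for v by metis
    then show ?thesis using cos_pos by (intro injI) (metis less_irrefl scaleR_cancel_left)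
  qed
  have "homeomorphism (- {0}) cone_graph param (\<lambda>q. (1 / cos \<theta>) *\<^sub>R fst q)"
  proof (rule homeomorphismI)
    show "continuous_on (- {0}) param" using Ck_on_param[of 0] by simp
    show "continuous_on cone_graph (\<lambda>q. (1 / cos \<theta>) *\<^sub>R fst q)" by (intro continuous_intros)
  qed (use cos_pos param_image in \<open>auto simp: param_def cone_graph_def\<close>)
  then show "\<exists>\<psi>. homeomorphism (- {0}) cone_graph param \<psi>" by blast
  show "open (- {0} :: (real^'a) set)" by (simp add: open_Compl)
  show "openin (top_of_set cone_graph) cone_graph" by simp
qed

lemma unstable: "unstable_cone TYPE('a) (LO_cone G \<theta>)"
proof -
  obtain L where L: "L > 0" and neg: "integral {1..exp L} (\<lambda>r. r ^ (2 * m + 1) *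
      ((radial_profile_deriv m L r)\<^sup>2 - \<kappa> * (radial_profile m L r / r)\<^sup>2)) < 0"
    using Hardy_sharp[OF \<kappa>] by blast
  \<comment> \<open>The annulus on which \<open>ln (norm u) / L\<close> lies in the unit interval;
    elsewhere \<open>bump\<close> and hence the field vanish.\<close>
  define Bd where "Bd = {u::real^'a. 1 \<le> norm u \<and> norm u \<le> exp L}"
  define K where "K = param ` Bd"
  let ?P = "{(param, Bd)}"
  have Bd0: "Bd \<subseteq> - {0}" by (auto simp: Bd_def)
  have Bd: "closed Bd" "bounded Bd"
  proof -
    have "Bd = cball 0 (exp L) - ball 0 1" by (auto simp: Bd_def)
    then show "closed Bd" "bounded Bd" by (auto intro: closed_Diff bounded_subset[OF bounded_cball])
  qed
  have "compact K"
    unfolding K_def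
  proof (rule compact_continuous_image)
    show "continuous_on Bd param"
      using Ck_on_param[of 0] by (intro continuous_on_subset[OF _ Bd0]) simp
    show "compact Bd" using Bd by (simp add: compact_eq_bounded_closed)
  qed
  moreover have "K \<subseteq> cone_graph" unfolding K_def param_image[symmetric] using Bd0 by blast
  moreover have "smooth_on cone_graph (V L)"
  proof (rule smooth_onI[OF open_fst_nonzero])
    have comp: "Ck_on j {q. fst q \<noteq> 0} (\<lambda>q :: (real^'a) \<times> (real^'b). h (fst q))"
      if "Ck_on j (- {0}) h" for h :: "real^'a \<Rightarrow> 'c::real_normed_vector" and j
      by (rule Ck_on_compose[OF open_fst_nonzero _ that Ck_on_bounded_linear]) (auto intro: bounded_linear_fst)
    have "Ck_on j (- {0}) (\<lambda>y :: real^'a. \<psi> L (norm y * (1 / cos \<theta>)))" for j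
      using cos_pos
      by (intro Ck_on_compose[OF _ _ Ck_on_\<psi>] Ck_on_mult Ck_on_norm Ck_on_const) auto
    then have "Ck_on j (- {0}) (\<lambda>y :: real^'a. \<psi> L (norm y * (1 / cos \<theta>)) *\<^sub>R (- tan \<theta> *\<^sub>R y, norm y *\<^sub>R G y))" for j
      by (intro Ck_on_scaleR Ck_on_Pair Ck_on_const Ck_on_norm Ck_on_id Ck_on_G) auto
    from comp[OF this] show "Ck_on j {q. fst q \<noteq> 0} (V L)" for j
      unfolding V_def[abs_def] by simp
  qed (auto simp: cone_graph_def)
  moreover have "V L q \<in> normal_space UNIV cone_graph q" if q: "q \<in> cone_graph" for q
  proof -
    obtain y where y: "y \<noteq> 0" "q = (y, F y)" using q unfolding cone_graph_def by auto
    have GG: "G y \<bullet> G y = 1" using norm_G[OF y(1)] by (simp add: dot_square_norm)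
    have "V L q \<bullet> (v, DF y v) = 0" for v
      using y(1) by (simp add: V_def y(2) DF_eq inner_add_right GG G_inner_DG)
    then show ?thesis unfolding y(2) normal_space_graph[OF y(1)] graph_normal_def by simp
  qed
  moreover have "V L q = 0" if q: "q \<in> cone_graph - K" for q
  proof -
    obtain u where u: "u \<noteq> 0" "q = param u" using q unfolding param_image[symmetric] by auto
    then have "u \<notin> Bd" using q unfolding K_def by blast
    then consider "norm u < 1" | "norm u > exp L" unfolding Bd_def by fastforce
    then have "bump (ln (norm u) / L) = 0"
    proof cases
      case 1
      then have "ln (norm u) \<le> 0" using u by simp
      then show ?thesis using L by (intro bump_eq_0) (simp add: divide_le_0_iff)
    next
      case 2
      then have "ln (exp L) < ln (norm u)" using u by (subst ln_less_cancel_iff) auto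
      then show ?thesis using L by (intro bump_eq_0) simp
    qed
    then show ?thesis unfolding u(2) V_param by (simp add: \<psi>_def radial_profile_def zero_prod_def)
  qed
  moreover have "patchwork cone_graph K ?P"
  proof -
    have "Bd \<in> sets borel" using Bd by simp
    moreover have "closure Bd \<subseteq> - {0}" using Bd Bd0 by simp
    ultimately show ?thesis
      unfolding patchwork_def using local_parametrization_param Bd
      by (auto simp: K_def disjoint_family_on_def intro!: exI[of _ "- {0}"])
  qed
  moreover have "\<exists>A' q. (\<forall>\<^sub>F s in nhds 0. (varied_volume ?P (V L) has_real_derivative A' s) (at s)) \<and>
      (A' has_real_derivative q) (at 0) \<and> q < 0"
  proof -
    let ?C = "unit_ball_vol (real DIM(real^'a)) * real DIM(real^'a)"
    let ?g = "radial_profile_deriv m L"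
    let ?I = "\<lambda>s. integral {1..exp L} (\<lambda>r. r ^ (2 * m + 1) * (sqrt (1 + s\<^sup>2 * (?g r)\<^sup>2) * w (s * \<psi> L r)))"
    have c\<psi>: "continuous_on {1..exp L} (\<psi> L)"
      using Ck_on_\<psi>[of 0 L] by (auto intro: continuous_on_subset)
    have cln: "continuous_on {1..exp L} (\<lambda>r. f (ln r / L))" if "continuous_on UNIV f" for f :: "real \<Rightarrow> real"
      by (rule continuous_on_compose2[OF that]) (use L in \<open>auto intro!: continuous_intros\<close>)
    have cg: "continuous_on {1..exp L} ?g"
      unfolding radial_profile_deriv_def[abs_def]
      by (intro continuous_intros cln continuous_on_bump continuous_on_dbump) (use L in auto)
    obtain A' where A': "\<And>s. (?I has_field_derivative A' s) (at s)"
      "(A' has_field_derivative integral {1..exp L} (\<lambda>r. r ^ (2 * m + 1) * ((?g r)\<^sup>2 * w 0 + (\<psi> L r)\<^sup>2 * w2 0))) (at 0)"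
      by (rule second_variation_weighted_length[OF _ cg c\<psi> w_deriv w1_deriv continuous_on_w2,
            of "\<lambda>r. r ^ (2 * m + 1)"]) (auto intro!: continuous_intros)
    obtain M where M: "\<And>r. r \<in> {1..exp L} \<Longrightarrow> \<bar>\<psi> L r\<bar> \<le> M" "M > 0"
    proof -
      have "bounded (\<psi> L ` {1..exp L})"
        by (intro compact_imp_bounded compact_continuous_image c\<psi>) simp
      then show ?thesis using that unfolding bounded_pos by (metis imageI real_norm_def)
    qed
    \<comment> \<open>For \<open>\<bar>s\<bar> < \<epsilon>\<close> the coefficient
      \<open>cos \<theta> - s * sin \<theta> * \<psi> L r\<close> is nonnegative on the annulus, as
      \<open>volume_density_varied\<close> requires.\<close>
    define \<epsilon> where "\<epsilon> = cos \<theta> / (sin \<theta> * M)"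
    have \<epsilon>: "\<epsilon> > 0" using cos_pos sin_pos M by (simp add: \<epsilon>_def)
    have vol: "varied_volume ?P (V L) s = ?C * ?I s" if s: "\<bar>s\<bar> < \<epsilon>" for s
    proof -
      have "varied_volume ?P (V L) s = (LINT u:Bd|lborel. volume_density (\<lambda>u. param u + s *\<^sub>R V L (param u)) u)"
        by (simp add: varied_volume_def)
      also have "\<dots> = (LINT u:Bd|lborel. (\<lambda>r. sqrt (1 + s\<^sup>2 * (?g r)\<^sup>2) * w (s * \<psi> L r)) (norm u))"
      proof (rule set_lebesgue_integral_cong)
        show "\<forall>u. u \<in> Bd \<longrightarrow> volume_density (\<lambda>u. param u + s *\<^sub>R V L (param u)) u =
            (\<lambda>r. sqrt (1 + s\<^sup>2 * (?g r)\<^sup>2) * w (s * \<psi> L r)) (norm u)"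
        proof (intro allI impI)
          fix u assume u: "u \<in> Bd"
          have "s * sin \<theta> * \<psi> L (norm u) \<le> \<bar>s\<bar> * sin \<theta> * \<bar>\<psi> L (norm u)\<bar>"
            using sin_pos by (metis abs_ge_self abs_mult abs_of_pos)
          also have "\<dots> \<le> \<epsilon> * sin \<theta> * M"
            using s sin_pos M(1)[of "norm u"] u \<epsilon> by (intro mult_mono) (auto simp: Bd_def)
          also have "\<dots> = cos \<theta>" using sin_pos M(2) by (simp add: \<epsilon>_def)
          finally show "volume_density (\<lambda>u. param u + s *\<^sub>R V L (param u)) u =
              (\<lambda>r. sqrt (1 + s\<^sup>2 * (?g r)\<^sup>2) * w (s * \<psi> L r)) (norm u)"
            using u Bd0 L by (intro volume_density_varied) auto
        qed
      qed (use Bd in auto)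
      also have "\<dots> = ?C * integral {1..exp L} (\<lambda>r. r ^ (DIM(real^'a) - 1) * (sqrt (1 + s\<^sup>2 * (?g r)\<^sup>2) * w (s * \<psi> L r)))"
        unfolding Bd_def
      proof (rule integral_radial)
        have "continuous_on UNIV w" using w_deriv by (auto intro!: continuous_at_imp_continuous_on DERIV_isCont)
        then have "continuous_on {1..exp L} (\<lambda>r. w (s * \<psi> L r))"
          by (rule continuous_on_compose2) (auto intro!: continuous_intros c\<psi>)
        then show "continuous_on {1..exp L} (\<lambda>r. sqrt (1 + s\<^sup>2 * (?g r)\<^sup>2) * w (s * \<psi> L r))"
          by (intro continuous_intros cg)
      qed (use L in auto)
      finally show ?thesis by (simp add: card_a)
    qed
    have "(varied_volume ?P (V L) has_real_derivative ?C * A' s) (at s)" if "s \<in> {-\<epsilon><..<\<epsilon>}" for s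
      by (rule has_field_derivative_transform_within_open[OF DERIV_cmult[OF A'(1)[of s], of ?C] _ that])
         (use vol in auto)
    moreover have "\<forall>\<^sub>F s in nhds 0. s \<in> {-\<epsilon><..<\<epsilon>}"
      using \<epsilon> by (intro eventually_nhds_in_open) auto
    ultimately have "\<forall>\<^sub>F s in nhds 0. (varied_volume ?P (V L) has_real_derivative ?C * A' s) (at s)"
      by (auto elim: eventually_mono)
    moreover note DERIV_cmult[OF A'(2), of ?C]
    moreover have "?C * integral {1..exp L} (\<lambda>r. r ^ (2 * m + 1) * ((?g r)\<^sup>2 * w 0 + (\<psi> L r)\<^sup>2 * w2 0)) < 0"
    proof -
      \<comment> \<open>By \<open>w2_0\<close> the positive constant \<open>w 0\<close> factors out,
        and what remains is the integrand of \<open>Hardy_sharp\<close>.\<close>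
      have "(\<lambda>r. r ^ (2 * m + 1) * ((?g r)\<^sup>2 * w 0 + (\<psi> L r)\<^sup>2 * w2 0)) =
        (\<lambda>r. w 0 * (r ^ (2 * m + 1) * ((?g r)\<^sup>2 - \<kappa> * (radial_profile m L r / r)\<^sup>2)))"
        unfolding w2_0 \<psi>_def by (auto simp: fun_eq_iff algebra_simps)
      moreover have "?C > 0" by simp
      ultimately show ?thesis
        using neg w_pos by (simp only: integral_mult_right mult_pos_neg)
    qed
    ultimately show ?thesis by (intro exI conjI)
  qed
  ultimately show ?thesis
    unfolding unstable_cone_def cone_minus_0 by blast
qed

end

section \<open>From the hypotheses on the map to the two families of Type (II)\<close>

lemma LOMSE_type_cone_unstable:
  fixes f :: "real^'a \<Rightarrow> real^'b"
  assumes f: "LOMSE_type f (2 * m + 1) (2 * m) k" and m: "m > 0" and k: "k > 0" and \<theta>: "LO_angle f \<theta>"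
    and \<kappa>: "(2 * real m + 1) * (1 - (2 * real m + 1) / (real m * (real k * (real k + 2 * real m) / (2 * real m))))
      > (real m)\<^sup>2"
  shows "minimal_cone CARD('a) (LO_cone f \<theta>) \<and> unstable_cone TYPE('a) (LO_cone f \<theta>)"
proof -
  have card: "CARD('a) = 2 * m + 2" using f by (simp add: LOMSE_type_def)
  have unit: "f ` sphere 0 1 \<subseteq> sphere 0 1"
    using f by (simp add: LOMSE_type_def LOMSE_def LOM_def)
  have "\<forall>i. \<exists>P. real_polynomial_function P \<and> (\<forall>t y. P (t *\<^sub>R y) = t ^ k * P y) \<and>
      (\<forall>y. laplacian P y = 0) \<and> (\<forall>x\<in>sphere 0 1. f x $ i = P x)"
    using f by (simp add: LOMSE_type_def spherical_harmonic_def)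
  then obtain P where P: "\<And>i. real_polynomial_function (P i)" "\<And>i t y. P i (t *\<^sub>R y) = t ^ k * P i y"
      "\<And>i y. laplacian (P i) y = 0" "\<And>i x. x \<in> sphere 0 1 \<Longrightarrow> f x $ i = P i x"
    by metis
  interpret H: harmonic_sphere_map P k
  proof
    fix x :: "real^'a" assume x: "norm x = 1"
    then have "f x \<in> sphere 0 1" by (intro subsetD[OF unit] imageI) simp
    then have "norm (f x) = 1" by simp
    then have "f x \<bullet> f x = 1" by (simp add: dot_square_norm)
    then show "(\<Sum>i\<in>UNIV. (P i x)\<^sup>2) = 1"
      using P(4) x by (simp add: inner_vec_def power2_eq_square)
  qed (use P k in auto)
  have fG: "f x = H.G x" if "x \<in> sphere 0 1" for x
    using that P(4) by (simp add: H.G_unit_sphere vec_eq_iff)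
  then have link: "LO_link f \<theta> = LO_link H.G \<theta>"
    unfolding LO_link_def by force
  then have cone: "LO_cone f \<theta> = LO_cone H.G \<theta>"
    unfolding LO_cone_def by simp
  interpret M: LO_minimal_type_II P k \<theta> m "real k * (real k + 2 * real m) / (2 * real m)"
    "(2 * real m + 1) * (1 - (2 * real m + 1) / (real m * (real k * (real k + 2 * real m) / (2 * real m))))"
  proof
    show "0 < \<theta>" "\<theta> < pi / 2" using \<theta> by (simp_all add: LO_angle_def)
    show "mean_curvature (sphere 0 1) (LO_link H.G \<theta>) q = 0" if "q \<in> LO_link H.G \<theta>" for q
      using that \<theta> unfolding LO_angle_def minimal_submanifold_def link by blast
    fix x :: "real^'a" assume x: "norm x = 1"
    let ?D = "sphere_differential f x" and ?T = "{v. v \<bullet> x = 0}"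
    have T: "tangent_space (sphere 0 1) x = ?T" by (rule tangent_space_sphere[OF x])
    have x0: "x \<noteq> 0" and xs: "x \<in> sphere 0 1" using x by auto
    \<comment> \<open>\<open>sphere_differential\<close> is a derivative picked within the sphere
      and need not equal \<open>H.DG x\<close>; this makes the two comparable on tangent
      vectors.\<close>
    have DG: "(f has_derivative H.DG x) (at x within sphere 0 1)"
      by (rule has_derivative_transform[OF xs _ has_derivative_at_withinI[OF H.G_deriv[OF x0]]])
         (simp add: fG)
    then have "f differentiable (at x within sphere 0 1)" unfolding differentiable_def by blast
    then have D: "(f has_derivative ?D) (at x within sphere 0 1)"
      unfolding sphere_differential_def by (simp add: frechet_derivative_works)
    \<comment> \<open>Here \<open>\<sigma>\<close> may still depend on \<open>x\<close>;
      \<open>adapted_frame\<close> identifies its square with the same number at every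
      point.\<close>
    obtain \<sigma> where \<sigma>: "\<sigma> > 0" "singular_values ?D ?T = {0, \<sigma>}"
      using f xs T unfolding LOMSE_type_def LOMSE_def by metis
    have "\<sigma> \<in> singular_values ?D (tangent_space (sphere 0 1) x)" using \<sigma>(2) T by simp
    then have "dim (singular_space ?D ?T \<sigma>) = 2 * m"
      using f xs \<sigma>(1) unfolding LOMSE_type_def T[symmetric] by blast
    then obtain E0 E1 where E: "orthonormal_basis ?T (E0 \<union> E1)" "E0 \<inter> E1 = {}"
      "card E0 + 2 * m + 1 = CARD('a)" "card E1 = 2 * m" "\<And>e. e \<in> E0 \<Longrightarrow> H.DG x e = 0"
      "\<And>e w. e \<in> E1 \<Longrightarrow> H.DG x e \<bullet> H.DG x w = real k * (real k + real CARD('a) - 2) / real (2 * m) * (e \<bullet> w)"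
      using H.adapted_frame[OF x has_derivative_linear[OF D] _ \<sigma>(2,1), of "2 * m"]
        has_derivative_within_unique_on_tangent[OF D DG] T m by auto
    show "\<exists>E0 E1. orthonormal_basis ?T (E0 \<union> E1) \<and> E0 \<inter> E1 = {} \<and> card E0 = 1 \<and> card E1 = 2 * m \<and>
      (\<forall>e\<in>E0. H.DG x e = 0) \<and>
      (\<forall>e\<in>E1. \<forall>w. H.DG x e \<bullet> H.DG x w = real k * (real k + 2 * real m) / (2 * real m) * (e \<bullet> w))"
    proof (intro exI conjI ballI allI)
      show "card E0 = 1" using E(3) card by simp
      show "H.DG x e \<bullet> H.DG x w = real k * (real k + 2 * real m) / (2 * real m) * (e \<bullet> w)"
        if "e \<in> E1" for e w
        using E(6)[OF that] by (simp add: card)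
    qed (use E in auto)
  qed (use m card \<kappa> in auto)
  show ?thesis
    unfolding cone using M.minimal_cone_LO_cone[OF M.minimal] M.unstable by blast
qed

theorem theorem1p1:
  fixes f :: "real^'a \<Rightarrow> real^'b" and \<theta> :: real
  assumes "LOMSE f" and "Type_II f" and "LO_angle f \<theta>"
  shows "minimal_cone CARD('a) (LO_cone f \<theta>) \<and> unstable_cone TYPE('a) (LO_cone f \<theta>)"
proof -
  obtain n p k where f: "LOMSE_type f n p k"
    and cases: "(n, p) = (3, 2) \<and> k \<ge> 4 \<or> (n, p) = (5, 4) \<and> k \<ge> 6"
    using assms(2) unfolding Type_II_def by blast
  from cases show ?thesis
  proof (elim disjE conjE)
    assume np: "(n, p) = (3, 2)" and k: "k \<ge> 4"
    \<comment> \<open>For \<open>m = 1\<close> the condition \<open>\<kappa> > 1\<close> reads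
      \<open>k * (k + 2) > 9\<close>: among even degrees \<open>4\<close> is the first to satisfy
      it.\<close>
    have "real k * (real k + 2) \<ge> 4 * (4 + 2)" using k by (intro mult_mono) auto
    then have "3 * (1 - 3 / (real k * (real k + 2) / 2)) > (1 :: real)" by (simp add: field_simps)
    then show ?thesis
      using LOMSE_type_cone_unstable[of f 1 k \<theta>] f np k assms(3) by simp
  next
    assume np: "(n, p) = (5, 4)" and k: "k \<ge> 6"
    \<comment> \<open>For \<open>m = 2\<close> the condition \<open>\<kappa> > 4\<close> reads
      \<open>k * (k + 4) > 50\<close>: degree \<open>4\<close> gives \<open>32\<close>, degree
      \<open>6\<close> gives \<open>60\<close>.\<close>
    have "real k * (real k + 4) \<ge> 6 * (6 + 4)" using k by (intro mult_mono) auto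
    then have "5 * (1 - 5 / (2 * (real k * (real k + 4) / 4))) > (4 :: real)" by (simp add: field_simps)
    then show ?thesis
      using LOMSE_type_cone_unstable[of f 2 k \<theta>] f np k assms(3) by simp
  qed
qed

end
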